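(* Let $(\Omega,\mathcal{A},T,\mu,\mathcal{F},\|\cdot\|,\chi)$ fulfill Property $\mathfrak{D}$ and let $\chi:\Omega\to\mathbb{R}_{\ge0}$ be such that $\mu(\chi>x)=L(x)/x^{\alpha}$ with $L$ a slowly varying function and $0<\alpha<1$. Further, let $(b_n)_{n\in\mathbb{N}}$ be a sequence of natural numbers tending to infinity with $b_n=o(n)$. If there exists $\psi\in\Psi$ such that $$\lim_{n\to\infty}\frac{b_n}{\log\psi(\lfloor\log n\rfloor)}=\infty,$$ then there exists a positive valued sequence $(d_n)_{n\in\mathbb{N}}$ such that $$\lim_{n\to\infty}\frac{\mathsf{S}_n^{b_n}\chi}{d_n}=1\quad\mu\text{-almost surely,}$$ and $(d_n)$ fulfills $$d_n\sim\frac{\alpha}{1-\alpha}\cdot n^{1/\alpha}\cdot b_n^{1-1/\alpha}\cdot\left(L^{1/\alpha}\right)^{\#}\!\left(\left(\frac{n}{b_n}\right)^{1/\alpha}\right)\qquad(n\to\infty).$$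
   Context: Transfer operator. For a non-singular transformation $T$ of a probability space $(\Omega,\mathcal{A},\mu)$, $\widehat T:\mathcal{L}^1\to\mathcal{L}^1$ is the unique operator with $\int \widehat T f\cdot g\,\mathrm{d}\mu=\int f\cdot g\circ T\,\mathrm{d}\mu$ for all $f\in\mathcal{L}^1$, $g\in\mathcal{L}^\infty$. $|\cdot|_\infty$ is the $\mathcal{L}^\infty$ norm. Spectral gap. A bounded linear operator $U$ on a Banach space has a spectral gap if $U=\lambda P+N$ with $\lambda\in\mathbb{C}$ and $P,N$ bounded linear operators such that $P^2=P$, $\dim \mathrm{Im}(P)=1$, $\rho(N)<|\lambda|$ ($\rho$ = spectral radius), and $PN=NP=0$. Property $\mathfrak{C}$. Let $\mathcal{F}$ be a subset of the measurable functions forming a Banach algebra with respect to a norm $\|\cdot\|$. $(\Omega,\mathcal{A},T,\mu,\mathcal{F},\|\cdot\|)$ has Property $\mathfrak{C}$ if: $\mu$ is a $T$-invariant, mixing probability measure; $\mathcal{F}$ contains the constant functions and $\|f\|\ge|f|_\infty$ for all $f\in\mathcal{F}$; there is $K_0>0$ with $\|\widehat T f\|\le K_0\|f\|$ for all $f\in\mathcal{F}$; $\widehat T$ has a spectral gap on $\mathcal{F}$ with respect to $\|\cdot\|$. Property $\mathfrak{D}$. Let $\chi:\Omega\to\mathbb{R}_{\ge0}$ be measurable and ${}^{\ell}\chi:=\chi\cdot\mathbb{1}_{\{\chi\le\ell\}}$ for $\ell\ge0$. $(\Omega,\mathcal{A},T,\mu,\mathcal{F},\|\cdot\|,\chi)$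 has Property $\mathfrak{D}$ if $(\Omega,\mathcal{A},T,\mu,\mathcal{F},\|\cdot\|)$ has Property $\mathfrak{C}$ and there are $K_1,K_2>0$ such that for all $\ell>0$: $\|{}^{\ell}\chi\|\le K_1\ell$ and $\|\mathbb{1}_{\{\chi>\ell\}}\|\le K_2$. Trimmed sums. For each $n$ (and each point of $\Omega$) choose a permutation $\sigma$ of $\{0,\dots,n-1\}$ with $\chi\circ T^{\sigma(0)}\ge\chi\circ T^{\sigma(1)}\ge\dots\ge\chi\circ T^{\sigma(n-1)}$; for $b_n\in\mathbb{N}_0$ put $\mathsf{S}_n^{b_n}\chi:=\sum_{k=b_n}^{n-1}\chi\circ T^{\sigma(k)}$, i.e. the Birkhoff sum with the $b_n$ largest terms removed. Further notation. $\Psi:=\{u:\mathbb{N}\to\mathbb{R}^+:\ \sum_{n=1}^\infty 1/u(n)<\infty\}$. $\lfloor x\rfloor$ is the largest integer not exceeding $x$. $u\sim w$ means $u/w\to1$ at infinity. $L$ is slowly varying if $L(cx)\sim L(x)$ as $x\to\infty$ for every $c>0$. The de Bruijn conjugate $M^{\#}$ of a function $M$ slowly varying at infinity is a slowly varying function (it exists and is unique up to asymptotic equivalence) satisfying $\lim_{x\to\infty}M(x)\,M^{\#}(xM(x))=1=\lim_{x\to\infty}M^{\#}(x)\,M(xM^{\#}(x))$.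
   Formalization: The norming formula uses the de Bruijn conjugate of L^{-1/α} instead of L^{1/α}; as printed the formula fails already for χ(x)=c·x^{-1/α} with c≠1 under the doubling map, where d_n must scale like c, not 1/c. *)

theory Defs
  imports
    "HOL-Probability.Probability"
    "HOL-Probability.Essential_Supremum"
    "HOL-Combinatorics.Permutations"
    "HOL-Library.Landau_Symbols"
begin

text \<open>
  A space of almost-everywhere classes of complex functions on \<open>space M\<close> is represented by the set
  \<open>F\<close> of all representatives of its elements, together with a norm \<open>nrm\<close> that depends only on the
  class. Equality of elements of \<open>F\<close> is equality almost everywhere.
\<close>

definition ae_eq :: "'a measure \<Rightarrow> ('a \<Rightarrow> complex) \<Rightarrow> ('a \<Rightarrow> complex) \<Rightarrow> bool" where
  "ae_eq M f g \<longleftrightarrow> (AE x in M. f x = g x)"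

definition Linf_norm :: "'a measure \<Rightarrow> ('a \<Rightarrow> complex) \<Rightarrow> ereal" where
  "Linf_norm M f = esssup M (\<lambda>x. ereal (cmod (f x)))"

definition Linf :: "'a measure \<Rightarrow> ('a \<Rightarrow> complex) set" where
  "Linf M = {f \<in> borel_measurable M. Linf_norm M f < \<infinity>}"

definition banach_function_algebra ::
    "'a measure \<Rightarrow> ('a \<Rightarrow> complex) set \<Rightarrow> (('a \<Rightarrow> complex) \<Rightarrow> real) \<Rightarrow> bool" where
  "banach_function_algebra M F nrm \<longleftrightarrow>
     F \<subseteq> borel_measurable M \<and>
     (\<forall>f\<in>F. \<forall>g\<in>borel_measurable M. ae_eq M f g \<longrightarrow> g \<in> F \<and> nrm g = nrm f) \<and>
     (\<lambda>_. 0) \<in> F \<and>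
     (\<forall>f\<in>F. \<forall>g\<in>F. (\<lambda>x. f x + g x) \<in> F \<and> nrm (\<lambda>x. f x + g x) \<le> nrm f + nrm g) \<and>
     (\<forall>c. \<forall>f\<in>F. (\<lambda>x. c * f x) \<in> F \<and> nrm (\<lambda>x. c * f x) = cmod c * nrm f) \<and>
     (\<forall>f\<in>F. nrm f = 0 \<longleftrightarrow> ae_eq M f (\<lambda>_. 0)) \<and>
     (\<forall>f\<in>F. \<forall>g\<in>F. (\<lambda>x. f x * g x) \<in> F \<and> nrm (\<lambda>x. f x * g x) \<le> nrm f * nrm g) \<and>
     (\<forall>u. (\<forall>n::nat. u n \<in> F) \<and>
          (\<forall>e>0. \<exists>N. \<forall>m\<ge>N. \<forall>n\<ge>N. nrm (\<lambda>x. u m x - u n x) < e) \<longrightarrow>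
          (\<exists>f\<in>F. (\<lambda>n. nrm (\<lambda>x. u n x - f x)) \<longlonglongrightarrow> 0))"

text \<open>
  Linearity is required up to null sets. Together with boundedness it implies that the operator
  respects equality almost everywhere, i.e. acts on classes.
\<close>

definition bounded_operator ::
    "'a measure \<Rightarrow> ('a \<Rightarrow> complex) set \<Rightarrow> (('a \<Rightarrow> complex) \<Rightarrow> real) \<Rightarrow>
     (('a \<Rightarrow> complex) \<Rightarrow> 'a \<Rightarrow> complex) \<Rightarrow> bool" where
  "bounded_operator M F nrm U \<longleftrightarrow>
     (\<forall>f\<in>F. U f \<in> F) \<and>
     (\<forall>f\<in>F. \<forall>g\<in>F. ae_eq M (U (\<lambda>x. f x + g x)) (\<lambda>x. U f x + U g x)) \<and>
     (\<forall>c. \<forall>f\<in>F. ae_eq M (U (\<lambda>x. c * f x)) (\<lambda>x. c * U f x)) \<and>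
     (\<exists>K. \<forall>f\<in>F. nrm (U f) \<le> K * nrm f)"

definition operator_spectrum ::
    "'a measure \<Rightarrow> ('a \<Rightarrow> complex) set \<Rightarrow> (('a \<Rightarrow> complex) \<Rightarrow> real) \<Rightarrow>
     (('a \<Rightarrow> complex) \<Rightarrow> 'a \<Rightarrow> complex) \<Rightarrow> complex set" where
  "operator_spectrum M F nrm U =
     {z. \<not> (\<exists>R. bounded_operator M F nrm R \<and>
              (\<forall>f\<in>F. ae_eq M (R (\<lambda>x. z * f x - U f x)) f \<and>
                     ae_eq M (\<lambda>x. z * R f x - U (R f) x) f))}"

definition operator_spectral_radius ::
    "'a measure \<Rightarrow> ('a \<Rightarrow> complex) set \<Rightarrow> (('a \<Rightarrow> complex) \<Rightarrow> real) \<Rightarrow>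
     (('a \<Rightarrow> complex) \<Rightarrow> 'a \<Rightarrow> complex) \<Rightarrow> ereal" where
  "operator_spectral_radius M F nrm U = (SUP z\<in>operator_spectrum M F nrm U. ereal (cmod z))"

definition one_dimensional_image ::
    "'a measure \<Rightarrow> ('a \<Rightarrow> complex) set \<Rightarrow> (('a \<Rightarrow> complex) \<Rightarrow> 'a \<Rightarrow> complex) \<Rightarrow> bool" where
  "one_dimensional_image M F P \<longleftrightarrow>
     (\<exists>p\<in>P ` F. \<not> ae_eq M p (\<lambda>_. 0) \<and> (\<forall>q\<in>P ` F. \<exists>c. ae_eq M q (\<lambda>x. c * p x)))"

definition has_spectral_gap ::
    "'a measure \<Rightarrow> ('a \<Rightarrow> complex) set \<Rightarrow> (('a \<Rightarrow> complex) \<Rightarrow> real) \<Rightarrow>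
     (('a \<Rightarrow> complex) \<Rightarrow> 'a \<Rightarrow> complex) \<Rightarrow> bool" where
  "has_spectral_gap M F nrm U \<longleftrightarrow>
     bounded_operator M F nrm U \<and>
     (\<exists>lam P N.
        bounded_operator M F nrm P \<and> bounded_operator M F nrm N \<and>
        (\<forall>f\<in>F. ae_eq M (U f) (\<lambda>x. lam * P f x + N f x)) \<and>
        (\<forall>f\<in>F. ae_eq M (P (P f)) (P f)) \<and>
        one_dimensional_image M F P \<and>
        operator_spectral_radius M F nrm N < ereal (cmod lam) \<and>
        (\<forall>f\<in>F. ae_eq M (P (N f)) (\<lambda>_. 0) \<and> ae_eq M (N (P f)) (\<lambda>_. 0)))"

text \<open>
  For \<open>f\<close> integrable and \<open>T\<close> non-singular the condition determines \<open>g\<close> up to a null set;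
  \<open>transfer_op M T f\<close> is one of its versions.
\<close>

definition transfer_op :: "'a measure \<Rightarrow> ('a \<Rightarrow> 'a) \<Rightarrow> ('a \<Rightarrow> complex) \<Rightarrow> 'a \<Rightarrow> complex" where
  "transfer_op M T f =
     (SOME g. integrable M g \<and>
        (\<forall>h\<in>Linf M. (LINT x|M. g x * h x) = (LINT x|M. f x * h (T x))))"

definition invariant_measure :: "'a measure \<Rightarrow> ('a \<Rightarrow> 'a) \<Rightarrow> bool" where
  "invariant_measure M T \<longleftrightarrow> T \<in> measurable M M \<and> distr M M T = M"

definition mixing :: "'a measure \<Rightarrow> ('a \<Rightarrow> 'a) \<Rightarrow> bool" where
  "mixing M T \<longleftrightarrow>
     (\<forall>A\<in>sets M. \<forall>B\<in>sets M.
        (\<lambda>n. measure M (A \<inter> ((T ^^ n) -` B \<inter> space M))) \<longlonglongrightarrow> measure M A * measure M B)"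

definition property_C ::
    "'a measure \<Rightarrow> ('a \<Rightarrow> 'a) \<Rightarrow> ('a \<Rightarrow> complex) set \<Rightarrow> (('a \<Rightarrow> complex) \<Rightarrow> real) \<Rightarrow> bool" where
  "property_C M T F nrm \<longleftrightarrow>
     prob_space M \<and> invariant_measure M T \<and> mixing M T \<and>
     banach_function_algebra M F nrm \<and>
     (\<forall>c. (\<lambda>_. c) \<in> F) \<and>
     (\<forall>f\<in>F. Linf_norm M f \<le> ereal (nrm f)) \<and>
     (\<exists>K0>0. \<forall>f\<in>F. transfer_op M T f \<in> F \<and> nrm (transfer_op M T f) \<le> K0 * nrm f) \<and>
     has_spectral_gap M F nrm (transfer_op M T)"

definition truncation :: "real \<Rightarrow> ('a \<Rightarrow> real) \<Rightarrow> 'a \<Rightarrow> real" where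
  "truncation l chi x = chi x * indicator {y. chi y \<le> l} x"

definition property_D ::
    "'a measure \<Rightarrow> ('a \<Rightarrow> 'a) \<Rightarrow> ('a \<Rightarrow> complex) set \<Rightarrow> (('a \<Rightarrow> complex) \<Rightarrow> real) \<Rightarrow>
     ('a \<Rightarrow> real) \<Rightarrow> bool" where
  "property_D M T F nrm chi \<longleftrightarrow>
     property_C M T F nrm \<and>
     chi \<in> borel_measurable M \<and> (\<forall>x\<in>space M. chi x \<ge> 0) \<and>
     (\<exists>K1>0. \<exists>K2>0. \<forall>l>0.
        (\<lambda>x. complex_of_real (truncation l chi x)) \<in> F \<and>
        nrm (\<lambda>x. complex_of_real (truncation l chi x)) \<le> K1 * l \<and>
        (\<lambda>x. indicator {y. chi y > l} x) \<in> F \<and>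
        nrm (\<lambda>x. indicator {y. chi y > l} x) \<le> K2)"

definition decreasing_arrangement ::
    "('a \<Rightarrow> 'a) \<Rightarrow> ('a \<Rightarrow> real) \<Rightarrow> nat \<Rightarrow> 'a \<Rightarrow> (nat \<Rightarrow> nat) \<Rightarrow> bool" where
  "decreasing_arrangement T chi n x \<sigma> \<longleftrightarrow>
     \<sigma> permutes {..<n} \<and>
     (\<forall>i j. i \<le> j \<and> j < n \<longrightarrow> chi ((T ^^ \<sigma> j) x) \<le> chi ((T ^^ \<sigma> i) x))"

text \<open>Different arrangements differ only in the order of ties, so the sum does not depend on the choice.\<close>

definition trimmed_sum :: "('a \<Rightarrow> 'a) \<Rightarrow> ('a \<Rightarrow> real) \<Rightarrow> nat \<Rightarrow> nat \<Rightarrow> 'a \<Rightarrow> real" where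
  "trimmed_sum T chi n b x =
     (let \<sigma> = (SOME \<sigma>. decreasing_arrangement T chi n x \<sigma>)
      in \<Sum>k=b..<n. chi ((T ^^ \<sigma> k) x))"

text \<open>The sequences in \<open>Psi\<close> are indexed from 1; the value at 0 is irrelevant.\<close>

definition Psi :: "(nat \<Rightarrow> real) set" where
  "Psi = {u. (\<forall>n\<ge>1. u n > 0) \<and> summable (\<lambda>n. 1 / u (Suc n))}"

definition slowly_varying :: "(real \<Rightarrow> real) \<Rightarrow> bool" where
  "slowly_varying L \<longleftrightarrow>
     (\<forall>\<^sub>F x in at_top. L x > 0) \<and> (\<forall>c>0. (\<lambda>x. L (c * x)) \<sim>[at_top] L)"

definition is_de_bruijn_conjugate :: "(real \<Rightarrow> real) \<Rightarrow> (real \<Rightarrow> real) \<Rightarrow> bool" where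
  "is_de_bruijn_conjugate M G \<longleftrightarrow>
     slowly_varying G \<and>
     ((\<lambda>x. M x * G (x * M x)) \<longlongrightarrow> 1) at_top \<and>
     ((\<lambda>x. G x * M (x * G x)) \<longlongrightarrow> 1) at_top"

text \<open>
  Only the asymptotic behaviour of the conjugate is determined. With this normalisation, if
  \<open>G\<close> is the conjugate of \<open>L\<^bsup>-1/\<alpha>\<^esup>\<close> then \<open>x = y * G y\<close> solves \<open>L x / x\<^bsup>\<alpha>\<^esup> \<sim> y\<^bsup>-\<alpha>\<^esup>\<close> asymptotically. The
  conjugate of \<open>L\<^bsup>1/\<alpha>\<^esup>\<close> does not: it fails already for \<open>L\<close> constant and different from 1. Hence the
  exponent \<open>-1/\<alpha>\<close>, not \<open>1/\<alpha>\<close>, in norming sequences for tails \<open>L x / x\<^bsup>\<alpha>\<^esup>\<close>.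
\<close>

definition de_bruijn_conjugate :: "(real \<Rightarrow> real) \<Rightarrow> real \<Rightarrow> real" where
  "de_bruijn_conjugate M = (SOME G. is_de_bruijn_conjugate M G)"

end

(*
  The spectral gap gives exponential decay of correlations in the norm of the algebra: bounds for the
  resolvent of N, averaged over the n-th roots of r^n, control N^n; since the transfer operator
  contracts L^1 and fixes constants, the leading eigenvalue is 1 and the projection is the integral.

  For an observable 0 <= f <= 1 with bounded norm and mean p, the twisted operator
  g |-> That ((1 + s f) g) has moments at most exp (n p (s + D s^2)), because the deviation of its
  iterates from their mean is O(|s|) relative to the mean. Chernoff's argument yields
  P(|S_n f - n p| > e n p) <= 2 exp (- c n p), with c depending only on e and on the norm bound.

  This is applied to the indicator of {chi > t} and to chi 1{chi <= t} / t, whose norms are bounded in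
  t. If at most (at least) b_n terms exceed t, then the trimmed sum is at most (at least) the sum of
  the truncated terms. With t the quantile of the tail at b_n / n, Karamata's theorem gives the
  truncated mean, so that d_n = alpha / (1 - alpha) * b_n * t. The exceptional events are summed over
  geometric blocks of n and over all possible values of b_n; the growth condition on b_n makes the
  result summable, and Borel-Cantelli applies.
*)
theory Submission
  imports
    Defs "HOL-Library.Function_Algebras"
begin

section \<open>Regularly varying tails\<close>

text \<open>The means in question tend to 0: at the quantile of b_n / n the expected count is only
  of order b_n, which may grow barely faster than log (log n). An error estimate without the factor
  p would be useless, so every error must carry it. This is possible because a nonnegative
  observable is integrated against functions whose essential bound is dominated by the algebra norm.
  Nothing relates the values of b_n inside one block to each other, hence the union over all
  admissible trimming numbers m. Their failure probabilities form a geometric series governed by its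
  first term; starting it at m of size log (\<psi> k) / \<delta> produces 1 / \<psi> k, and each k
  accounts for a fixed number of blocks. Counts and truncated sums at a fixed threshold increase
  with n, so only the two ends of a block need be controlled. The tail may jump. Quantiles replace
  inverses, and asymptotics of arguments are recovered from those of tail values by monotonicity.
  Operators are linear only up to null sets; a linear choice of representatives restores exact
  operator identities.\<close>

locale regular_tail =
  fixes G :: "real \<Rightarrow> real" and \<alpha> :: real
  assumes alpha_pos: "0 < \<alpha>"
    and antitone: "x \<le> y \<Longrightarrow> G y \<le> G x"
    and pos: "0 < G x"
    and regular: "0 < c \<Longrightarrow> ((\<lambda>t. G (c * t) / G t) \<longlongrightarrow> c powr - \<alpha>) at_top"
begin

lemma less_of_tail_less: "G y < G x \<Longrightarrow> x < y"
  using antitone[of y x] by linarith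

text \<open>Regular variation at the factor 2 gives geometric decay along \<open>s\<close>,
  \<open>2 * s\<close>, \<open>4 * s\<close>, ... at any rate \<open>k\<close> strictly between 2
  powr - \<alpha> and 1; monotonicity fills the gaps.\<close>

lemma eventually_less:
  assumes "0 < e" shows "\<forall>\<^sub>F t in at_top. G t < e"
proof -
  define k where "k = (1 + 2 powr - \<alpha>) / 2"
  have "(2::real) powr - \<alpha> < 1"
    using alpha_pos by (simp add: powr_less_one)
  hence k: "2 powr - \<alpha> < k" "k < 1" "0 < k"
    by (simp_all add: k_def add_pos_pos)
  have "\<forall>\<^sub>F t in at_top. G (2 * t) / G t < k"
    using order_tendstoD(2)[OF regular[of 2] k(1)] by simp
  then obtain t0 where t0: "\<And>t. t \<ge> t0 \<Longrightarrow> G (2 * t) / G t < k"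
    by (auto simp: eventually_at_top_linorder)
  define s where "s = max 1 t0"
  have step: "G (2 ^ n * s) \<le> k ^ n * G s" for n
  proof (induction n)
    case (Suc n)
    have "1 * s \<le> 2 ^ n * s"
      by (intro mult_right_mono) (auto simp: s_def)
    hence "t0 \<le> 2 ^ n * s"
      unfolding s_def by linarith
    from t0[OF this] have "G (2 * (2 ^ n * s)) \<le> k * G (2 ^ n * s)"
      using pos[of "2 ^ n * s"] by (simp add: field_simps)
    also have "\<dots> \<le> k * (k ^ n * G s)"
      using k Suc by (intro mult_left_mono) auto
    finally show ?case by (simp add: mult_ac)
  qed auto
  have "(\<lambda>n. k ^ n * G s) \<longlonglongrightarrow> 0 * G s"
    using k by (intro tendsto_intros LIMSEQ_realpow_zero) auto
  hence "\<forall>\<^sub>F n in sequentially. k ^ n * G s < e"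
    using assms by (intro order_tendstoD(2)) auto
  then obtain n where "k ^ n * G s < e"
    by (auto simp: eventually_sequentially)
  hence n: "G (2 ^ n * s) < e"
    using step[of n] by linarith
  show ?thesis
    using eventually_ge_at_top[of "2 ^ n * s"]
    by eventually_elim (use n antitone in \<open>meson le_less_trans\<close>)
qed

text \<open>The substitute for inverting \<open>G\<close>. If \<open>s i\<close> were at least
  \<open>m * t i\<close> with \<open>m > c\<close>, monotonicity would push the tail ratio down to
  about m powr - \<alpha>, strictly below its limit c powr - \<alpha>; symmetrically from
  below.\<close>

lemma ratio_of_tail_ratio:
  assumes t: "filterlim t at_top X" and c: "0 < c"
    and lim: "((\<lambda>i. G (s i) / G (t i)) \<longlongrightarrow> c powr - \<alpha>) X"
  shows "((\<lambda>i. s i / t i) \<longlongrightarrow> c) X"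
proof (rule order_tendstoI)
  have mono: "x powr - \<alpha> < y powr - \<alpha>" if "0 < y" "y < x" for x y
    using that alpha_pos by (intro powr_less_mono2_neg) auto
  have tp: "\<forall>\<^sub>F i in X. 0 < t i"
    using t by (simp add: filterlim_at_top_dense)
  {
    fix a assume a: "c < a"
    define m where "m = (c + a) / 2"
    have m: "c < m" "m < a" using a by (auto simp: m_def)
    define l where "l = (c powr - \<alpha> + m powr - \<alpha>) / 2"
    have l: "m powr - \<alpha> < l" "l < c powr - \<alpha>"
      using mono[of c m] c m by (auto simp: l_def)
    have "((\<lambda>i. G (m * t i) / G (t i)) \<longlongrightarrow> m powr - \<alpha>) X"
      using c m by (intro filterlim_compose[OF regular t]) auto
    from order_tendstoD(2)[OF this l(1)] order_tendstoD(1)[OF lim l(2)] tp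
    show "\<forall>\<^sub>F i in X. s i / t i < a"
    proof eventually_elim
      case (elim i)
      hence "G (m * t i) / G (t i) < G (s i) / G (t i)" by linarith
      hence "G (m * t i) < G (s i)"
        using pos[of "t i"] by (simp add: divide_less_cancel)
      hence "s i < m * t i" by (rule less_of_tail_less)
      also have "\<dots> < a * t i" using m elim by simp
      finally show ?case using elim by (simp add: field_simps)
    qed
  }
  {
    fix a assume a: "a < c"
    define m where "m = (max a 0 + c) / 2"
    have m: "a < m" "0 < m" "m < c" using a c by (auto simp: m_def)
    define l where "l = (c powr - \<alpha> + m powr - \<alpha>) / 2"
    have l: "c powr - \<alpha> < l" "l < m powr - \<alpha>"
      using mono[of m c] c m by (auto simp: l_def)
    have "((\<lambda>i. G (m * t i) / G (t i)) \<longlongrightarrow> m powr - \<alpha>) X"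
      using c m by (intro filterlim_compose[OF regular t]) auto
    from order_tendstoD(1)[OF this l(2)] order_tendstoD(2)[OF lim l(1)] tp
    show "\<forall>\<^sub>F i in X. a < s i / t i"
    proof eventually_elim
      case (elim i)
      hence "G (s i) / G (t i) < G (m * t i) / G (t i)" by linarith
      hence "G (s i) < G (m * t i)"
        using pos[of "t i"] by (simp add: divide_less_cancel)
      hence *: "m * t i < s i" by (rule less_of_tail_less)
      have "a * t i < m * t i" using m elim by simp
      with * have "a * t i < s i" by linarith
      thus ?case using elim by (simp add: field_simps)
    qed
  }
qed

section \<open>Generalised inverse of the tail\<close>

definition tail_quantile :: "real \<Rightarrow> real" where
  "tail_quantile p = Inf {x. 0 < x \<and> G x \<le> p}"

lemma tail_quantile_set_nonempty:
  assumes "0 < p" shows "{x. 0 < x \<and> G x \<le> p} \<noteq> {}"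
proof -
  have "\<forall>\<^sub>F t in at_top. 0 < t \<and> G t < p"
    using assms by (intro eventually_conj eventually_less eventually_gt_at_top)
  then obtain x where "0 < x \<and> G x < p"
    by (auto simp: eventually_at_top_linorder)
  thus ?thesis by (auto intro: less_imp_le)
qed

text \<open>\<open>G\<close> may jump, so the infimum itself need not satisfy the defining
  inequality. Hence the strict inequality, here and in the estimates that follow.\<close>

lemma tail_le_of_quantile_less:
  assumes "0 < p" "tail_quantile p < x" shows "G x \<le> p"
proof -
  obtain y where "0 < y" "G y \<le> p" "y < x"
    using assms tail_quantile_set_nonempty[of p]
    unfolding tail_quantile_def by (subst (asm) cInf_less_iff) (auto intro!: bdd_belowI[of _ 0])
  thus ?thesis using antitone[of y x] by linarith
qed

lemma less_tail_of_less_quantile: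
  assumes "0 < x" "x < tail_quantile p" shows "p < G x"
proof (rule ccontr)
  assume "\<not> p < G x"
  hence "tail_quantile p \<le> x"
    using assms unfolding tail_quantile_def by (intro cInf_lower) (auto intro!: bdd_belowI[of _ 0])
  thus False using assms by simp
qed

lemma le_tail_quantile:
  assumes "0 < p" "p < G x" shows "x \<le> tail_quantile p"
  using tail_le_of_quantile_less[of p x] assms by force

lemma tail_quantile_antimono:
  assumes "0 < p" "p \<le> p'" shows "tail_quantile p' \<le> tail_quantile p"
  unfolding tail_quantile_def
  using assms tail_quantile_set_nonempty[of p]
  by (intro cInf_superset_mono) (auto intro!: bdd_belowI[of _ 0])

lemma filterlim_tail_quantile: "filterlim tail_quantile at_top (at_right 0)"
  unfolding filterlim_at_top
proof
  fix Z :: real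
  have "\<forall>\<^sub>F p in at_right 0. 0 < p \<and> p < G Z"
    using pos[of Z] by (auto simp: eventually_at_right_field)
  thus "\<forall>\<^sub>F p in at_right 0. Z \<le> tail_quantile p"
    by eventually_elim (auto intro: le_tail_quantile)
qed

text \<open>Slightly beyond the quantile the tail is at most \<open>p\<close>, slightly before it
  exceeds \<open>p\<close>, and regular variation makes the change of the tail between the two
  points negligible: jumps disappear asymptotically.\<close>

lemma tail_of_quantile: "((\<lambda>p. G (tail_quantile p) / p) \<longlongrightarrow> 1) (at_right 0)"
proof (rule order_tendstoI)
  have big: "\<forall>\<^sub>F p in at_right 0. 0 < p \<and> 0 < tail_quantile p"
    using filterlim_tail_quantile unfolding filterlim_at_top_dense
    by (auto intro: eventually_conj eventually_at_right_less)
  have lim: "((\<lambda>p. G (c * tail_quantile p) / G (tail_quantile p)) \<longlongrightarrow> c powr - \<alpha>) (at_right 0)"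
    if "0 < c" for c
    using filterlim_compose[OF regular[OF that] filterlim_tail_quantile] .
  {
    fix a :: real assume a: "1 < a"
    \<comment> \<open>The extra 2 in the exponent makes the limiting ratio the inverse square root
      of \<open>a\<close>, which leaves room above \<open>1 / a\<close>.\<close>
    define c where "c = a powr (1 / (2 * \<alpha>))"
    have c: "1 < c" "0 < c" and ca: "c powr - \<alpha> = a powr - (1/2)"
      using a alpha_pos by (auto simp: c_def powr_powr)
    have "1 / a < c powr - \<alpha>"
      using a powr_less_mono[of "-1" "-(1/2)" a] unfolding ca by (simp add: powr_minus_divide)
    from order_tendstoD(1)[OF lim[OF c(2)] this] big
    show "\<forall>\<^sub>F p in at_right 0. G (tail_quantile p) / p < a"
    proof eventually_elim
      case (elim p)
      have "G (c * tail_quantile p) \<le> p"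
        using c elim by (intro tail_le_of_quantile_less) auto
      hence "a * G (c * tail_quantile p) \<le> a * p"
        using a by simp
      moreover have "G (tail_quantile p) < a * G (c * tail_quantile p)"
        using elim pos[of "tail_quantile p"] a by (simp add: field_simps)
      ultimately have "G (tail_quantile p) < a * p" by linarith
      thus ?case using elim by (simp add: field_simps)
    qed
  }
  {
    fix a :: real assume a: "a < 1"
    define a' where "a' = max a (1/2)"
    have a': "a \<le> a'" "0 < a'" "a' < 1" using a by (auto simp: a'_def)
    define c where "c = a' powr (1 / (2 * \<alpha>))"
    have c: "c < 1" "0 < c" and ca: "c powr - \<alpha> = a' powr - (1/2)"
      using a' alpha_pos by (auto simp: c_def powr_powr powr01_less_one)
    have "c powr - \<alpha> < 1 / a'"
      using powr_less_mono'[of a' "-1" "-(1/2)"] a' unfolding ca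
      by (simp add: powr_minus_divide[of a' 1] del: powr_minus)
    from order_tendstoD(2)[OF lim[OF c(2)] this] big
    show "\<forall>\<^sub>F p in at_right 0. a < G (tail_quantile p) / p"
    proof eventually_elim
      case (elim p)
      have "p < G (c * tail_quantile p)"
        using c elim by (intro less_tail_of_less_quantile) auto
      hence "a' * p < a' * G (c * tail_quantile p)"
        using a' by simp
      moreover have "a' * G (c * tail_quantile p) < G (tail_quantile p)"
        using elim pos[of "tail_quantile p"] a' by (simp add: field_simps)
      ultimately have "a' * p < G (tail_quantile p)" by linarith
      moreover have "a * p \<le> a' * p" using a' elim by simp
      ultimately have "a * p < G (tail_quantile p)" by linarith
      thus ?case using elim by (simp add: field_simps)
    qed
  }
qed

text \<open>The tail at the quantile of \<open>c * p\<close> is asymptotic to \<open>c * p\<close>,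
  so the two tail values have ratio tending to \<open>c\<close>; the ratio of the arguments
  follows.\<close>

lemma tail_quantile_ratio:
  assumes c: "0 < c"
  shows "((\<lambda>p. tail_quantile (c * p) / tail_quantile p) \<longlongrightarrow> c powr - (1 / \<alpha>)) (at_right 0)"
proof (rule ratio_of_tail_ratio[OF filterlim_tail_quantile])
  have "filterlim (\<lambda>p. c * p) (at_right 0) (at_right 0)"
    unfolding filterlim_at
    using c by (auto intro!: tendsto_eq_intros eventually_at_rightI[of 0 1])
  from filterlim_compose[OF tail_of_quantile this]
  have "((\<lambda>p. c * (G (tail_quantile (c * p)) / (c * p)) / (G (tail_quantile p) / p)) \<longlongrightarrow> c * 1 / 1) (at_right 0)"
    by (intro tendsto_intros tail_of_quantile) auto
  also have "?this \<longleftrightarrow> ((\<lambda>p. G (tail_quantile (c * p)) / G (tail_quantile p)) \<longlongrightarrow> c) (at_right 0)"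
    using c by (intro filterlim_cong refl eventually_at_rightI[of 0 1]) auto
  finally show "((\<lambda>p. G (tail_quantile (c * p)) / G (tail_quantile p)) \<longlongrightarrow> (c powr - (1 / \<alpha>)) powr - \<alpha>) (at_right 0)"
    using alpha_pos c by (simp add: powr_powr)
qed (use c in auto)

section \<open>De Bruijn conjugates and quantiles\<close>

text \<open>With \<open>x * L x powr (- 1 / \<alpha>) = G x powr (- 1 / \<alpha>)\<close> the second defining relation of a conjugate
  says that \<open>y * C y\<close> is asymptotically the quantile at \<open>y powr - \<alpha>\<close>.\<close>

context
  fixes L :: "real \<Rightarrow> real"
  assumes tail: "\<And>x. 0 < x \<Longrightarrow> G x = L x / x powr \<alpha>"
begin

lemma slowly_varying_part_pos: "0 < x \<Longrightarrow> 0 < L x"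
  using tail[of x] pos[of x] by (simp add: zero_less_divide_iff)

lemma conjugate_argument:
  assumes "0 < x" shows "x * L x powr (- 1 / \<alpha>) = G x powr (- 1 / \<alpha>)"
  using assms slowly_varying_part_pos[of x] alpha_pos
  by (simp add: tail powr_divide powr_powr powr_minus field_simps)

lemma quantile_at_powr:
  "filterlim (\<lambda>y::real. y powr - \<alpha>) (at_right 0) at_top"
  using alpha_pos unfolding filterlim_at
  by (auto intro!: tendsto_neg_powr filterlim_ident eventually_gt_at_top simp: eventually_gt_at_top)

text \<open>\<open>de_bruijn_conjugate\<close> is a choice, so nothing is known about it before a
  conjugate is exhibited. Slow variation of the witness is regular variation of the quantile with
  index -1/\<alpha>; the two relations express that quantile and tail are asymptotic inverses in
  either order.\<close>

lemma exists_conjugate: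
  "is_de_bruijn_conjugate (\<lambda>x. L x powr (- 1 / \<alpha>)) (\<lambda>y. tail_quantile (y powr - \<alpha>) / y)"
    (is "is_de_bruijn_conjugate ?M ?C")
  unfolding is_de_bruijn_conjugate_def slowly_varying_def
proof (intro conjI allI impI)
  note Q = filterlim_compose[OF filterlim_tail_quantile quantile_at_powr]
  have Qpos: "\<forall>\<^sub>F y in at_top. 0 < tail_quantile (y powr - \<alpha>) \<and> 0 < y"
    using Q unfolding filterlim_at_top_dense by (auto intro: eventually_conj eventually_gt_at_top)
  thus "\<forall>\<^sub>F y in at_top. 0 < ?C y"
    by eventually_elim auto
  show "(\<lambda>x. ?C (c * x)) \<sim>[at_top] ?C" if c: "0 < c" for c
  proof (rule asymp_equivI')
    have "((\<lambda>y. tail_quantile (c powr - \<alpha> * y powr - \<alpha>) / tail_quantile (y powr - \<alpha>) / c) \<longlongrightarrow>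
             (c powr - \<alpha>) powr - (1 / \<alpha>) / c) at_top"
      using c by (intro tendsto_intros filterlim_compose[OF tail_quantile_ratio quantile_at_powr]) auto
    also have "(c powr - \<alpha>) powr - (1 / \<alpha>) / c = 1"
      using c alpha_pos by (simp add: powr_powr)
    finally show "((\<lambda>x. ?C (c * x) / ?C x) \<longlongrightarrow> 1) at_top"
    proof (rule Lim_transform_eventually)
      show "\<forall>\<^sub>F y in at_top. tail_quantile (c powr - \<alpha> * y powr - \<alpha>) / tail_quantile (y powr - \<alpha>) / c
               = ?C (c * y) / ?C y"
        using Qpos by eventually_elim (use c in \<open>auto simp: powr_mult\<close>)
    qed
  qed
  \<comment> \<open>One order of composition, \<open>G (tail_quantile p) / p\<close>, is already
    known. Taking \<open>p = G x\<close> and passing from tail values to arguments yields the other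
    order.\<close>
  have "((\<lambda>x. tail_quantile (G x) / x) \<longlongrightarrow> 1) at_top"
  proof (rule ratio_of_tail_ratio[OF filterlim_ident])
    have "filterlim G (at_right 0) at_top"
      unfolding filterlim_at
    proof
      show "\<forall>\<^sub>F x in at_top. G x \<in> {0<..} \<and> G x \<noteq> 0"
        using pos by (intro always_eventually allI) (simp add: less_le)
      show "(G \<longlongrightarrow> 0) at_top"
      proof (rule order_tendstoI)
        show "\<forall>\<^sub>F x in at_top. a < G x" if "a < 0" for a
          using that pos by (intro always_eventually allI) (rule less_trans)
      qed (rule eventually_less)
    qed
    from filterlim_compose[OF tail_of_quantile this]
    show "((\<lambda>x. G (tail_quantile (G x)) / G x) \<longlongrightarrow> 1 powr - \<alpha>) at_top" by simp
  qed auto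
  thus "((\<lambda>x. ?M x * ?C (x * ?M x)) \<longlongrightarrow> 1) at_top"
  proof (rule Lim_transform_eventually)
    show "\<forall>\<^sub>F x in at_top. tail_quantile (G x) / x = ?M x * ?C (x * ?M x)"
      using eventually_gt_at_top[of 0]
    proof eventually_elim
      case (elim x)
      have "(x * ?M x) powr - \<alpha> = G x"
        using elim alpha_pos pos[of x] by (simp only: conjugate_argument powr_powr) simp
      thus ?case
        using slowly_varying_part_pos[OF elim] elim by simp
    qed
  qed
  have "((\<lambda>y. (G (tail_quantile (y powr - \<alpha>)) / (y powr - \<alpha>)) powr (- 1 / \<alpha>)) \<longlongrightarrow> 1 powr (- 1 / \<alpha>)) at_top"
    by (intro tendsto_intros filterlim_compose[OF tail_of_quantile quantile_at_powr]) auto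
  hence "((\<lambda>y. (G (tail_quantile (y powr - \<alpha>)) / (y powr - \<alpha>)) powr (- 1 / \<alpha>)) \<longlongrightarrow> 1) at_top" by simp
  thus "((\<lambda>x. ?C x * ?M (x * ?C x)) \<longlongrightarrow> 1) at_top"
  proof (rule Lim_transform_eventually)
    show "\<forall>\<^sub>F y in at_top. (G (tail_quantile (y powr - \<alpha>)) / (y powr - \<alpha>)) powr (- 1 / \<alpha>) = ?C y * ?M (y * ?C y)"
      using Qpos
    proof eventually_elim
      case (elim y)
      let ?t = "tail_quantile (y powr - \<alpha>)"
      have "(G ?t / (y powr - \<alpha>)) powr (- 1 / \<alpha>) = G ?t powr (- 1 / \<alpha>) / y"
        using elim pos[of ?t] alpha_pos by (subst powr_divide) (auto simp: powr_powr)
      also have "\<dots> = ?t * ?M ?t / y"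
        using elim by (simp only: conjugate_argument)
      finally show ?case using elim by simp
    qed
  qed
qed

text \<open>Holds for whichever conjugate is chosen: its second relation, raised to the power
  -\<alpha>, says that the tail at \<open>y * ?C y\<close> is asymptotic to y powr - \<alpha>. So is
  the tail at the quantile, and asymptotically equal tails have asymptotically equal
  arguments.\<close>

lemma conjugate_quantile:
  "((\<lambda>y. y * de_bruijn_conjugate (\<lambda>x. L x powr (- 1 / \<alpha>)) y / tail_quantile (y powr - \<alpha>)) \<longlongrightarrow> 1) at_top"
    (is "((\<lambda>y. y * ?C y / _) \<longlongrightarrow> 1) at_top")
proof (rule ratio_of_tail_ratio)
  let ?M = "\<lambda>x. L x powr (- 1 / \<alpha>)"
  have "is_de_bruijn_conjugate ?M ?C"
    unfolding de_bruijn_conjugate_def by (rule someI[of "is_de_bruijn_conjugate ?M", OF exists_conjugate])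
  hence Cpos: "\<forall>\<^sub>F y in at_top. 0 < ?C y \<and> 0 < y" and lim: "((\<lambda>x. ?C x * ?M (x * ?C x)) \<longlongrightarrow> 1) at_top"
    unfolding is_de_bruijn_conjugate_def slowly_varying_def
    by (auto intro: eventually_conj eventually_gt_at_top)
  have "((\<lambda>y. (?C y * ?M (y * ?C y)) powr - \<alpha> / (G (tail_quantile (y powr - \<alpha>)) / (y powr - \<alpha>))) \<longlongrightarrow> 1 powr - \<alpha> / 1) at_top"
    by (intro tendsto_intros lim filterlim_compose[OF tail_of_quantile quantile_at_powr]) auto
  also have "1 powr - \<alpha> / 1 = 1 powr - \<alpha>" by simp
  finally show "((\<lambda>y. G (y * ?C y) / G (tail_quantile (y powr - \<alpha>))) \<longlongrightarrow> 1 powr - \<alpha>) at_top"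
  proof (rule Lim_transform_eventually)
    show "\<forall>\<^sub>F y in at_top. (?C y * ?M (y * ?C y)) powr - \<alpha> / (G (tail_quantile (y powr - \<alpha>)) / (y powr - \<alpha>))
             = G (y * ?C y) / G (tail_quantile (y powr - \<alpha>))"
      using Cpos
    proof eventually_elim
      case (elim y)
      let ?t = "y * ?C y"
      have t: "0 < ?t" using elim by simp
      have "?C y * ?M ?t = ?t * ?M ?t / y" using elim by simp
      also have "\<dots> = G ?t powr (- 1 / \<alpha>) / y" by (simp only: conjugate_argument[OF t])
      finally have "(?C y * ?M ?t) powr - \<alpha> = G ?t / y powr - \<alpha>"
        using pos[of ?t] elim alpha_pos by (simp only: powr_divide powr_powr) (simp add: less_imp_le powr_divide powr_powr)
      thus ?case using elim by simp
    qed
  qed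
qed (auto intro: filterlim_compose[OF filterlim_tail_quantile quantile_at_powr])

end

end

section \<open>Karamata's theorem for truncated moments\<close>

text \<open>Averaging over scales: a bound on one period \<open>[q * t0, t0]\<close> propagates to infinity, and the
  contraction factor makes its influence vanish.\<close>

lemma eventually_le_of_scaling_contraction:
  fixes v :: "real \<Rightarrow> real"
  assumes q: "0 < q" "q < 1" and k: "0 \<le> k" "k < 1" and t0: "0 < t0" and d: "0 < d"
    and rec: "\<And>t. t0 \<le> t \<Longrightarrow> v t \<le> k * v (q * t) + e"
    and bounded: "\<And>t. q * t0 \<le> t \<Longrightarrow> t \<le> t0 \<Longrightarrow> v t \<le> B"
  shows "\<forall>\<^sub>F t in at_top. v t \<le> e / (1 - k) + d"
proof -
  \<comment> \<open>Subtracting the fixed point \<open>e / (1 - k)\<close> of the affine recursion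
    makes it homogeneous.\<close>
  define w where "w t = v t - e / (1 - k)" for t
  have w_rec: "w t \<le> k * w (q * t)" if "t0 \<le> t" for t
  proof -
    have "e = e / (1 - k) * (1 - k)"
      using k by simp
    hence "e = e / (1 - k) - k * (e / (1 - k))"
      by (simp only: right_diff_distrib mult.commute[of k] mult_1_right)
    thus ?thesis
      using rec[OF that] unfolding w_def right_diff_distrib by linarith
  qed
  \<comment> \<open>\<open>w\<close> may be negative; a nonnegative bound \<open>C\<close> stays a
    bound after multiplication by \<open>k\<close>.\<close>
  define C where "C = max 0 (B - e / (1 - k))"
  have C: "0 \<le> C" by (simp add: C_def)
  have w_base: "w t \<le> C" if "q * t0 \<le> t" "t \<le> t0" for t
    using bounded[OF that] by (simp add: w_def C_def)
  have k_mult: "k * x \<le> C" if "x \<le> C" for x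
    using mult_left_mono[OF that k(1)] mult_right_mono[of k 1 C] k C by linarith
  have w_bdd': "w t \<le> C" if "t0 \<le> t" "t * q ^ m \<le> t0" for m t
    using that
  proof (induction m arbitrary: t)
    case 0
    thus ?case using w_base[of t] q t0 mult_right_mono[of q 1 t0] by simp
  next
    case (Suc m)
    have "w (q * t) \<le> C"
    proof (cases "q * t \<le> t0")
      case True
      thus ?thesis using Suc.prems q by (intro w_base) auto
    next
      case False
      thus ?thesis using Suc.prems by (intro Suc.IH) (auto simp: mult_ac)
    qed
    thus ?case using w_rec[of t] k_mult Suc.prems(1) by fastforce
  qed
  have w_bdd: "w t \<le> C" if "t0 \<le> t" for t
  proof -
    have "0 < t0 / t" using that t0 by simp
    then obtain m where "q ^ m < t0 / t"
      using real_arch_pow_inv[of "t0 / t" q] q by auto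
    thus ?thesis
      using w_bdd'[of t m] that t0 by (simp add: field_simps)
  qed
  have w_pow: "w t \<le> k ^ n * C" if "t0 \<le> t * q ^ n" for n t
    using that
  proof (induction n arbitrary: t)
    case 0
    thus ?case using w_bdd by simp
  next
    case (Suc n)
    have t: "0 < t"
      using less_le_trans[OF t0 Suc.prems] q by (simp add: zero_less_mult_iff del: power_Suc)
    have "t * q ^ Suc n \<le> t * 1"
      using q t by (intro mult_left_mono power_le_one) auto
    hence "w t \<le> k * w (q * t)"
      using Suc.prems by (intro w_rec) simp
    also have "\<dots> \<le> k * (k ^ n * C)"
      using Suc.prems k by (intro mult_left_mono Suc.IH) (auto simp: mult_ac)
    finally show ?case by (simp add: mult_ac)
  qed
  have "(\<lambda>n. k ^ n * C) \<longlonglongrightarrow> 0 * C"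
    using k by (intro tendsto_intros LIMSEQ_realpow_zero) auto
  hence "\<forall>\<^sub>F n in sequentially. k ^ n * C < d"
    using d by (intro order_tendstoD(2)) auto
  then obtain n where n: "k ^ n * C < d"
    by (auto simp: eventually_sequentially)
  show ?thesis
    using eventually_ge_at_top[of "t0 / q ^ n"]
  proof eventually_elim
    case (elim t)
    hence "w t \<le> k ^ n * C"
      using q by (intro w_pow) (simp add: field_simps)
    thus ?case using n by (simp add: w_def)
  qed
qed

text \<open>A quotient of two difference quotients at 1. It evaluates the limit of the fixed points
  of the scaling recursion as the scale \<open>q\<close> tends to 1.\<close>

lemma powr_increment_ratio_at_1:
  fixes a c :: real
  assumes "c \<noteq> 0"
  shows "((\<lambda>q. (q powr a - 1) / (q powr c - 1)) \<longlongrightarrow> a / c) (at_left 1)"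
proof -
  have "((\<lambda>q. (q powr b - 1) / (q - 1)) \<longlongrightarrow> b) (at_left 1)" for b :: real
  proof -
    have "((\<lambda>q. q powr b) has_field_derivative b * 1 powr (b - 1)) (at (1::real) within {..<1})"
      by (intro DERIV_subset[OF has_real_derivative_powr]) auto
    thus ?thesis by (simp add: has_field_derivative_iff)
  qed
  from tendsto_divide[OF this[of a] this[of c] assms]
  have "((\<lambda>q. (q powr a - 1) / (q - 1) / ((q powr c - 1) / (q - 1))) \<longlongrightarrow> a / c) (at_left 1)" .
  thus ?thesis
    by (rule Lim_transform_eventually) (auto intro!: eventually_at_leftI[of 0])
qed

text \<open>The coefficients of the recursion are attained only in the limit; the slack
  \<open>d\<close> lets them hold from some point on while the fixed point stays below
  \<open>a\<close>.\<close>

lemma exists_perturbation: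
  fixes e k a :: real
  assumes "k < 1" "e / (1 - k) < a"
  obtains d where "0 < d" "k + d < 1" "(e + d) / (1 - (k + d)) < a"
proof -
  have "((\<lambda>d. (e + d) / (1 - (k + d))) \<longlongrightarrow> (e + 0) / (1 - (k + 0))) (at_right 0)"
    using assms by (intro tendsto_intros) auto
  hence "\<forall>\<^sub>F d in at_right 0. (e + d) / (1 - (k + d)) < a"
    using assms by (intro order_tendstoD(2)) auto
  moreover have "\<forall>\<^sub>F d in at_right 0. 0 < d \<and> k + d < 1"
    using assms by (intro eventually_at_rightI[of 0 "1 - k"]) auto
  ultimately have "\<forall>\<^sub>F d in at_right 0. 0 < d \<and> k + d < 1 \<and> (e + d) / (1 - (k + d)) < a"
    by eventually_elim auto
  hence "\<exists>d. 0 < d \<and> k + d < 1 \<and> (e + d) / (1 - (k + d)) < a"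
    using trivial_limit_at_right_real eventually_happens by blast
  thus ?thesis using that by blast
qed

context regular_tail
begin

text \<open>\<open>V\<close> stands for the truncated mean and enters only through the bounds that
  the mass between \<open>s\<close> and \<open>t\<close> imposes on its increments. The normalised
  quantity satisfies a recursion from \<open>q * t\<close> to \<open>t\<close> with factor close to
  q powr (1 - \<alpha>), a contraction because \<alpha> < 1, and an increment between
  \<open>q\<close> times (q powr - \<alpha>) - 1 and that number itself. Both fixed points tend to
  \<alpha> / (1 - \<alpha>) as \<open>q\<close> tends to 1.\<close>

lemma truncated_moment:
  fixes V :: "real \<Rightarrow> real"
  assumes alpha: "\<alpha> < 1"
    and nonneg: "\<And>t. 0 \<le> V t"
    and lower: "\<And>s t. 0 < s \<Longrightarrow> s \<le> t \<Longrightarrow> s * (G s - G t) \<le> V t - V s"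
    and upper: "\<And>s t. 0 < s \<Longrightarrow> s \<le> t \<Longrightarrow> V t - V s \<le> t * (G s - G t)"
  shows "((\<lambda>t. V t / (t * G t)) \<longlongrightarrow> \<alpha> / (1 - \<alpha>)) at_top"
proof -
  define v where "v t = V t / (t * G t)" for t
  have v_nonneg: "0 \<le> v t" if "0 < t" for t
    using that nonneg[of t] pos[of t] by (simp add: v_def)
  have V_mono: "V s \<le> V t" if "0 < s" "s \<le> t" for s t
  proof -
    have "0 \<le> s * (G s - G t)" using that antitone[of s t] by simp
    thus ?thesis using lower[OF that] by linarith
  qed
  have v_split: "v t = q * (G (q * t) / G t) * v (q * t) + (V t - V (q * t)) / (t * G t)"
    if "0 < q" "0 < t" for q t
    using that pos[of t] pos[of "q * t"] by (simp add: v_def field_simps)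
  have incr_upper: "(V t - V (q * t)) / (t * G t) \<le> G (q * t) / G t - 1"
    and incr_lower: "q * (G (q * t) / G t - 1) \<le> (V t - V (q * t)) / (t * G t)"
    if "0 < q" "q < 1" "0 < t" for q t
  proof -
    have qt: "0 < q * t" "q * t \<le> t" and tG: "0 < t * G t"
      using that pos[of t] by auto
    show "(V t - V (q * t)) / (t * G t) \<le> G (q * t) / G t - 1"
      using divide_right_mono[OF upper[OF qt], of "t * G t"] tG that
      by (simp add: diff_divide_distrib split: if_splits)
    show "q * (G (q * t) / G t - 1) \<le> (V t - V (q * t)) / (t * G t)"
      using divide_right_mono[OF lower[OF qt], of "t * G t"] tG that
      by (simp add: diff_divide_distrib right_diff_distrib split: if_splits)
  qed
  have v_bdd: "v t \<le> V t0 / (q * t0 * G t0)" if "0 < q" "0 < t0" "q * t0 \<le> t" "t \<le> t0" for q t t0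
    unfolding v_def
  proof (rule frac_le)
    have "0 < t" using that by (smt (verit) mult_pos_pos)
    thus "V t \<le> V t0" using that V_mono by blast
    show "q * t0 * G t0 \<le> t * G t"
      using that antitone[of t t0] pos[of t0] \<open>0 < t\<close> by (intro mult_mono) auto
  qed (use that nonneg pos in auto)
  have ratio: "((\<lambda>q. (q powr - \<alpha> - 1) / (1 - q powr (1 - \<alpha>))) \<longlongrightarrow> \<alpha> / (1 - \<alpha>)) (at_left 1)"
    using tendsto_minus[OF powr_increment_ratio_at_1[of "1 - \<alpha>" "- \<alpha>"]] alpha
    by (simp only: minus_divide_right minus_diff_eq minus_minus) (simp flip: minus_divide_left add: minus_divide_right)
  have scale: "((\<lambda>t. G (q * t) / G t) \<longlongrightarrow> q powr - \<alpha>) at_top" if "0 < q" for q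
    using regular[OF that] .
  have q_powr: "q * q powr - \<alpha> = q powr (1 - \<alpha>)" if "0 < q" for q :: real
    using that by (simp add: powr_diff powr_minus_divide)
  show ?thesis
    unfolding v_def[symmetric]
  proof (rule order_tendstoI)
    fix a assume a: "\<alpha> / (1 - \<alpha>) < a"
    have "\<forall>\<^sub>F q in at_left 1. 0 < q \<and> q < (1::real)"
      by (intro eventually_at_leftI[of 0]) auto
    with order_tendstoD(2)[OF ratio a]
    have "\<forall>\<^sub>F q in at_left 1. 0 < q \<and> q < 1 \<and> (q powr - \<alpha> - 1) / (1 - q powr (1 - \<alpha>)) < a"
      by eventually_elim auto
    then obtain q where q: "0 < q" "q < 1" "(q powr - \<alpha> - 1) / (1 - q powr (1 - \<alpha>)) < a"
      using trivial_limit_at_left_real eventually_happens by blast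
    have k1: "q powr (1 - \<alpha>) < 1" using q alpha by (simp add: powr01_less_one)
    obtain d where d: "0 < d" "q powr (1 - \<alpha>) + d < 1"
      "(q powr - \<alpha> - 1 + d) / (1 - (q powr (1 - \<alpha>) + d)) < a"
      using exists_perturbation[OF k1 q(3)] .
    define k where "k = q powr (1 - \<alpha>) + d"
    define e where "e = q powr - \<alpha> - 1 + d"
    \<comment> \<open>The contraction lemma yields a non-strict bound with an excess; the excess is
      chosen to end at \<open>m\<close>, strictly below \<open>a\<close>.\<close>
    obtain m where m: "e / (1 - k) < m" "m < a"
      using dense[OF d(3)] unfolding k_def e_def by blast
    have "\<forall>\<^sub>F t in at_top. v t \<le> k * v (q * t) + e"
    proof -
      have "((\<lambda>t. q * (G (q * t) / G t)) \<longlongrightarrow> q * q powr - \<alpha>) at_top"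
        using q by (intro tendsto_intros scale)
      hence "\<forall>\<^sub>F t in at_top. q * (G (q * t) / G t) < k"
        using d q by (intro order_tendstoD(2)) (auto simp: k_def q_powr)
      moreover have "\<forall>\<^sub>F t in at_top. G (q * t) / G t < e + 1"
        using d q by (intro order_tendstoD(2)[OF scale]) (auto simp: e_def)
      ultimately show ?thesis
        using eventually_gt_at_top[of 0]
      proof eventually_elim
        case (elim t)
        have "q * (G (q * t) / G t) * v (q * t) \<le> k * v (q * t)"
          using elim q by (intro mult_right_mono v_nonneg) auto
        thus ?case
          using incr_upper[of q t] v_split[of q t] elim q by linarith
      qed
    qed
    then obtain t1 where t1: "\<And>t. t1 \<le> t \<Longrightarrow> v t \<le> k * v (q * t) + e"
      by (auto simp: eventually_at_top_linorder)
    have "\<forall>\<^sub>F t in at_top. v t \<le> e / (1 - k) + (m - e / (1 - k))"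
    proof (rule eventually_le_of_scaling_contraction[of q k "max 1 t1"])
      show "v t \<le> V (max 1 t1) / (q * max 1 t1 * G (max 1 t1))" if "q * max 1 t1 \<le> t" "t \<le> max 1 t1" for t
        using that q by (intro v_bdd) auto
    qed (use q d m t1 in \<open>auto simp: k_def add_nonneg_nonneg\<close>)
    thus "\<forall>\<^sub>F t in at_top. v t < a"
      by eventually_elim (use m in simp)
  next
    fix a assume a: "a < \<alpha> / (1 - \<alpha>)"
    have ratio': "((\<lambda>q. q * ((q powr - \<alpha> - 1) / (1 - q powr (1 - \<alpha>)))) \<longlongrightarrow> 1 * (\<alpha> / (1 - \<alpha>))) (at_left 1)"
      by (intro tendsto_intros ratio)
    have "\<forall>\<^sub>F q in at_left 1. a < q * ((q powr - \<alpha> - 1) / (1 - q powr (1 - \<alpha>)))"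
      using a by (intro order_tendstoD(1)[OF ratio']) auto
    moreover have "\<forall>\<^sub>F q in at_left 1. 0 < q \<and> q < (1::real)"
      by (intro eventually_at_leftI[of 0]) auto
    ultimately have "\<forall>\<^sub>F q in at_left 1. 0 < q \<and> q < 1 \<and> a < q * ((q powr - \<alpha> - 1) / (1 - q powr (1 - \<alpha>)))"
      by eventually_elim auto
    then obtain q where q: "0 < q" "q < 1" "a < q * ((q powr - \<alpha> - 1) / (1 - q powr (1 - \<alpha>)))"
      using trivial_limit_at_left_real eventually_happens by blast
    have k1: "q powr (1 - \<alpha>) < 1" using q alpha by (simp add: powr01_less_one)
    define k where "k = q powr (1 - \<alpha>)"
    define e where "e = q * (q powr - \<alpha> - 1)"
    have k: "0 < k" "k < 1" using k1 q by (auto simp: k_def)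
    have "((\<lambda>d. (e - d) / (1 - (k - d))) \<longlongrightarrow> (e - 0) / (1 - (k - 0))) (at_right 0)"
      using k by (intro tendsto_intros) auto
    hence "\<forall>\<^sub>F d in at_right 0. a < (e - d) / (1 - (k - d))"
      using q by (intro order_tendstoD(1)) (auto simp: e_def k_def)
    moreover have "\<forall>\<^sub>F d in at_right 0. 0 < d \<and> 0 \<le> k - d"
      using k by (intro eventually_at_rightI[of 0 k]) auto
    ultimately have "\<forall>\<^sub>F d in at_right 0. 0 < d \<and> 0 \<le> k - d \<and> a < (e - d) / (1 - (k - d))"
      by eventually_elim auto
    then obtain d where d: "0 < d" "0 \<le> k - d" "a < (e - d) / (1 - (k - d))"
      using trivial_limit_at_right_real eventually_happens by blast
    \<comment> \<open>For the lower bound the contraction lemma is applied to \<open>- v\<close>,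
      which is at most 0 on the base period. The slack is now subtracted, and
      \<open>0 \<le> k - d\<close> keeps the factor admissible.\<close>
    define l where "l = k - d"
    define f where "f = e - d"
    obtain m where m: "m < f / (1 - l)" "a < m"
      using dense[OF d(3)] unfolding l_def f_def by blast
    have "\<forall>\<^sub>F t in at_top. - v t \<le> l * - v (q * t) + - f"
    proof -
      have "((\<lambda>t. q * (G (q * t) / G t)) \<longlongrightarrow> q * q powr - \<alpha>) at_top"
        using q by (intro tendsto_intros scale)
      hence "\<forall>\<^sub>F t in at_top. l < q * (G (q * t) / G t)"
        using d q by (intro order_tendstoD(1)) (auto simp: k_def l_def q_powr)
      moreover have "((\<lambda>t. q * (G (q * t) / G t - 1)) \<longlongrightarrow> e) at_top"
        unfolding e_def using q by (intro tendsto_intros scale)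
      hence "\<forall>\<^sub>F t in at_top. f < q * (G (q * t) / G t - 1)"
        using d by (intro order_tendstoD(1)) (auto simp: f_def)
      ultimately show ?thesis
        using eventually_gt_at_top[of 0]
      proof eventually_elim
        case (elim t)
        have "l * v (q * t) \<le> q * (G (q * t) / G t) * v (q * t)"
          using elim q by (intro mult_right_mono v_nonneg) auto
        thus ?case
          using incr_lower[of q t] v_split[of q t] elim q by linarith
      qed
    qed
    then obtain t1 where t1: "\<And>t. t1 \<le> t \<Longrightarrow> - v t \<le> l * - v (q * t) + - f"
      by (auto simp: eventually_at_top_linorder)
    have "\<forall>\<^sub>F t in at_top. - v t \<le> - f / (1 - l) + (f / (1 - l) - m)"
    proof (rule eventually_le_of_scaling_contraction[of q l "max 1 t1"])
      show "- v t \<le> 0" if "q * max 1 t1 \<le> t" for t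
      proof -
        have "0 < q * max 1 t1" using q by simp
        thus ?thesis using v_nonneg[of t] that by linarith
      qed
      show "l < 1" using k d by (simp add: l_def)
    qed (use q d m t1 in \<open>auto simp: l_def\<close>)
    thus "\<forall>\<^sub>F t in at_top. a < v t"
      by eventually_elim (use m in simp)
  qed
qed

end

section \<open>Spectral radius and powers of an operator\<close>

text \<open>\<open>nrm\<close> is a seminorm, so that the locale covers both the function algebra
  with its null functions and a space of representatives inside it.\<close>

locale normed_subspace = vector_space scl
  for scl :: "complex \<Rightarrow> 'v \<Rightarrow> 'v::ab_group_add" +
  fixes X :: "'v set" and nrm :: "'v \<Rightarrow> real"
  assumes X: "subspace X"
    and nrm_add: "f \<in> X \<Longrightarrow> g \<in> X \<Longrightarrow> nrm (f + g) \<le> nrm f + nrm g"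
    and nrm_scale: "f \<in> X \<Longrightarrow> nrm (scl c f) = cmod c * nrm f"
begin

lemmas X_zero = subspace_0[OF X]
lemmas X_add = subspace_add[OF X]
lemmas X_scale = subspace_scale[OF X]
lemmas X_diff = subspace_diff[OF X]
lemmas X_sum = subspace_sum[OF X]

lemma nrm_zero: "nrm 0 = 0"
  using nrm_scale[OF X_zero, of 0] by simp

lemma nrm_minus: "f \<in> X \<Longrightarrow> nrm (- f) = nrm f"
  using nrm_scale[of f "-1"] by simp

lemma nrm_nonneg: "f \<in> X \<Longrightarrow> 0 \<le> nrm f"
  using nrm_add[of f "- f"] nrm_minus[of f] subspace_neg[OF X, of f] by (simp add: nrm_zero)

lemma nrm_diff_le: "f \<in> X \<Longrightarrow> g \<in> X \<Longrightarrow> nrm (f - g) \<le> nrm f + nrm g"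
  using nrm_add[of f "- g"] nrm_minus[of g] subspace_neg[OF X, of g] by simp

lemma nrm_le_add_diff: "f \<in> X \<Longrightarrow> g \<in> X \<Longrightarrow> nrm f \<le> nrm g + nrm (f - g)"
  using nrm_add[of g "f - g"] X_diff[of f g] by simp

lemma nrm_sum:
  assumes "\<And>i. i \<in> I \<Longrightarrow> f i \<in> X" shows "nrm (\<Sum>i\<in>I. f i) \<le> (\<Sum>i\<in>I. nrm (f i))"
  using assms
proof (induction I rule: infinite_finite_induct)
  case (insert i I)
  thus ?case
    using nrm_add[of "f i" "\<Sum>i\<in>I. f i"] X_sum[of I f] by auto
qed (auto simp: nrm_zero)

definition bounded_endo :: "('v \<Rightarrow> 'v) \<Rightarrow> bool" where
  "bounded_endo N \<longleftrightarrow> (\<forall>f\<in>X. N f \<in> X) \<and> (\<forall>f\<in>X. \<forall>g\<in>X. N (f + g) = N f + N g) \<and>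
     (\<forall>c. \<forall>f\<in>X. N (scl c f) = scl c (N f)) \<and> (\<exists>K. \<forall>f\<in>X. nrm (N f) \<le> K * nrm f)"

context
  fixes N assumes N: "bounded_endo N"
begin

lemma endo_mem: "f \<in> X \<Longrightarrow> N f \<in> X"
  and endo_add: "f \<in> X \<Longrightarrow> g \<in> X \<Longrightarrow> N (f + g) = N f + N g"
  and endo_scale: "f \<in> X \<Longrightarrow> N (scl c f) = scl c (N f)"
  using N by (auto simp: bounded_endo_def)

lemma endo_zero: "N 0 = 0"
  using endo_scale[OF X_zero, of 0] by simp

lemma endo_diff: "f \<in> X \<Longrightarrow> g \<in> X \<Longrightarrow> N (f - g) = N f - N g"
  using endo_add[of "f - g" g] X_diff[of f g] by simp

lemma endo_sum: "(\<And>i. i \<in> I \<Longrightarrow> f i \<in> X) \<Longrightarrow> N (\<Sum>i\<in>I. f i) = (\<Sum>i\<in>I. N (f i))"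
proof (induction I rule: infinite_finite_induct)
  case (insert i I)
  thus ?case using endo_add[of "f i" "\<Sum>i\<in>I. f i"] X_sum[of I f] by auto
qed (auto simp: endo_zero)

lemma endo_bound:
  obtains K where "0 \<le> K" "\<And>f. f \<in> X \<Longrightarrow> nrm (N f) \<le> K * nrm f"
proof -
  obtain K where K: "\<And>f. f \<in> X \<Longrightarrow> nrm (N f) \<le> K * nrm f"
    using N unfolding bounded_endo_def by blast
  show ?thesis
  proof (rule that[of "max K 0"])
    show "nrm (N f) \<le> max K 0 * nrm f" if "f \<in> X" for f
      using K[OF that] mult_right_mono[of K "max K 0" "nrm f"] nrm_nonneg[OF that] by linarith
  qed simp
qed

lemma endo_power_mem: "f \<in> X \<Longrightarrow> (N ^^ n) f \<in> X"
  by (induction n) (auto intro: endo_mem)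

lemma bounded_endo_power: "bounded_endo (N ^^ n)"
proof (induction n)
  case 0
  show ?case by (auto simp: bounded_endo_def intro!: exI[of _ 1])
next
  case (Suc n)
  note IH = Suc
  obtain K where K: "0 \<le> K" "\<And>f. f \<in> X \<Longrightarrow> nrm (N f) \<le> K * nrm f" using endo_bound by blast
  obtain K' where K': "\<And>f. f \<in> X \<Longrightarrow> nrm ((N ^^ n) f) \<le> K' * nrm f"
    using IH unfolding bounded_endo_def by blast
  have "nrm (N ((N ^^ n) f)) \<le> K * K' * nrm f" if "f \<in> X" for f
    using K(2)[OF endo_power_mem[OF that]] mult_left_mono[OF K'[OF that] K(1)]
    by (simp add: mult_ac) (meson order_trans)
  thus ?case
    using IH by (auto simp: bounded_endo_def endo_add endo_scale intro: endo_mem)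
qed

lemma endo_power_bound:
  assumes "0 \<le> K" "\<And>f. f \<in> X \<Longrightarrow> nrm (N f) \<le> K * nrm f" "f \<in> X"
  shows "nrm ((N ^^ n) f) \<le> K ^ n * nrm f"
proof (induction n)
  case (Suc n)
  have "nrm (N ((N ^^ n) f)) \<le> K * nrm ((N ^^ n) f)"
    using assms endo_power_mem by blast
  also have "\<dots> \<le> K * (K ^ n * nrm f)"
    using Suc assms(1) by (rule mult_left_mono)
  finally show ?case by (simp add: mult_ac)
qed simp

text \<open>A partial sum of the Neumann series for the inverse of \<open>1 - N / w\<close>. It is
  the cofactor of \<open>1 - N / w\<close> in the factorisation of
  \<open>1 - (N / w) ^ n\<close>.\<close>

definition power_average :: "complex \<Rightarrow> nat \<Rightarrow> 'v \<Rightarrow> 'v" where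
  "power_average w n f = (\<Sum>k<n. scl (inverse w ^ k) ((N ^^ k) f))"

lemma power_average_mem: "f \<in> X \<Longrightarrow> power_average w n f \<in> X"
  unfolding power_average_def by (intro X_sum X_scale endo_power_mem)

lemma power_average_telescope:
  assumes f: "f \<in> X"
  shows "power_average w n f - scl (inverse w) (N (power_average w n f)) = f - scl (inverse w ^ n) ((N ^^ n) f)"
proof -
  have "scl (inverse w) (N (power_average w n f)) = (\<Sum>k<n. scl (inverse w ^ Suc k) ((N ^^ Suc k) f))"
    unfolding power_average_def
    using f by (subst endo_sum) (auto simp: scale_sum_right endo_scale endo_power_mem intro: X_scale)
  hence "power_average w n f - scl (inverse w) (N (power_average w n f)) =
      (\<Sum>k<n. scl (inverse w ^ k) ((N ^^ k) f) - scl (inverse w ^ Suc k) ((N ^^ Suc k) f))"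
    by (simp add: power_average_def sum_subtractf)
  also have "\<dots> = f - scl (inverse w ^ n) ((N ^^ n) f)"
    by (subst sum_lessThan_telescope') simp
  finally show ?thesis .
qed

lemma power_average_commute:
  assumes f: "f \<in> X"
  shows "power_average w n (f - scl (inverse w) (N f)) = power_average w n f - scl (inverse w) (N (power_average w n f))"
proof -
  have *: "(N ^^ k) (f - scl (inverse w) (N f)) = (N ^^ k) f - scl (inverse w) (N ((N ^^ k) f))" for k
  proof (induction k)
    case (Suc k)
    thus ?case
      using f by (simp add: endo_diff endo_scale endo_mem endo_power_mem X_scale)
  qed simp
  show ?thesis
    unfolding power_average_def *
    using f by (subst endo_sum)
      (auto simp: scale_sum_right endo_scale endo_power_mem scale_right_diff_distrib sum_subtractf mult.commute
        intro: X_scale endo_mem)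
qed

section \<open>Averages over roots of unity: orthogonality of the characters of a cyclic
  group\<close>

lemma sum_roots_of_unity_powers:
  assumes "0 < n" "k < n"
  shows "(\<Sum>j<n. exp (2 * of_real pi * \<i> * of_nat j / of_nat n) ^ k :: complex) = (if k = 0 then of_nat n else 0)"
proof -
  define z where "z = exp (2 * of_real pi * \<i> * of_nat k / of_nat n :: complex)"
  have "exp (2 * of_real pi * \<i> * of_nat j / of_nat n) ^ k = z ^ j" for j
    unfolding z_def exp_of_nat_mult[symmetric] by (simp add: mult_ac)
  moreover have "z ^ n = exp (2 * of_real pi * \<i> * of_nat k)"
    using assms unfolding z_def exp_of_nat_mult[symmetric] by (simp add: field_simps)
  hence "z ^ n = 1"
    by (auto simp: exp_eq_1 mult_ac)
  moreover have "z = 1 \<longleftrightarrow> k = 0"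
    using complex_root_unity_eq_1[of n k] assms unfolding z_def by (auto dest: dvd_imp_le)
  ultimately show ?thesis
    by (auto simp: sum_gp_strict)
qed

text \<open>The \<open>n\<close>-th roots of \<open>r ^ n\<close>. The inverse is a convention under
  which \<open>inverse (circle_point r n j) ^ k\<close> is a positive power of a root of unity, up
  to a real factor.\<close>

definition circle_point :: "real \<Rightarrow> nat \<Rightarrow> nat \<Rightarrow> complex" where
  "circle_point r n j = of_real r * inverse (exp (2 * of_real pi * \<i> * of_nat j / of_nat n))"

lemma cmod_circle_point: "0 \<le> r \<Longrightarrow> cmod (circle_point r n j) = r"
proof -
  have "2 * of_real pi * \<i> * of_nat j / of_nat n = \<i> * complex_of_real (2 * pi * real j / real n)"
    by simp
  thus "0 \<le> r \<Longrightarrow> cmod (circle_point r n j) = r"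
    unfolding circle_point_def norm_mult norm_inverse by (simp only: norm_exp_i_times) simp
qed

lemma circle_point_power:
  assumes "0 < n" shows "circle_point r n j ^ n = of_real r ^ n"
proof -
  have "exp (2 * of_real pi * \<i> * of_nat j / of_nat n) ^ n = exp (2 * of_real pi * \<i> * of_nat j)"
    using assms unfolding exp_of_nat_mult[symmetric] by (simp add: field_simps)
  also have "\<dots> = (1 :: complex)" by (auto simp: exp_eq_1 mult_ac)
  finally show ?thesis by (simp add: circle_point_def power_mult_distrib power_inverse)
qed

lemma circle_point_diff:
  "cmod (circle_point r n j - circle_point s n j) = \<bar>r - s\<bar>"
proof -
  have "circle_point r n j - circle_point s n j = of_real (r - s) * circle_point 1 n j"
    by (simp add: circle_point_def algebra_simps)
  thus ?thesis
    by (simp only: norm_mult norm_of_real cmod_circle_point[OF zero_le_one] mult_1_right)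
qed

lemma average_power_average:
  assumes n: "0 < n" and r: "0 < r" and f: "f \<in> X"
  shows "scl (inverse (of_nat n)) (\<Sum>j<n. power_average (circle_point r n j) n f) = f"
proof -
  have "(\<Sum>j<n. power_average (circle_point r n j) n f) =
      (\<Sum>k<n. \<Sum>j<n. scl (inverse (circle_point r n j) ^ k) ((N ^^ k) f))"
    unfolding power_average_def by (rule sum.swap)
  also have "\<dots> = (\<Sum>k<n. scl (\<Sum>j<n. inverse (circle_point r n j) ^ k) ((N ^^ k) f))"
    by (simp add: scale_sum_left)
  also have "\<dots> = (\<Sum>k<n. if k = 0 then scl (of_nat n) f else 0)"
  proof (rule sum.cong)
    fix k assume k: "k \<in> {..<n}"
    have "(\<Sum>j<n. inverse (circle_point r n j) ^ k) =
       inverse (of_real r) ^ k * (\<Sum>j<n. exp (2 * of_real pi * \<i> * of_nat j / of_nat n) ^ k)"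
      by (simp add: circle_point_def sum_distrib_left power_mult_distrib)
    thus "scl (\<Sum>j<n. inverse (circle_point r n j) ^ k) ((N ^^ k) f) = (if k = 0 then scl (of_nat n) f else 0)"
      using k n by (simp add: sum_roots_of_unity_powers)
  qed simp
  also have "\<dots> = scl (of_nat n) f"
    using n by (simp add: sum.delta)
  finally show ?thesis using n by simp
qed

section \<open>Averaged resolvents and descent of the radius\<close>

text \<open>Averaging the resolvent over the \<open>n\<close>-th roots of \<open>r ^ n\<close> inverts \<open>1 - (N / r) ^ n\<close>. The bounds on
  the resolvent are inherited by the average uniformly in \<open>n\<close>, and so is its Lipschitz dependence on \<open>r\<close>;
  hence invertibility with control for one radius carries over to slightly smaller radii.\<close>

context
  fixes P :: "complex \<Rightarrow> 'v \<Rightarrow> 'v" and r B R :: real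
  assumes r: "0 < r" and B: "0 \<le> B"
    and P: "\<And>w. r \<le> cmod w \<Longrightarrow> cmod w \<le> R \<Longrightarrow> bounded_endo (P w)"
    and P_bound: "\<And>w f. r \<le> cmod w \<Longrightarrow> cmod w \<le> R \<Longrightarrow> f \<in> X \<Longrightarrow> nrm (P w f) \<le> B * nrm f"
    and P_left: "\<And>w f. r \<le> cmod w \<Longrightarrow> cmod w \<le> R \<Longrightarrow> f \<in> X \<Longrightarrow> P w (f - scl (inverse w) (N f)) = f"
    and P_right: "\<And>w f. r \<le> cmod w \<Longrightarrow> cmod w \<le> R \<Longrightarrow> f \<in> X \<Longrightarrow> P w f - scl (inverse w) (N (P w f)) = f"
begin

lemma P_mem: "r \<le> cmod w \<Longrightarrow> cmod w \<le> R \<Longrightarrow> f \<in> X \<Longrightarrow> P w f \<in> X"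
  using P by (auto simp: bounded_endo_def)

text \<open>\<open>P w\<close> is the normalised resolvent, the inverse of \<open>1 - N / w\<close>,
  given on the annulus between the radii \<open>r\<close> and \<open>R\<close>.\<close>

definition circle_average :: "real \<Rightarrow> nat \<Rightarrow> 'v \<Rightarrow> 'v" where
  "circle_average s n f = scl (inverse (of_nat n)) (\<Sum>j<n. P (circle_point s n j) f)"

lemma circle_average_mem: "r \<le> s \<Longrightarrow> s \<le> R \<Longrightarrow> f \<in> X \<Longrightarrow> circle_average s n f \<in> X"
  using r unfolding circle_average_def
  by (intro X_scale X_sum P_mem) (auto simp: cmod_circle_point)

lemma nrm_average:
  assumes "0 < n" "\<And>j. j < n \<Longrightarrow> u j \<in> X" "\<And>j. j < n \<Longrightarrow> nrm (u j) \<le> b"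
  shows "nrm (scl (inverse (of_nat n)) (\<Sum>j<n. u j)) \<le> b"
proof -
  have "nrm (\<Sum>j<n. u j) \<le> (\<Sum>j<n. nrm (u j))"
    using assms by (intro nrm_sum) auto
  also have "\<dots> \<le> real n * b"
    using sum_bounded_above[of "{..<n}" "\<lambda>j. nrm (u j)" b] assms by simp
  finally have "nrm (\<Sum>j<n. u j) \<le> real n * b" .
  moreover have "(\<Sum>j<n. u j) \<in> X" using assms by (intro X_sum) auto
  ultimately show ?thesis
    using assms(1) by (simp add: nrm_scale norm_divide field_simps)
qed

lemma nrm_circle_average:
  assumes "0 < n" "r \<le> s" "s \<le> R" "f \<in> X"
  shows "nrm (circle_average s n f) \<le> B * nrm f"
  unfolding circle_average_def
  using assms r by (intro nrm_average P_mem P_bound) (auto simp: cmod_circle_point)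

text \<open>At each sample point \<open>1 - (N / w) ^ n\<close> is \<open>1 - N / w\<close> times
  \<open>power_average\<close>, and \<open>w ^ n = s ^ n\<close> does not depend on the point.
  \<open>P w\<close> cancels the first factor, and the averages of the second over the roots give
  the identity.\<close>

lemma circle_average_left:
  assumes n: "0 < n" and s: "r \<le> s" "s \<le> R" and f: "f \<in> X"
  shows "circle_average s n (f - scl (inverse (of_real s) ^ n) ((N ^^ n) f)) = f"
proof -
  have "P (circle_point s n j) (f - scl (inverse (of_real s) ^ n) ((N ^^ n) f))
      = power_average (circle_point s n j) n f" for j
  proof -
    let ?w = "circle_point s n j"
    have "f - scl (inverse (of_real s) ^ n) ((N ^^ n) f) = f - scl (inverse ?w ^ n) ((N ^^ n) f)"
      using n by (simp add: power_inverse circle_point_power)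
    also have "\<dots> = power_average ?w n f - scl (inverse ?w) (N (power_average ?w n f))"
      using f by (simp add: power_average_telescope)
    finally show ?thesis
      using P_left[of ?w "power_average ?w n f"] f s r power_average_mem by (simp add: cmod_circle_point)
  qed
  thus ?thesis
    unfolding circle_average_def using average_power_average[of n s f] assms r by simp
qed

lemma circle_average_right:
  assumes n: "0 < n" and s: "r \<le> s" "s \<le> R" and f: "f \<in> X"
  shows "circle_average s n f - scl (inverse (of_real s) ^ n) ((N ^^ n) (circle_average s n f)) = f"
proof -
  let ?w = "circle_point s n"
  note Nn = bounded_endo_power[of n]
  have PX: "P (?w j) f \<in> X" for j
    using s r f by (intro P_mem) (auto simp: cmod_circle_point)
  have "(N ^^ n) (circle_average s n f) = scl (inverse (of_nat n)) (\<Sum>j<n. (N ^^ n) (P (?w j) f))"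
  proof -
    have "(N ^^ n) (\<Sum>j<n. P (?w j) f) = (\<Sum>j<n. (N ^^ n) (P (?w j) f))"
      using PX by (intro normed_subspace.endo_sum[OF normed_subspace_axioms Nn]) auto
    thus ?thesis
      unfolding circle_average_def
      using PX by (subst normed_subspace.endo_scale[OF normed_subspace_axioms Nn]) (auto intro: X_sum)
  qed
  hence "circle_average s n f - scl (inverse (of_real s) ^ n) ((N ^^ n) (circle_average s n f)) =
     scl (inverse (of_nat n)) (\<Sum>j<n. P (?w j) f - scl (inverse (of_real s) ^ n) ((N ^^ n) (P (?w j) f)))"
    unfolding circle_average_def
    by (simp add: sum_subtractf scale_right_diff_distrib scale_sum_right mult.commute)
  also have "(\<Sum>j<n. P (?w j) f - scl (inverse (of_real s) ^ n) ((N ^^ n) (P (?w j) f))) =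
      (\<Sum>j<n. power_average (?w j) n f)"
  proof (rule sum.cong)
    fix j
    have "P (?w j) f - scl (inverse (of_real s) ^ n) ((N ^^ n) (P (?w j) f)) =
        P (?w j) f - scl (inverse (?w j) ^ n) ((N ^^ n) (P (?w j) f))"
      using n by (simp add: power_inverse circle_point_power)
    also have "\<dots> = power_average (?w j) n (P (?w j) f - scl (inverse (?w j)) (N (P (?w j) f)))"
      using PX by (simp add: power_average_telescope power_average_commute)
    also have "\<dots> = power_average (?w j) n f"
      using s r f by (subst P_right) (auto simp: cmod_circle_point)
    finally show "P (?w j) f - scl (inverse (of_real s) ^ n) ((N ^^ n) (P (?w j) f)) = power_average (?w j) n f" .
  qed simp
  also have "scl (inverse (of_nat n)) \<dots> = f"
    using assms r by (intro average_power_average) auto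
  finally show ?thesis .
qed

text \<open>The resolvent identity, applied at sample points of equal argument, whose distance is
  the difference of the radii. The bound is free of \<open>n\<close>.\<close>

lemma circle_average_lipschitz:
  assumes K: "0 \<le> K" "\<And>f. f \<in> X \<Longrightarrow> nrm (N f) \<le> K * nrm f"
    and n: "0 < n" and s: "r \<le> s" "s \<le> R" and t: "r \<le> t" "t \<le> R" and f: "f \<in> X"
  shows "nrm (circle_average s n f - circle_average t n f) \<le> B\<^sup>2 * K / r\<^sup>2 * \<bar>s - t\<bar> * nrm f"
proof -
  have "nrm (P w f - P z f) \<le> B\<^sup>2 * K / r\<^sup>2 * cmod (w - z) * nrm f"
    if w: "r \<le> cmod w" "cmod w \<le> R" and z: "r \<le> cmod z" "cmod z \<le> R" for w z
  proof -
    let ?u = "P w f" and ?v = "P z f"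
    have X': "?u \<in> X" "?v \<in> X" "N ?v \<in> X"
      using w z f by (auto intro: P_mem endo_mem)
    have "?u - ?v - scl (inverse w) (N (?u - ?v)) =
        (?u - scl (inverse w) (N ?u)) - (?v - scl (inverse w) (N ?v))"
      using X' by (simp add: endo_diff scale_right_diff_distrib)
    also have "\<dots> = (?v - scl (inverse z) (N ?v)) - (?v - scl (inverse w) (N ?v))"
      using w z f by (simp only: P_right)
    also have "\<dots> = scl (inverse w - inverse z) (N ?v)"
      by (simp add: scale_left_diff_distrib)
    finally have "?u - ?v = P w (scl (inverse w - inverse z) (N ?v))"
      using P_left[OF w, of "?u - ?v"] X' X_diff by simp
    also have "nrm \<dots> \<le> B * (cmod (inverse w - inverse z) * nrm (N ?v))"
      using P_bound[OF w X_scale[OF X'(3)], of "inverse w - inverse z"] X' by (simp add: nrm_scale)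
    also have "\<dots> \<le> B * (cmod (w - z) / r\<^sup>2 * (K * (B * nrm f)))"
    proof (intro mult_left_mono mult_mono B)
      have nz: "w \<noteq> 0" "z \<noteq> 0" using w z r by auto
      have "cmod (inverse w - inverse z) = cmod (w - z) / (cmod w * cmod z)"
      proof -
        have "inverse w - inverse z = (z - w) / (w * z)" using nz by (simp add: field_simps)
        thus ?thesis by (simp add: norm_divide norm_mult norm_minus_commute)
      qed
      also have "\<dots> \<le> cmod (w - z) / r\<^sup>2"
        using w z r unfolding power2_eq_square by (intro divide_left_mono mult_mono mult_pos_pos) auto
      finally show "cmod (inverse w - inverse z) \<le> cmod (w - z) / r\<^sup>2" .
      have "nrm (N ?v) \<le> K * nrm ?v" using K X' by blast
      also have "\<dots> \<le> K * (B * nrm f)"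
        using P_bound[OF z f] K(1) by (rule mult_left_mono)
      finally show "nrm (N ?v) \<le> K * (B * nrm f)" .
    qed (use X' r in \<open>auto simp: nrm_nonneg\<close>)
    finally show ?thesis by (simp add: power2_eq_square field_simps)
  qed
  note lip = this
  have "circle_average s n f - circle_average t n f =
      scl (inverse (of_nat n)) (\<Sum>j<n. P (circle_point s n j) f - P (circle_point t n j) f)"
    by (simp add: circle_average_def scale_right_diff_distrib sum_subtractf)
  also have "nrm \<dots> \<le> B\<^sup>2 * K / r\<^sup>2 * \<bar>s - t\<bar> * nrm f"
  proof (rule nrm_average[OF n])
    fix j
    have *: "r \<le> cmod (circle_point s n j)" "cmod (circle_point s n j) \<le> R"
      "r \<le> cmod (circle_point t n j)" "cmod (circle_point t n j) \<le> R"
      using s t r by (auto simp: cmod_circle_point)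
    show "P (circle_point s n j) f - P (circle_point t n j) f \<in> X"
      using * f by (intro X_diff P_mem)
    show "nrm (P (circle_point s n j) f - P (circle_point t n j) f) \<le> B\<^sup>2 * K / r\<^sup>2 * \<bar>s - t\<bar> * nrm f"
      using lip[OF *] by (simp add: circle_point_diff)
  qed
  finally show ?thesis .
qed

text \<open>Growth at most \<open>s ^ n\<close> makes \<open>(N / (s + h)) ^ n\<close> small, so for
  large \<open>n\<close> the average at radius \<open>s + h\<close> is close to the identity. The
  Lipschitz bound carries this closeness to radius \<open>t\<close>, at distance at most
  \<open>2 * h\<close>, where the average inverts \<open>1 - (N / t) ^ n\<close>; this bounds
  \<open>(N / t) ^ n\<close>. The width \<open>h\<close> depends only on \<open>B\<close>,
  \<open>K\<close>, \<open>r\<close>, so the step can be repeated.\<close>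

lemma power_bound_step:
  assumes K: "0 \<le> K" "\<And>f. f \<in> X \<Longrightarrow> nrm (N f) \<le> K * nrm f"
    and s: "r \<le> t" "t \<le> s" "s - h \<le> t" and h: "0 < h" "s + h \<le> R" "B\<^sup>2 * K / r\<^sup>2 * (2 * h) \<le> 1 / 4"
    and C: "\<And>n f. f \<in> X \<Longrightarrow> nrm ((N ^^ n) f) \<le> C * s ^ n * nrm f"
  shows "\<exists>C'. \<forall>n. \<forall>f\<in>X. nrm ((N ^^ n) f) \<le> C' * t ^ n * nrm f"
proof -
  have t0: "0 < t" and s0: "0 < s" using r s by auto
  have "\<bar>s / (s + h)\<bar> < 1" using s0 h by simp
  hence "(\<lambda>n. \<bar>C\<bar> * (s / (s + h)) ^ n * B) \<longlonglongrightarrow> \<bar>C\<bar> * 0 * B"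
    by (intro tendsto_intros LIMSEQ_realpow_zero) (use s0 h in auto)
  hence "\<forall>\<^sub>F n in sequentially. \<bar>C\<bar> * (s / (s + h)) ^ n * B < 1 / 4"
    by (rule order_tendstoD(2)) simp
  then obtain n0 where n0: "\<And>n. n0 \<le> n \<Longrightarrow> \<bar>C\<bar> * (s / (s + h)) ^ n * B < 1 / 4"
    by (auto simp: eventually_sequentially)
  have late: "nrm ((N ^^ n) f) \<le> t ^ n * nrm f" if n: "Suc n0 \<le> n" and f: "f \<in> X" for n f
  proof -
    have near: "nrm (circle_average t n g - g) \<le> 1 / 2 * nrm g" if g: "g \<in> X" for g
    proof -
      let ?a = "circle_average (s + h) n g" and ?b = "circle_average t n g"
      have X': "?a \<in> X" "?b \<in> X" "(N ^^ n) ?a \<in> X"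
        using g s h by (auto intro!: circle_average_mem endo_power_mem)
      have "?a - scl (inverse (of_real (s + h)) ^ n) ((N ^^ n) ?a) = g"
        using n g s h by (intro circle_average_right) auto
      hence "?a - g = ?a - (?a - scl (inverse (of_real (s + h)) ^ n) ((N ^^ n) ?a))"
        by (simp only:)
      hence "nrm (?a - g) = nrm (scl (inverse (of_real (s + h)) ^ n) ((N ^^ n) ?a))"
        by simp
      also have "\<dots> = inverse (s + h) ^ n * nrm ((N ^^ n) ?a)"
        using X' s0 h by (simp add: nrm_scale norm_power norm_inverse flip: of_real_add)
      also have "\<dots> \<le> inverse (s + h) ^ n * (\<bar>C\<bar> * s ^ n * (B * nrm g))"
      proof (intro mult_left_mono)
        have "nrm ((N ^^ n) ?a) \<le> C * s ^ n * nrm ?a" using C X' by blast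
        also have "\<dots> \<le> \<bar>C\<bar> * s ^ n * (B * nrm g)"
          using nrm_circle_average[of n "s + h" g] n g s h s0 X' by (intro mult_mono) (auto simp: nrm_nonneg)
        finally show "nrm ((N ^^ n) ?a) \<le> \<bar>C\<bar> * s ^ n * (B * nrm g)" .
      qed (use s0 h in auto)
      also have "\<dots> = \<bar>C\<bar> * (s / (s + h)) ^ n * B * nrm g"
        by (simp add: power_divide power_inverse field_simps)
      also have "\<dots> \<le> 1 / 4 * nrm g"
        using n0[of n] n g by (intro mult_right_mono) (auto simp: nrm_nonneg)
      finally have 1: "nrm (?a - g) \<le> 1 / 4 * nrm g" .
      have "nrm (?b - ?a) \<le> B\<^sup>2 * K / r\<^sup>2 * \<bar>t - (s + h)\<bar> * nrm g"
        using n s h g by (intro circle_average_lipschitz K) auto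
      also have "\<dots> \<le> B\<^sup>2 * K / r\<^sup>2 * (2 * h) * nrm g"
        using s h K g by (intro mult_right_mono mult_left_mono) (auto simp: nrm_nonneg)
      also have "\<dots> \<le> 1 / 4 * nrm g"
        using h g by (intro mult_right_mono) (auto simp: nrm_nonneg)
      finally have 2: "nrm (?b - ?a) \<le> 1 / 4 * nrm g" .
      have "nrm (?b - g) \<le> nrm (?b - ?a) + nrm (?a - g)"
        using nrm_add[of "?b - ?a" "?a - g"] X' g X_diff by simp
      thus ?thesis using 1 2 by linarith
    qed
    \<comment> \<open>The average sends \<open>f - u\<close> to \<open>f\<close>, so its distance
      from the identity at \<open>f - u\<close> is exactly the norm of \<open>u\<close>. The factor
      1/2 allows this norm to be absorbed on the left.\<close>
    define u where "u = scl (inverse (of_real t) ^ n) ((N ^^ n) f)"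
    have u: "u \<in> X" unfolding u_def using f by (intro X_scale endo_power_mem)
    have "circle_average t n (f - u) = f"
      unfolding u_def using n s h f by (intro circle_average_left) auto
    hence "nrm u \<le> 1 / 2 * nrm (f - u)"
      using near[of "f - u"] f u X_diff by simp
    also have "\<dots> \<le> 1 / 2 * (nrm f + nrm u)"
      using nrm_diff_le f u by simp
    finally have "nrm u \<le> nrm f" by simp
    moreover have "nrm u = inverse t ^ n * nrm ((N ^^ n) f)"
      unfolding u_def using f t0 endo_power_mem by (simp add: nrm_scale norm_power norm_inverse)
    ultimately show ?thesis using t0 by (simp add: power_inverse field_simps)
  qed
  \<comment> \<open>The sum covers the finitely many early powers, for which only
    \<open>K ^ n\<close> is available.\<close>
  define C' where "C' = 1 + (\<Sum>n\<le>n0. (K / t) ^ n)"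
  have "nrm ((N ^^ n) f) \<le> C' * t ^ n * nrm f" if f: "f \<in> X" for n f
  proof (cases "n \<le> n0")
    case True
    have "(K / t) ^ n \<le> (\<Sum>n\<le>n0. (K / t) ^ n)"
      using True K t0 by (intro member_le_sum) auto
    hence "(K / t) ^ n * t ^ n \<le> C' * t ^ n"
      using t0 by (intro mult_right_mono) (auto simp: C'_def)
    hence "K ^ n \<le> C' * t ^ n" using t0 by (simp add: power_divide)
    hence "K ^ n * nrm f \<le> C' * t ^ n * nrm f"
      using f by (intro mult_right_mono) (auto simp: nrm_nonneg)
    thus ?thesis using endo_power_bound[OF K f, of n] by linarith
  next
    case False
    have "1 \<le> C'" using K t0 by (auto simp: C'_def intro: sum_nonneg)
    hence "1 * (t ^ n * nrm f) \<le> C' * (t ^ n * nrm f)"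
      using f t0 by (intro mult_right_mono) (auto simp: nrm_nonneg)
    thus ?thesis using late[of n f] False f by simp
  qed
  thus ?thesis by blast
qed

end

text \<open>Pointwise invertibility becomes a uniform resolvent bound on a compact annulus. The
  descent starts at a radius not below the operator bound \<open>K\<close>, where the claim is
  trivial, and reaches \<open>r\<close> after finitely many steps of fixed width.\<close>

theorem power_bound_of_resolvent:
  assumes r: "0 < r"
    and resolvent: "\<And>z. r \<le> cmod z \<Longrightarrow>
      \<exists>Q. bounded_endo Q \<and> (\<forall>f\<in>X. Q (scl z f - N f) = f \<and> scl z (Q f) - N (Q f) = f)"
  shows "\<exists>C. \<forall>n. \<forall>f\<in>X. nrm ((N ^^ n) f) \<le> C * r ^ n * nrm f"
proof -
  obtain K where K: "0 \<le> K" "\<And>f. f \<in> X \<Longrightarrow> nrm (N f) \<le> K * nrm f" using endo_bound by blast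
  have "\<forall>z. \<exists>Q. r \<le> cmod z \<longrightarrow> bounded_endo Q \<and> (\<forall>f\<in>X. Q (scl z f - N f) = f \<and> scl z (Q f) - N (Q f) = f)"
    using resolvent by blast
  then obtain Q where Q': "\<forall>z. r \<le> cmod z \<longrightarrow> bounded_endo (Q z) \<and>
      (\<forall>f\<in>X. Q z (scl z f - N f) = f \<and> scl z (Q z f) - N (Q z f) = f)"
    using choice[of "\<lambda>z Q. r \<le> cmod z \<longrightarrow> bounded_endo Q \<and> (\<forall>f\<in>X. Q (scl z f - N f) = f \<and> scl z (Q f) - N (Q f) = f)"]
    by blast
  have Q: "bounded_endo (Q z)" and Q_left: "f \<in> X \<Longrightarrow> Q z (scl z f - N f) = f"
    and Q_right: "f \<in> X \<Longrightarrow> scl z (Q z f) - N (Q z f) = f" if "r \<le> cmod z" for z f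
    using Q' that by blast+
  define s0 where "s0 = max r K"
  \<comment> \<open>The outer radius leaves room for the sample radius \<open>s + h\<close>, since
    \<open>h \<le> 1\<close>.\<close>
  define R where "R = s0 + 1"
  have s0: "0 < s0" "r \<le> s0" using r by (auto simp: s0_def)
  have Q_mem: "Q z f \<in> X" if "r \<le> cmod z" "f \<in> X" for z f
    using Q[OF that(1)] that(2) by (auto simp: bounded_endo_def)
  \<comment> \<open>A lower bound for \<open>w - N\<close> is perturbed more easily than a bound for
    its inverse: moving \<open>z\<close> to \<open>w\<close> costs at most half of the norm of
    \<open>f\<close>, which is absorbed.\<close>
  have local_bound: "\<exists>e>0. \<exists>b\<ge>0. \<forall>w\<in>ball z e. \<forall>f\<in>X. nrm f \<le> b * nrm (scl w f - N f)"
    if z: "r \<le> cmod z" for z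
  proof -
    obtain b where b: "0 \<le> b" "\<And>f. f \<in> X \<Longrightarrow> nrm (Q z f) \<le> b * nrm f"
      using normed_subspace.endo_bound[OF normed_subspace_axioms Q[OF z]] by blast
    define e where "e = 1 / (2 * b + 1)"
    have e: "0 < e" "b * e \<le> 1 / 2" using b by (auto simp: e_def field_simps)
    have "nrm f \<le> 2 * b * nrm (scl w f - N f)" if w: "w \<in> ball z e" and f: "f \<in> X" for w f
    proof -
      have X': "scl z f - N f \<in> X" "scl w f - N f \<in> X"
        using f by (auto intro: X_diff X_scale endo_mem)
      have "nrm f \<le> b * nrm (scl z f - N f)"
        using b(2)[OF X'(1)] Q_left[OF z f] by simp
      moreover have "nrm (scl z f - N f) \<le> nrm (scl w f - N f) + nrm (scl (z - w) f)"
        using nrm_le_add_diff[OF X'] by (simp add: scale_left_diff_distrib)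
      moreover have "nrm (scl (z - w) f) \<le> e * nrm f"
        using w f by (auto simp: nrm_scale dist_norm intro!: mult_right_mono nrm_nonneg)
      ultimately have "nrm f \<le> b * (nrm (scl w f - N f) + e * nrm f)"
        using mult_left_mono[OF _ b(1), of "nrm (scl z f - N f)" "nrm (scl w f - N f) + e * nrm f"] by linarith
      hence "nrm f \<le> b * nrm (scl w f - N f) + b * e * nrm f"
        by (simp add: distrib_left mult.assoc)
      moreover have "b * e * nrm f \<le> 1 / 2 * nrm f"
        using e f by (intro mult_right_mono) (auto simp: nrm_nonneg)
      ultimately show ?thesis by simp
    qed
    thus ?thesis using e b by (intro exI[of _ e] conjI exI[of _ "2 * b"]) auto
  qed
  obtain e b where eb: "\<And>z. r \<le> cmod z \<Longrightarrow> 0 < e z" "\<And>z. r \<le> cmod z \<Longrightarrow> 0 \<le> b z"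
    "\<And>z w f. r \<le> cmod z \<Longrightarrow> w \<in> ball z (e z) \<Longrightarrow> f \<in> X \<Longrightarrow> nrm f \<le> b z * nrm (scl w f - N f)"
    using local_bound by metis
  define A where "A = {z. r \<le> cmod z} \<inter> cball 0 R"
  have "compact A"
    unfolding A_def by (intro closed_Int_compact closed_Collect_le continuous_intros) auto
  then obtain D where D: "D \<subseteq> A" "finite D" "A \<subseteq> (\<Union>z\<in>D. ball z (e z))"
    by (rule compactE_image[of A A "\<lambda>z. ball z (e z)"]) (use eb in \<open>auto simp: A_def\<close>)
  define b0 where "b0 = (\<Sum>z\<in>D. b z)"
  have b_nonneg: "0 \<le> b z" if "z \<in> D" for z using that D eb by (auto simp: A_def)
  hence b0: "0 \<le> b0" unfolding b0_def by (rule sum_nonneg)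
  have apriori: "nrm f \<le> b0 * nrm (scl w f - N f)" if "r \<le> cmod w" "cmod w \<le> R" "f \<in> X" for w f
  proof -
    have "w \<in> A" using that by (auto simp: A_def)
    then obtain z where z: "z \<in> D" "w \<in> ball z (e z)" using D by blast
    have "nrm f \<le> b z * nrm (scl w f - N f)"
      using eb(3)[of z w f] z that D by (auto simp: A_def)
    also have "\<dots> \<le> b0 * nrm (scl w f - N f)"
      unfolding b0_def using z D b_nonneg that
      by (intro mult_right_mono member_le_sum nrm_nonneg X_diff X_scale endo_mem) auto
    finally show ?thesis .
  qed
  define P where "P w f = scl w (Q w f)" for w f
  define B where "B = R * b0"
  have P: "bounded_endo (P w)" if w: "r \<le> cmod w" for w
  proof -
    obtain k where k: "\<And>f. f \<in> X \<Longrightarrow> nrm (Q w f) \<le> k * nrm f"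
      using normed_subspace.endo_bound[OF normed_subspace_axioms Q[OF w]] by blast
    have "nrm (scl w (Q w f)) \<le> (cmod w * k) * nrm f" if f: "f \<in> X" for f
      using k[OF f] Q_mem[OF w f] by (simp add: nrm_scale mult.assoc mult_left_mono)
    thus ?thesis
      using Q[OF w] unfolding bounded_endo_def P_def
      by (auto simp: scale_right_distrib mult.commute intro: X_scale intro!: exI[of _ "cmod w * k"])
  qed
  have P_bound: "nrm (P w f) \<le> B * nrm f" if w: "r \<le> cmod w" "cmod w \<le> R" and f: "f \<in> X" for w f
  proof -
    have "nrm (P w f) = cmod w * nrm (Q w f)"
      using Q_mem w f by (simp add: P_def nrm_scale)
    also have "\<dots> \<le> R * (b0 * nrm f)"
      using apriori[OF w Q_mem[OF w(1) f]] Q_right[OF w(1) f] w f Q_mem r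
      by (intro mult_mono) (auto simp: nrm_nonneg)
    finally show ?thesis by (simp add: B_def mult_ac)
  qed
  have P_left: "P w (f - scl (inverse w) (N f)) = f" if w: "r \<le> cmod w" and f: "f \<in> X" for w f
  proof -
    have "w \<noteq> 0" using w r by auto
    hence "scl w (f - scl (inverse w) (N f)) = scl w f - N f"
      by (simp add: scale_right_diff_distrib)
    moreover have "P w (f - scl (inverse w) (N f)) = Q w (scl w (f - scl (inverse w) (N f)))"
      unfolding P_def using Q[OF w] f X_diff X_scale endo_mem by (auto simp: bounded_endo_def)
    ultimately show ?thesis using Q_left[OF w f] by simp
  qed
  have P_right: "P w f - scl (inverse w) (N (P w f)) = f" if w: "r \<le> cmod w" and f: "f \<in> X" for w f
  proof -
    have "w \<noteq> 0" using w r by auto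
    thus ?thesis
      using Q_right[OF w f] Q_mem[OF w f] by (simp add: P_def endo_scale)
  qed
  have B: "0 \<le> B" using b0 s0 by (simp add: B_def R_def)
  define lip where "lip = B\<^sup>2 * K / r\<^sup>2"
  define h where "h = 1 / (8 * (lip + 1))"
  have lip: "0 \<le> lip" using K by (simp add: lip_def)
  have h: "0 < h" "h \<le> 1" "lip * (2 * h) \<le> 1 / 4" using lip by (auto simp: h_def field_simps)
  have "\<exists>C. \<forall>n. \<forall>f\<in>X. nrm ((N ^^ n) f) \<le> C * max r (s0 - real m * h) ^ n * nrm f" for m
  proof (induction m)
    case 0
    have "nrm ((N ^^ n) f) \<le> 1 * s0 ^ n * nrm f" if "f \<in> X" for n f
    proof -
      have "K ^ n * nrm f \<le> s0 ^ n * nrm f"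
        using that K by (intro mult_right_mono power_mono) (auto simp: s0_def nrm_nonneg)
      thus ?thesis using endo_power_bound[OF K that, of n] by simp
    qed
    thus ?case using s0 by (intro exI[of _ 1]) (auto simp: max_def)
  next
    case (Suc m)
    then obtain C where C: "\<And>n f. f \<in> X \<Longrightarrow> nrm ((N ^^ n) f) \<le> C * max r (s0 - real m * h) ^ n * nrm f"
      by blast
    have mh: "0 \<le> real m * h" using h by simp
    show ?case
    proof (rule power_bound_step[of r B R P K _ "max r (s0 - real m * h)" h])
      show "max r (s0 - real m * h) + h \<le> R"
      proof -
        have "max r (s0 - real m * h) \<le> s0"
          using mh s0(2) by (intro max.boundedI) linarith+
        thus ?thesis using h(2) unfolding R_def by linarith
      qed
      show "B\<^sup>2 * K / r\<^sup>2 * (2 * h) \<le> 1 / 4"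
        using h(3) unfolding lip_def .
      show "nrm ((N ^^ n) f) \<le> C * max r (s0 - real m * h) ^ n * nrm f" if "f \<in> X" for n f
        by (rule C[OF that])
    qed (use r B P P_bound P_left P_right K h in \<open>auto simp: algebra_simps\<close>)
  qed
  moreover obtain m where "s0 \<le> real m * h"
    using reals_Archimedean3[OF h(1)] less_imp_le by blast
  hence "max r (s0 - real m * h) = r" using r by auto
  ultimately show ?thesis by metis
qed

end

end

section \<open>The transfer operator of a measure preserving map\<close>

lemma Linf_iff: "h \<in> Linf M \<longleftrightarrow> h \<in> borel_measurable M \<and> (\<exists>C. AE x in M. cmod (h x) \<le> C)"
proof
  assume h: "h \<in> Linf M"
  hence "esssup M (\<lambda>x. ereal (cmod (h x))) < \<infinity>"
    by (simp add: Linf_def Linf_norm_def)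
  then obtain C where C: "esssup M (\<lambda>x. ereal (cmod (h x))) \<le> ereal C"
    by (cases "esssup M (\<lambda>x. ereal (cmod (h x)))") auto
  have "AE x in M. ereal (cmod (h x)) \<le> esssup M (\<lambda>x. ereal (cmod (h x)))"
    by (rule esssup_AE)
  hence "AE x in M. cmod (h x) \<le> C"
    by eventually_elim (use C in \<open>simp add: order_trans[OF _ C, of "ereal _", simplified]\<close>)
  thus "h \<in> borel_measurable M \<and> (\<exists>C. AE x in M. cmod (h x) \<le> C)"
    using h by (auto simp: Linf_def)
next
  assume "h \<in> borel_measurable M \<and> (\<exists>C. AE x in M. cmod (h x) \<le> C)"
  then obtain C where [measurable]: "h \<in> borel_measurable M" and C: "AE x in M. cmod (h x) \<le> C" by blast
  have "esssup M (\<lambda>x. ereal (cmod (h x))) \<le> ereal C"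
    using C by (intro esssup_I) auto
  thus "h \<in> Linf M" by (auto simp: Linf_def Linf_norm_def)
qed

lemma integrable_mult_Linf:
  assumes f: "integrable M f" and h: "h \<in> Linf M"
  shows "integrable M (\<lambda>x. f x * h x)"
proof -
  obtain C where [measurable]: "h \<in> borel_measurable M" and C: "AE x in M. cmod (h x) \<le> C"
    using h by (auto simp: Linf_iff)
  have [measurable]: "f \<in> borel_measurable M" using f by simp
  show ?thesis
  proof (rule Bochner_Integration.integrable_bound[of M "\<lambda>x. \<bar>C\<bar> * cmod (f x)"])
    show "AE x in M. norm (f x * h x) \<le> norm (\<bar>C\<bar> * cmod (f x))"
      using C
    proof eventually_elim
      case (elim x)
      have "cmod (h x) * cmod (f x) \<le> \<bar>C\<bar> * cmod (f x)"
        using elim by (intro mult_right_mono) auto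
      thus ?case by (simp add: norm_mult abs_mult mult.commute)
    qed
  qed (use f in auto)
qed

text \<open>Testing against the conjugate phase of \<open>f\<close> recovers the \<open>L\<^sup>1\<close> norm.\<close>

lemma exists_phase:
  assumes [measurable]: "f \<in> borel_measurable M"
  obtains h where "h \<in> Linf M" "\<And>x. cmod (h x) \<le> 1" "\<And>x. f x * h x = of_real (cmod (f x))"
proof
  let ?h = "\<lambda>x. cnj (f x) / of_real (cmod (f x))"
  show le: "cmod (?h x) \<le> 1" for x by (simp add: norm_divide)
  have "(\<lambda>x. cnj (f x)) \<in> borel_measurable M"
    by (rule measurable_compose[OF assms borel_measurable_continuous_onI]) (intro continuous_intros)
  moreover have "(\<lambda>x. complex_of_real (cmod (f x))) \<in> borel_measurable M"
    by (rule measurable_compose[OF assms borel_measurable_continuous_onI]) (intro continuous_intros)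
  ultimately have "?h \<in> borel_measurable M" by (rule borel_measurable_divide)
  thus "?h \<in> Linf M" using le by (auto simp: Linf_iff intro!: exI[of _ 1])
  show "f x * ?h x = of_real (cmod (f x))" for x
    using complex_norm_square[of "f x"] by (cases "f x = 0") (simp_all add: field_simps power2_eq_square)
qed

locale measure_preserving = prob_space M for M :: "'a measure" and T :: "'a \<Rightarrow> 'a" +
  assumes invariant: "invariant_measure M T"
begin

lemma T_measurable [measurable]: "T \<in> measurable M M"
  and distr_T: "distr M M T = M"
  using invariant by (auto simp: invariant_measure_def)

lemma AE_T: "AE x in M. Q x \<Longrightarrow> AE x in M. Q (T x)"
  by (rule AE_distrD[OF T_measurable]) (subst distr_T)

text \<open>\<open>g\<close> is the Radon-Nikodym density of the image under \<open>T\<close> of the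
  measure with density \<open>f\<close>; absolute continuity holds because invariance makes
  preimages of null sets null.\<close>

lemma transfer_exists_nonneg:
  assumes f: "integrable M f" "\<And>x. 0 \<le> f x"
  obtains g :: "'a \<Rightarrow> real" where "integrable M g" "\<And>x. 0 \<le> g x"
    "\<And>h :: 'a \<Rightarrow> complex. h \<in> borel_measurable M \<Longrightarrow>
      (LINT x|M. of_real (g x) * h x) = (LINT x|M. of_real (f x) * h (T x))"
proof -
  define N where "N = distr (density M f) M T"
  have [measurable]: "f \<in> borel_measurable M" using f by simp
  have N_eq: "emeasure N A = (\<integral>\<^sup>+x. ennreal (f x) * indicator (T -` A \<inter> space M) x \<partial>M)" if "A \<in> sets M" for A
    using that by (simp add: N_def emeasure_distr emeasure_density)
  have "emeasure N (space N) = (\<integral>\<^sup>+x. ennreal (f x) \<partial>M)"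
  proof -
    have "T -` space M \<inter> space M = space M"
      using measurable_space[OF T_measurable] by auto
    hence "emeasure N (space N) = (\<integral>\<^sup>+x. ennreal (f x) * indicator (space M) x \<partial>M)"
      using N_eq[of "space M"] by (simp add: N_def)
    also have "\<dots> = (\<integral>\<^sup>+x. ennreal (f x) \<partial>M)"
      by (intro nn_integral_cong) auto
    finally show ?thesis .
  qed
  hence fin: "finite_measure N"
    using f by (intro finite_measureI) (simp add: nn_integral_eq_integral)
  have ac: "absolutely_continuous M N"
    unfolding absolutely_continuous_def
  proof
    fix A assume A: "A \<in> null_sets M"
    have "emeasure M (T -` A \<inter> space M) = emeasure (distr M M T) A"
      using A by (intro emeasure_distr[symmetric]) auto
    hence "T -` A \<inter> space M \<in> null_sets M"
      using A measurable_sets[OF T_measurable, of A] by (simp add: distr_T null_sets_def)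
    hence "AE x in M. x \<notin> T -` A \<inter> space M" by (rule AE_not_in)
    hence "emeasure N A = 0"
      unfolding N_eq[OF null_setsD2[OF A]]
      by (subst nn_integral_0_iff_AE) (use A in \<open>auto simp: indicator_def\<close>)
    thus "A \<in> null_sets N" using A by (auto simp: null_sets_def N_def)
  qed
  have sets: "sets N = sets M" by (simp add: N_def)
  obtain g where g [measurable]: "g \<in> borel_measurable M" "AE x in M. RN_deriv M N x = ennreal (g x)" "\<And>x. 0 \<le> g x"
    using real_RN_deriv[OF fin ac sets] by metis
  have "density M g = density M (RN_deriv M N)"
    using g by (intro density_cong) auto
  also have "\<dots> = N" by (rule density_RN_deriv[OF ac sets])
  finally have dens: "density M g = N" .
  show ?thesis
  proof (rule that[of g])
    have "(\<integral>\<^sup>+x. ennreal (g x) \<partial>M) = emeasure N (space M)"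
      unfolding dens[symmetric] by (auto simp: emeasure_density intro!: nn_integral_cong)
    also have "\<dots> < \<infinity>"
      using finite_measure.emeasure_finite[OF fin, of "space M"] by (simp add: less_top)
    finally show "integrable M g"
      using g by (intro integrableI_nonneg) auto
    fix h :: "'a \<Rightarrow> complex" assume [measurable]: "h \<in> borel_measurable M"
    have "(LINT x|M. of_real (g x) * h x) = (LINT x|density M g. h x)"
      using g by (subst integral_density) (auto simp: scaleR_conv_of_real)
    also have "\<dots> = (LINT x|density M f. h (T x))"
      unfolding dens N_def by (subst integral_distr) auto
    also have "\<dots> = (LINT x|M. of_real (f x) * h (T x))"
      using f by (subst integral_density) (auto simp: scaleR_conv_of_real)
    finally show "(LINT x|M. of_real (g x) * h x) = (LINT x|M. of_real (f x) * h (T x))" .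
  qed (use g in auto)
qed

lemma Linf_comp_T: "h \<in> Linf M \<Longrightarrow> (\<lambda>x. h (T x)) \<in> Linf M"
  unfolding Linf_iff using AE_T by fastforce

lemma transfer_exists_real:
  assumes f: "integrable M f"
  obtains g :: "'a \<Rightarrow> real" where "integrable M g"
    "\<And>h. h \<in> Linf M \<Longrightarrow> (LINT x|M. of_real (g x) * h x) = (LINT x|M. of_real (f x) * h (T x))"
proof -
  have f1: "integrable M (\<lambda>x. max 0 (f x))" and f2: "integrable M (\<lambda>x. max 0 (- f x))"
    using f by auto
  obtain g1 where g1: "integrable M g1" "\<And>x. 0 \<le> g1 x" "\<And>h :: 'a \<Rightarrow> complex. h \<in> borel_measurable M \<Longrightarrow>
      (LINT x|M. of_real (g1 x) * h x) = (LINT x|M. of_real (max 0 (f x)) * h (T x))"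
    using transfer_exists_nonneg[OF f1] by auto
  obtain g2 where g2: "integrable M g2" "\<And>x. 0 \<le> g2 x" "\<And>h :: 'a \<Rightarrow> complex. h \<in> borel_measurable M \<Longrightarrow>
      (LINT x|M. of_real (g2 x) * h x) = (LINT x|M. of_real (max 0 (- f x)) * h (T x))"
    using transfer_exists_nonneg[OF f2] by auto
  show ?thesis
  proof (rule that[of "\<lambda>x. g1 x - g2 x"])
    fix h assume h: "h \<in> Linf M"
    note h' = Linf_comp_T[OF h]
    have "(LINT x|M. of_real (g1 x - g2 x) * h x) = (LINT x|M. of_real (g1 x) * h x) - (LINT x|M. of_real (g2 x) * h x)"
      unfolding of_real_diff left_diff_distrib
      using g1 g2 h by (intro Bochner_Integration.integral_diff integrable_mult_Linf) auto
    also have "\<dots> = (LINT x|M. of_real (max 0 (f x)) * h (T x)) - (LINT x|M. of_real (max 0 (- f x)) * h (T x))"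
      using g1 g2 h by (auto simp: Linf_iff)
    also have "\<dots> = (LINT x|M. of_real (max 0 (f x)) * h (T x) - of_real (max 0 (- f x)) * h (T x))"
      using f1 f2 h' by (intro Bochner_Integration.integral_diff[symmetric] integrable_mult_Linf) auto
    also have "\<dots> = (LINT x|M. of_real (f x) * h (T x))"
      by (intro Bochner_Integration.integral_cong) (auto simp: max_def)
    finally show "(LINT x|M. of_real (g1 x - g2 x) * h x) = (LINT x|M. of_real (f x) * h (T x))" .
  qed (use g1 g2 in auto)
qed

text \<open>\<open>transfer_op\<close> is a choice, so its defining property has to be backed by
  existence, obtained for the real and imaginary parts separately.\<close>

lemma transfer_op_spec:
  assumes f: "integrable M f"
  shows "integrable M (transfer_op M T f)"
    "h \<in> Linf M \<Longrightarrow> (LINT x|M. transfer_op M T f x * h x) = (LINT x|M. f x * h (T x))"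
proof -
  have f1: "integrable M (\<lambda>x. Re (f x))" and f2: "integrable M (\<lambda>x. Im (f x))"
    using f by auto
  obtain g1 where g1: "integrable M g1"
    "\<And>h. h \<in> Linf M \<Longrightarrow> (LINT x|M. of_real (g1 x) * h x) = (LINT x|M. of_real (Re (f x)) * h (T x))"
    using transfer_exists_real[OF f1] by blast
  obtain g2 where g2: "integrable M g2"
    "\<And>h. h \<in> Linf M \<Longrightarrow> (LINT x|M. of_real (g2 x) * h x) = (LINT x|M. of_real (Im (f x)) * h (T x))"
    using transfer_exists_real[OF f2] by blast
  have "\<exists>g. integrable M g \<and> (\<forall>h\<in>Linf M. (LINT x|M. g x * h x) = (LINT x|M. f x * h (T x)))"
  proof (intro exI[of _ "\<lambda>x. of_real (g1 x) + \<i> * of_real (g2 x)"] conjI ballI)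
    show "integrable M (\<lambda>x. of_real (g1 x) + \<i> * of_real (g2 x) :: complex)"
      using g1 g2 by auto
    fix h assume h: "h \<in> Linf M"
    note h' = Linf_comp_T[OF h]
    have "(LINT x|M. (of_real (g1 x) + \<i> * of_real (g2 x)) * h x) =
        (LINT x|M. of_real (g1 x) * h x + \<i> * (of_real (g2 x) * h x))"
      by (simp add: algebra_simps)
    also have "\<dots> = (LINT x|M. of_real (g1 x) * h x) + \<i> * (LINT x|M. of_real (g2 x) * h x)"
    proof -
      have "integrable M (\<lambda>x. of_real (g1 x) * h x)" "integrable M (\<lambda>x. of_real (g2 x) * h x)"
        using g1 g2 h by (auto intro!: integrable_mult_Linf)
      thus ?thesis by simp
    qed
    also have "\<dots> = (LINT x|M. of_real (Re (f x)) * h (T x)) + \<i> * (LINT x|M. of_real (Im (f x)) * h (T x))"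
      using g1 g2 h by simp
    also have "\<dots> = (LINT x|M. of_real (Re (f x)) * h (T x) + \<i> * (of_real (Im (f x)) * h (T x)))"
    proof -
      have "integrable M (\<lambda>x. of_real (Re (f x)) * h (T x))" "integrable M (\<lambda>x. of_real (Im (f x)) * h (T x))"
        using f1 f2 h' by (auto intro!: integrable_mult_Linf)
      thus ?thesis by simp
    qed
    also have "\<dots> = (LINT x|M. f x * h (T x))"
    proof (intro Bochner_Integration.integral_cong refl)
      fix x
      show "of_real (Re (f x)) * h (T x) + \<i> * (of_real (Im (f x)) * h (T x)) = f x * h (T x)"
        by (subst (3) complex_eq) (simp add: algebra_simps)
    qed
    finally show "(LINT x|M. (of_real (g1 x) + \<i> * of_real (g2 x)) * h x) = (LINT x|M. f x * h (T x))" .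
  qed
  from someI_ex[OF this] show "integrable M (transfer_op M T f)"
    "h \<in> Linf M \<Longrightarrow> (LINT x|M. transfer_op M T f x * h x) = (LINT x|M. f x * h (T x))"
    unfolding transfer_op_def[symmetric] by auto
qed

lemma integral_transfer_op:
  assumes "integrable M f" shows "(LINT x|M. transfer_op M T f x) = (LINT x|M. f x)"
  using transfer_op_spec(2)[OF assms, of "\<lambda>_. 1"] by (simp add: Linf_iff) (metis eventually_True order_refl norm_one)

text \<open>Duality: the image is tested against its own conjugate phase \<open>h\<close>, and
  composition with \<open>T\<close> keeps the modulus of \<open>h\<close> at most 1.\<close>

lemma transfer_op_L1_contraction:
  assumes f: "integrable M f"
  shows "(LINT x|M. cmod (transfer_op M T f x)) \<le> (LINT x|M. cmod (f x))"
proof -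
  let ?g = "transfer_op M T f"
  have g: "integrable M ?g" by (rule transfer_op_spec(1)[OF f])
  obtain h where h: "h \<in> Linf M" "\<And>x. cmod (h x) \<le> 1" "\<And>x. ?g x * h x = of_real (cmod (?g x))"
    using exists_phase[of ?g M] g by auto
  have "of_real (LINT x|M. cmod (?g x)) = (LINT x|M. ?g x * h x)"
    by (simp add: h)
  also have "\<dots> = (LINT x|M. f x * h (T x))" by (rule transfer_op_spec(2)[OF f h(1)])
  finally have "cmod (of_real (LINT x|M. cmod (?g x))) = cmod (LINT x|M. f x * h (T x))" by (rule arg_cong)
  hence "(LINT x|M. cmod (?g x)) = cmod (LINT x|M. f x * h (T x))" by simp
  moreover have "cmod (LINT x|M. f x * h (T x)) \<le> (LINT x|M. cmod (f x * h (T x)))"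
    by (rule integral_norm_bound)
  moreover have "(LINT x|M. cmod (f x * h (T x))) \<le> (LINT x|M. cmod (f x))"
  proof (rule integral_mono)
    show "integrable M (\<lambda>x. cmod (f x * h (T x)))"
      using f Linf_comp_T[OF h(1)] by (intro integrable_norm integrable_mult_Linf)
    show "cmod (f x * h (T x)) \<le> cmod (f x)" for x
      using h(2)[of "T x"] by (simp add: norm_mult mult_left_le)
  qed (use f in auto)
  ultimately show ?thesis
    by linarith
qed

text \<open>Testing the difference from 1 against its phase \<open>h\<close> gives the integral of
  \<open>h\<close> composed with \<open>T\<close> minus that of \<open>h\<close>, which vanishes by
  invariance.\<close>

lemma transfer_op_one: "AE x in M. transfer_op M T (\<lambda>_. 1) x = 1"
proof -
  let ?g = "transfer_op M T (\<lambda>_. 1)"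
  have 1: "integrable M (\<lambda>_. 1 :: complex)" by simp
  have g: "integrable M ?g" by (rule transfer_op_spec(1)[OF 1])
  hence g': "integrable M (\<lambda>x. ?g x - 1)" by simp
  obtain h where h: "h \<in> Linf M" "\<And>x. cmod (h x) \<le> 1" "\<And>x. (?g x - 1) * h x = of_real (cmod (?g x - 1))"
    using exists_phase[of "\<lambda>x. ?g x - 1" M] g' by auto
  have [measurable]: "h \<in> borel_measurable M" using h by (simp add: Linf_iff)
  have "of_real (LINT x|M. cmod (?g x - 1)) = (LINT x|M. (?g x - 1) * h x)"
    by (simp add: h)
  also have "\<dots> = (LINT x|M. ?g x * h x - 1 * h x)"
    by (simp only: left_diff_distrib)
  also have "\<dots> = (LINT x|M. ?g x * h x) - (LINT x|M. 1 * h x)"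
    using g 1 h(1) by (intro Bochner_Integration.integral_diff integrable_mult_Linf)
  also have "(LINT x|M. ?g x * h x) = (LINT x|M. h (T x))"
    using transfer_op_spec(2)[OF 1 h(1)] by simp
  also have "\<dots> = (LINT x|distr M M T. h x)"
    by (subst integral_distr) auto
  finally have "(LINT x|M. cmod (?g x - 1)) = 0"
    by (simp add: distr_T)
  hence "AE x in M. cmod (?g x - 1) = 0"
    using g' by (subst (asm) integral_nonneg_eq_0_iff_AE) auto
  thus ?thesis by eventually_elim auto
qed

end

section \<open>Exponential decay of correlations from the spectral gap\<close>

text \<open>A linear projection along the null vectors of the seminorm turns operators that are linear only
  up to null vectors into linear ones.\<close>

lemma (in normed_subspace) exists_projection_along_null_vectors:
  obtains \<pi> where "\<And>f g. \<pi> (f + g) = \<pi> f + \<pi> g" "\<And>c f. \<pi> (scl c f) = scl c (\<pi> f)"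
    "\<And>f. f \<in> X \<Longrightarrow> \<pi> f \<in> X" "\<And>f. f \<in> X \<Longrightarrow> nrm (\<pi> f - f) = 0"
    "\<And>f. f \<in> X \<Longrightarrow> nrm f = 0 \<Longrightarrow> \<pi> f = 0"
proof -
  define Z where "Z = {f \<in> X. nrm f = 0}"
  have Z: "subspace Z"
  proof (rule subspaceI)
    fix f g assume "f \<in> Z" "g \<in> Z"
    thus "f + g \<in> Z"
      using nrm_add[of f g] nrm_nonneg[of "f + g"] X_add[of f g] by (auto simp: Z_def)
  qed (auto simp: Z_def nrm_zero nrm_scale intro: X_zero X_scale)
  \<comment> \<open>A basis of the null space is extended to one of \<open>X\<close>. The projection
    kills the former and fixes the added vectors, which makes it linear and changes vectors only by
    null ones.\<close>
  obtain B1 where B1: "B1 \<subseteq> Z" "independent B1" "Z \<subseteq> span B1"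
    using maximal_independent_subset by blast
  have "B1 \<subseteq> X" using B1(1) by (auto simp: Z_def)
  obtain B where B: "B1 \<subseteq> B" "B \<subseteq> X" "independent B" "X \<subseteq> span B"
    using maximal_independent_subset_extend[OF \<open>B1 \<subseteq> X\<close> B1(2)] by blast
  interpret vector_space_pair scl scl by unfold_locales
  obtain \<pi> where lin: "Vector_Spaces.linear scl scl \<pi>" and \<pi>_B: "\<And>x. x \<in> B \<Longrightarrow> \<pi> x = (if x \<in> B1 then 0 else x)"
    using linear_independent_extend[OF B(3), of "\<lambda>x. if x \<in> B1 then 0 else x"] by blast
  interpret \<pi>: Vector_Spaces.linear scl scl \<pi> by (rule lin)
  have near: "\<pi> f - f \<in> Z" if "f \<in> X" for f
  proof -
    have "subspace {f. \<pi> f - f \<in> Z}"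
    proof (rule subspaceI)
      fix f g assume "f \<in> {f. \<pi> f - f \<in> Z}" "g \<in> {f. \<pi> f - f \<in> Z}"
      hence "(\<pi> f - f) + (\<pi> g - g) \<in> Z" using subspace_add[OF Z] by blast
      thus "f + g \<in> {f. \<pi> f - f \<in> Z}" by (simp add: \<pi>.add algebra_simps)
    next
      fix c f assume "f \<in> {f. \<pi> f - f \<in> Z}"
      hence "scl c (\<pi> f - f) \<in> Z" using subspace_scale[OF Z] by blast
      thus "scl c f \<in> {f. \<pi> f - f \<in> Z}" by (simp add: \<pi>.scale scale_right_diff_distrib)
    qed (simp add: \<pi>.zero subspace_0[OF Z])
    moreover have "B \<subseteq> {f. \<pi> f - f \<in> Z}"
      using \<pi>_B B1 subspace_0[OF Z] subspace_neg[OF Z] by auto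
    ultimately have "span B \<subseteq> {f. \<pi> f - f \<in> Z}" by (intro span_minimal)
    thus ?thesis using that B by auto
  qed
  show ?thesis
  proof (rule that[of \<pi>])
    fix f assume f: "f \<in> X"
    show "nrm (\<pi> f - f) = 0" using near[OF f] by (simp add: Z_def)
    have "f + (\<pi> f - f) \<in> X" using near[OF f] f by (intro X_add) (auto simp: Z_def)
    thus "\<pi> f \<in> X" by simp
    assume "nrm f = 0"
    hence "f \<in> span B1" using f B1 by (auto simp: Z_def)
    moreover have "subspace {f. \<pi> f = 0}"
      by (rule subspaceI) (auto simp: \<pi>.zero \<pi>.add \<pi>.scale)
    moreover have "B1 \<subseteq> {f. \<pi> f = 0}" using \<pi>_B B by auto
    ultimately show "\<pi> f = 0" using span_minimal by blast
  qed (auto simp: \<pi>.add \<pi>.scale)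
qed

section \<open>The function algebra and representatives of its classes\<close>

locale spectral_gap_system =
  fixes M :: "'a measure" and T :: "'a \<Rightarrow> 'a" and F :: "('a \<Rightarrow> complex) set" and nrm :: "('a \<Rightarrow> complex) \<Rightarrow> real"
  assumes property_C: "property_C M T F nrm"

sublocale spectral_gap_system \<subseteq> measure_preserving M T
  using property_C by (auto simp: property_C_def measure_preserving_def measure_preserving_axioms_def)

context spectral_gap_system
begin

lemma algebra: "banach_function_algebra M F nrm"
  and const_mem: "(\<lambda>_. c) \<in> F"
  and Linf_le: "f \<in> F \<Longrightarrow> Linf_norm M f \<le> ereal (nrm f)"
  and transfer_mem: "f \<in> F \<Longrightarrow> transfer_op M T f \<in> F"
  and gap: "has_spectral_gap M F nrm (transfer_op M T)"
  using property_C by (auto simp: property_C_def)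

abbreviation scl :: "complex \<Rightarrow> ('a \<Rightarrow> complex) \<Rightarrow> 'a \<Rightarrow> complex" where
  "scl c f \<equiv> (\<lambda>x. c * f x)"

lemma add_mem: "f \<in> F \<Longrightarrow> g \<in> F \<Longrightarrow> f + g \<in> F"
  and mult_mem: "f \<in> F \<Longrightarrow> g \<in> F \<Longrightarrow> (\<lambda>x. f x * g x) \<in> F"
  and scale_mem: "f \<in> F \<Longrightarrow> scl c f \<in> F"
  and norm_add: "f \<in> F \<Longrightarrow> g \<in> F \<Longrightarrow> nrm (f + g) \<le> nrm f + nrm g"
  and norm_scale: "f \<in> F \<Longrightarrow> nrm (scl c f) = cmod c * nrm f"
  and norm_mult_le: "f \<in> F \<Longrightarrow> g \<in> F \<Longrightarrow> nrm (\<lambda>x. f x * g x) \<le> nrm f * nrm g"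
  and norm_eq_0_iff: "f \<in> F \<Longrightarrow> nrm f = 0 \<longleftrightarrow> ae_eq M f (\<lambda>_. 0)"
  and F_borel: "f \<in> F \<Longrightarrow> f \<in> borel_measurable M"
  using algebra unfolding banach_function_algebra_def plus_fun_def by blast+

sublocale F: normed_subspace scl F nrm
proof unfold_locales
  show "module.subspace scl F"
  proof (subst module.subspace_def)
    show "module scl" by unfold_locales (auto simp: fun_eq_iff algebra_simps)
    show "0 \<in> F \<and> (\<forall>x\<in>F. \<forall>y\<in>F. x + y \<in> F) \<and> (\<forall>c. \<forall>x\<in>F. scl c x \<in> F)"
      using const_mem[of 0] by (auto simp: zero_fun_def add_mem scale_mem)
  qed
qed (auto simp: fun_eq_iff algebra_simps norm_add norm_scale)

lemma AE_le_norm: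
  assumes "f \<in> F" shows "AE x in M. cmod (f x) \<le> nrm f"
proof -
  have "AE x in M. ereal (cmod (f x)) \<le> esssup M (\<lambda>x. ereal (cmod (f x)))"
    by (rule esssup_AE)
  thus ?thesis
    by eventually_elim (use Linf_le[OF assms] in \<open>simp add: Linf_norm_def, metis ereal_less_eq(3) order_trans\<close>)
qed

lemma F_integrable: assumes "f \<in> F" shows "integrable M f"
  using AE_le_norm[OF assms] F_borel[OF assms] by (intro integrable_const_bound[of _ "nrm f"]) auto

lemma cmod_integral_le: assumes "f \<in> F" shows "cmod (LINT x|M. f x) \<le> nrm f"
proof -
  have "cmod (LINT x|M. f x) \<le> (LINT x|M. cmod (f x))" by (rule integral_norm_bound)
  also have "\<dots> \<le> (LINT x|M. nrm f)"
    using AE_le_norm[OF assms] F_integrable[OF assms] by (intro integral_mono_AE) auto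
  finally show ?thesis by (simp add: prob_space)
qed

lemma ae_eq_iff: "f \<in> F \<Longrightarrow> g \<in> F \<Longrightarrow> ae_eq M f g \<longleftrightarrow> nrm (f - g) = 0"
  by (subst norm_eq_0_iff) (auto simp: F.X_diff ae_eq_def)

text \<open>Boundedness sends the null function \<open>f - g\<close> to a null function; additivity
  up to null sets transfers this to the two images.\<close>

lemma bounded_operator_cong:
  assumes U: "bounded_operator M F nrm U" and f: "f \<in> F" "g \<in> F" "ae_eq M f g"
  shows "ae_eq M (U f) (U g)"
proof -
  have fg: "f - g \<in> F" using f by (intro F.X_diff)
  have mem: "U f \<in> F" "U g \<in> F" "U (f - g) \<in> F" using U f fg by (auto simp: bounded_operator_def)
  obtain K where "nrm (U (f - g)) \<le> K * nrm (f - g)"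
    using U fg by (auto simp: bounded_operator_def)
  hence "nrm (U (f - g)) = 0"
    using f ae_eq_iff[of f g] F.nrm_nonneg[OF mem(3)] by simp
  hence "ae_eq M (U (f - g)) (\<lambda>_. 0)" using mem norm_eq_0_iff by blast
  moreover have "ae_eq M (U (\<lambda>x. (f - g) x + g x)) (\<lambda>x. U (f - g) x + U g x)"
    using U fg f unfolding bounded_operator_def by blast
  ultimately show ?thesis
    unfolding ae_eq_def by (auto elim!: eventually_elim2)
qed

text \<open>\<open>proj\<close> fixes such a projection, \<open>Q\<close> is its image (one representative for every class), and \<open>V\<close> is
  the transfer operator followed by \<open>proj\<close>.\<close>

definition proj :: "('a \<Rightarrow> complex) \<Rightarrow> 'a \<Rightarrow> complex" where
  "proj = (SOME \<pi>. (\<forall>f g. \<pi> (f + g) = \<pi> f + \<pi> g) \<and> (\<forall>c f. \<pi> (scl c f) = scl c (\<pi> f)) \<and>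
    (\<forall>f\<in>F. \<pi> f \<in> F) \<and> (\<forall>f\<in>F. nrm (\<pi> f - f) = 0) \<and> (\<forall>f\<in>F. nrm f = 0 \<longrightarrow> \<pi> f = 0))"

lemma proj_add: "proj (f + g) = proj f + proj g"
  and proj_scale: "proj (scl c f) = scl c (proj f)"
  and proj_mem: "f \<in> F \<Longrightarrow> proj f \<in> F"
  and proj_near: "f \<in> F \<Longrightarrow> nrm (proj f - f) = 0"
  and proj_null: "f \<in> F \<Longrightarrow> nrm f = 0 \<Longrightarrow> proj f = 0"
proof -
  have "\<exists>\<pi>. (\<forall>f g. \<pi> (f + g) = \<pi> f + \<pi> g) \<and> (\<forall>c f. \<pi> (scl c f) = scl c (\<pi> f)) \<and>
    (\<forall>f\<in>F. \<pi> f \<in> F) \<and> (\<forall>f\<in>F. nrm (\<pi> f - f) = 0) \<and> (\<forall>f\<in>F. nrm f = 0 \<longrightarrow> \<pi> f = 0)"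
    by (rule F.exists_projection_along_null_vectors) blast
  from someI_ex[OF this] show "proj (f + g) = proj f + proj g" "proj (scl c f) = scl c (proj f)"
    "f \<in> F \<Longrightarrow> proj f \<in> F" "f \<in> F \<Longrightarrow> nrm (proj f - f) = 0" "f \<in> F \<Longrightarrow> nrm f = 0 \<Longrightarrow> proj f = 0"
    unfolding proj_def[symmetric] by blast+
qed

lemma proj_diff: "proj (f - g) = proj f - proj g"
  using proj_add[of "f - g" g] by simp

lemma proj_ae: "f \<in> F \<Longrightarrow> ae_eq M (proj f) f"
  using ae_eq_iff proj_mem proj_near by blast

lemma proj_eq: "f \<in> F \<Longrightarrow> g \<in> F \<Longrightarrow> ae_eq M f g \<Longrightarrow> proj f = proj g"
  using ae_eq_iff[of f g] proj_null[of "f - g"] F.X_diff[of f g] by (simp add: proj_diff)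

lemma norm_cong: "f \<in> F \<Longrightarrow> g \<in> F \<Longrightarrow> ae_eq M f g \<Longrightarrow> nrm f = nrm g"
  using algebra F_borel unfolding banach_function_algebra_def by metis

lemma norm_proj: "f \<in> F \<Longrightarrow> nrm (proj f) = nrm f"
  using norm_cong proj_ae proj_mem by blast

definition Q :: "('a \<Rightarrow> complex) set" where "Q = proj ` F"

lemma Q_sub: "f \<in> Q \<Longrightarrow> f \<in> F"
  by (auto simp: Q_def proj_mem)

lemma proj_Q: "f \<in> F \<Longrightarrow> proj f \<in> Q"
  by (simp add: Q_def)

lemma proj_id: "f \<in> Q \<Longrightarrow> proj f = f"
  by (auto simp: Q_def intro!: proj_eq proj_mem proj_ae)

lemma Q_null: "f \<in> Q \<Longrightarrow> nrm f = 0 \<Longrightarrow> f = 0"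
  using proj_null[of f] by (simp add: proj_id Q_sub)

sublocale Q: normed_subspace scl Q nrm
proof unfold_locales
  have "0 \<in> Q" using proj_null[OF F.X_zero] F.nrm_zero F.X_zero by (force simp: Q_def)
  moreover have "f + g \<in> Q" if "f \<in> Q" "g \<in> Q" for f g
    using that unfolding Q_def by (auto simp flip: proj_add intro: add_mem)
  moreover have "scl c f \<in> Q" if "f \<in> Q" for c f
    using that unfolding Q_def by (auto simp flip: proj_scale intro: scale_mem)
  ultimately show "F.subspace Q"
    by (auto simp: F.subspace_def)
qed (auto intro: norm_add norm_scale Q_sub)

text \<open>\<open>proj\<close> takes equal values on functions that agree almost everywhere, so
  linearity up to null sets becomes exact.\<close>

lemma bounded_endo_proj:
  assumes U: "bounded_operator M F nrm U"
  shows "Q.bounded_endo (\<lambda>f. proj (U f))"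
  unfolding Q.bounded_endo_def
proof (intro conjI ballI allI)
  have mem: "U f \<in> F" if "f \<in> Q" for f using U Q_sub[OF that] by (auto simp: bounded_operator_def)
  show "proj (U f) \<in> Q" if "f \<in> Q" for f using mem[OF that] by (rule proj_Q)
  show "proj (U (f + g)) = proj (U f) + proj (U g)" if "f \<in> Q" "g \<in> Q" for f g
  proof -
    have "ae_eq M (U (\<lambda>x. f x + g x)) (\<lambda>x. U f x + U g x)"
      using U Q_sub that unfolding bounded_operator_def by blast
    hence "proj (U (f + g)) = proj (U f + U g)"
      using that by (intro proj_eq mem Q.X_add add_mem) (auto simp: plus_fun_def)
    thus ?thesis by (simp add: proj_add)
  qed
  show "proj (U (scl c f)) = scl c (proj (U f))" if "f \<in> Q" for c f
  proof -
    have "ae_eq M (U (scl c f)) (scl c (U f))"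
      using U Q_sub that unfolding bounded_operator_def by blast
    hence "proj (U (scl c f)) = proj (scl c (U f))"
      using that by (intro proj_eq mem Q.X_scale scale_mem)
    thus ?thesis by (simp add: proj_scale)
  qed
  obtain K where "\<And>f. f \<in> F \<Longrightarrow> nrm (U f) \<le> K * nrm f"
    using U unfolding bounded_operator_def by blast
  thus "\<exists>K. \<forall>f\<in>Q. nrm (proj (U f)) \<le> K * nrm f"
    using mem Q_sub by (auto simp: norm_proj)
qed

text \<open>Every \<open>z\<close> of modulus at least \<open>r\<close> lies in the resolvent set.
  The resolvents, followed by \<open>proj\<close>, become exact two-sided inverses on
  \<open>Q\<close>, as the abstract power bound requires.\<close>

lemma power_bound_of_spectral_radius:
  assumes N: "bounded_operator M F nrm N" and r: "0 < r" "operator_spectral_radius M F nrm N < ereal r"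
  shows "\<exists>C. \<forall>n. \<forall>f\<in>Q. nrm (((\<lambda>f. proj (N f)) ^^ n) f) \<le> C * r ^ n * nrm f"
proof (rule Q.power_bound_of_resolvent[OF bounded_endo_proj[OF N] r(1)])
  fix z assume z: "r \<le> cmod z"
  have "z \<notin> operator_spectrum M F nrm N"
  proof
    assume "z \<in> operator_spectrum M F nrm N"
    hence "ereal (cmod z) \<le> operator_spectral_radius M F nrm N"
      unfolding operator_spectral_radius_def by (rule SUP_upper)
    thus False using r z by (metis ereal_less_eq(3) not_le order_trans)
  qed
  then obtain R where R: "bounded_operator M F nrm R"
    and R_left: "\<And>f. f \<in> F \<Longrightarrow> ae_eq M (R (\<lambda>x. z * f x - N f x)) f"
    and R_right: "\<And>f. f \<in> F \<Longrightarrow> ae_eq M (\<lambda>x. z * R f x - N (R f) x) f"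
    by (auto simp: operator_spectrum_def)
  have N_mem: "N f \<in> F" and R_mem: "R f \<in> F" if "f \<in> F" for f
    using N R that by (auto simp: bounded_operator_def)
  have diff: "(\<lambda>x. f x - g x) = f - g" for f g :: "'a \<Rightarrow> complex" by (simp add: fun_eq_iff)
  show "\<exists>R. Q.bounded_endo R \<and> (\<forall>f\<in>Q. R (scl z f - proj (N f)) = f \<and> scl z (R f) - proj (N (R f)) = f)"
  proof (intro exI[of _ "\<lambda>f. proj (R f)"] conjI ballI bounded_endo_proj[OF R])
    fix f assume fQ: "f \<in> Q"
    hence f: "f \<in> F" by (rule Q_sub)
    have "ae_eq M (scl z f - proj (N f)) (scl z f - N f)"
      using proj_ae[OF N_mem[OF f]] by (auto simp: ae_eq_def)
    hence "ae_eq M (R (scl z f - proj (N f))) (R (scl z f - N f))"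
      using f by (intro bounded_operator_cong[OF R] F.X_diff scale_mem proj_mem N_mem)
    moreover have "ae_eq M (R (scl z f - N f)) f"
      using R_left[OF f] by (simp only: diff)
    ultimately have "ae_eq M (R (scl z f - proj (N f))) f"
      unfolding ae_eq_def by eventually_elim auto
    hence "proj (R (scl z f - proj (N f))) = proj f"
      using f by (intro proj_eq R_mem F.X_diff scale_mem proj_mem N_mem)
    thus "proj (R (scl z f - proj (N f))) = f" using fQ by (simp add: proj_id)
    have "ae_eq M (N (proj (R f))) (N (R f))"
      using f by (intro bounded_operator_cong[OF N] proj_ae proj_mem R_mem)
    hence "proj (N (proj (R f))) = proj (N (R f))"
      using f by (intro proj_eq N_mem proj_mem R_mem)
    hence "scl z (proj (R f)) - proj (N (proj (R f))) = proj (scl z (R f) - N (R f))"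
      by (simp add: proj_diff proj_scale)
    also have "\<dots> = proj f"
    proof (intro proj_eq F.X_diff scale_mem R_mem N_mem f)
      show "ae_eq M (scl z (R f) - N (R f)) f"
        using R_right[OF f] by (simp only: fun_diff_def)
    qed
    finally show "scl z (proj (R f)) - proj (N (proj (R f))) = f" using fQ by (simp add: proj_id)
  qed
qed

definition V :: "('a \<Rightarrow> complex) \<Rightarrow> 'a \<Rightarrow> complex" where
  "V f = proj (transfer_op M T f)"

lemma bounded_operator_transfer: "bounded_operator M F nrm (transfer_op M T)"
  using gap by (simp add: has_spectral_gap_def)

lemma V_mem_Q: "f \<in> F \<Longrightarrow> V f \<in> Q"
  unfolding V_def by (intro proj_Q transfer_mem)

lemma V_mem: "f \<in> F \<Longrightarrow> V f \<in> F"
  by (rule Q_sub[OF V_mem_Q])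

lemma V_ae: "f \<in> F \<Longrightarrow> ae_eq M (V f) (transfer_op M T f)"
  unfolding V_def by (intro proj_ae transfer_mem)

lemma V_add: "f \<in> F \<Longrightarrow> g \<in> F \<Longrightarrow> V (f + g) = V f + V g"
proof -
  assume fg: "f \<in> F" "g \<in> F"
  have "ae_eq M (transfer_op M T (\<lambda>x. f x + g x)) (\<lambda>x. transfer_op M T f x + transfer_op M T g x)"
    using bounded_operator_transfer fg unfolding bounded_operator_def by blast
  hence "V (f + g) = proj (transfer_op M T f + transfer_op M T g)"
    unfolding V_def using fg by (intro proj_eq transfer_mem add_mem) (auto simp: plus_fun_def)
  thus ?thesis by (simp add: V_def proj_add)
qed

lemma V_scale: "f \<in> F \<Longrightarrow> V (scl c f) = scl c (V f)"
proof -
  assume f: "f \<in> F"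
  have "ae_eq M (transfer_op M T (scl c f)) (scl c (transfer_op M T f))"
    using bounded_operator_transfer f unfolding bounded_operator_def by blast
  hence "V (scl c f) = proj (scl c (transfer_op M T f))"
    unfolding V_def using f by (intro proj_eq transfer_mem scale_mem)
  thus ?thesis by (simp add: V_def proj_scale)
qed

lemma V_cong: "f \<in> F \<Longrightarrow> g \<in> F \<Longrightarrow> ae_eq M f g \<Longrightarrow> V f = V g"
  unfolding V_def by (intro proj_eq transfer_mem bounded_operator_cong[OF bounded_operator_transfer])

lemma V_power_mem: "f \<in> F \<Longrightarrow> (V ^^ n) f \<in> F"
  by (induction n) (auto intro: V_mem)

lemma V_power_add: "f \<in> F \<Longrightarrow> g \<in> F \<Longrightarrow> (V ^^ n) (f + g) = (V ^^ n) f + (V ^^ n) g"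
  by (induction n) (auto simp: V_add V_power_mem)

lemma V_power_scale: "f \<in> F \<Longrightarrow> (V ^^ n) (scl c f) = scl c ((V ^^ n) f)"
  by (induction n) (auto simp: V_scale V_power_mem)

lemma integral_cong_ae_eq: "f \<in> F \<Longrightarrow> g \<in> F \<Longrightarrow> ae_eq M f g \<Longrightarrow> (LINT x|M. f x) = (LINT x|M. g x)"
  unfolding ae_eq_def by (intro integral_cong_AE F_borel)

lemma integral_V: "f \<in> F \<Longrightarrow> (LINT x|M. V f x) = (LINT x|M. f x)"
  using integral_cong_ae_eq[OF V_mem transfer_mem V_ae] integral_transfer_op[OF F_integrable] by simp

lemma integral_V_power: "f \<in> F \<Longrightarrow> (LINT x|M. (V ^^ n) f x) = (LINT x|M. f x)"
  by (induction n) (auto simp: integral_V V_power_mem)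

lemma L1_contraction_V:
  assumes f: "f \<in> F" shows "(LINT x|M. cmod (V f x)) \<le> (LINT x|M. cmod (f x))"
proof -
  have "(LINT x|M. cmod (V f x)) = (LINT x|M. cmod (transfer_op M T f x))"
    using V_ae[OF f] F_borel[OF V_mem[OF f]] F_borel[OF transfer_mem[OF f]]
    by (intro integral_cong_AE) (auto simp: ae_eq_def)
  thus ?thesis using transfer_op_L1_contraction[OF F_integrable[OF f]] by simp
qed

lemma V_one: "ae_eq M (V (\<lambda>_. 1)) (\<lambda>_. 1)"
  using V_ae[OF const_mem[of 1]] transfer_op_one unfolding ae_eq_def by eventually_elim auto

lemma V_power_one: "nrm ((V ^^ n) (\<lambda>_. 1) - (\<lambda>_. 1)) = 0"
proof (induction n)
  case 0
  show ?case using F.nrm_zero by (simp add: zero_fun_def fun_diff_def)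
next
  case (Suc n)
  have "ae_eq M ((V ^^ n) (\<lambda>_. 1)) (\<lambda>_. 1)"
    using Suc by (subst ae_eq_iff) (intro V_power_mem const_mem)+
  hence "V ((V ^^ n) (\<lambda>_. 1)) = V (\<lambda>_. 1)"
    by (intro V_cong V_power_mem const_mem)
  hence "ae_eq M ((V ^^ Suc n) (\<lambda>_. 1)) (\<lambda>_. 1)"
    using V_one by simp
  thus ?case by (subst (asm) ae_eq_iff) (intro V_power_mem const_mem)+
qed

text \<open>The leading eigenvalue has modulus at most 1 because the transfer operator contracts \<open>L\<^sup>1\<close>. The
  constant function is fixed; its decomposition forces the eigenvalue to be 1 and the eigenspace to
  consist of constants, and invariance of the integral identifies the projection.\<close>

theorem exponential_decay:
  obtains C r where "0 \<le> C" "0 < r" "r < 1"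
    "\<And>n f. f \<in> F \<Longrightarrow> nrm ((V ^^ n) f - (\<lambda>_. LINT x|M. f x)) \<le> C * r ^ n * nrm f"
proof -
  obtain lam P N where P: "bounded_operator M F nrm P" and N: "bounded_operator M F nrm N"
    and dec: "\<And>f. f \<in> F \<Longrightarrow> ae_eq M (transfer_op M T f) (\<lambda>x. lam * P f x + N f x)"
    and PP: "\<And>f. f \<in> F \<Longrightarrow> ae_eq M (P (P f)) (P f)"
    and dim: "one_dimensional_image M F P"
    and rad: "operator_spectral_radius M F nrm N < ereal (cmod lam)"
    and PN: "\<And>f. f \<in> F \<Longrightarrow> ae_eq M (P (N f)) (\<lambda>_. 0)"
    and NP: "\<And>f. f \<in> F \<Longrightarrow> ae_eq M (N (P f)) (\<lambda>_. 0)"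
    using gap unfolding has_spectral_gap_def by blast
  have P_mem: "P f \<in> F" and N_mem: "N f \<in> F" if "f \<in> F" for f
    using P N that by (auto simp: bounded_operator_def)
  define P' where "P' f = proj (P f)" for f
  define N' where "N' f = proj (N f)" for f
  have P': "Q.bounded_endo P'" and N': "Q.bounded_endo N'"
    unfolding P'_def N'_def by (rule bounded_endo_proj[OF P], rule bounded_endo_proj[OF N])
  note P'_mem = Q.endo_mem[OF P'] and N'_mem = Q.endo_mem[OF N']
  have zero: "(\<lambda>_. 0) \<in> F" by (rule const_mem)
  have proj_zero: "proj (\<lambda>_. 0) = 0"
    using proj_null[OF F.X_zero] F.nrm_zero by (simp add: zero_fun_def)
  have V_Q: "V f = scl lam (P' f) + N' f" if "f \<in> Q" for f
  proof -
    note f = Q_sub[OF that]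
    have "V f = proj (scl lam (P f) + N f)"
      unfolding V_def using dec[OF f] f
      by (intro proj_eq transfer_mem add_mem scale_mem P_mem N_mem) (auto simp: plus_fun_def)
    thus ?thesis by (simp add: P'_def N'_def proj_add proj_scale)
  qed
  have P'P: "P' (proj (P f)) = proj (P f)" if f: "f \<in> F" for f
  proof -
    have "P' (proj (P f)) = proj (P (P f))"
      unfolding P'_def using f
      by (intro proj_eq P_mem proj_mem bounded_operator_cong[OF P] proj_ae)
    also have "\<dots> = proj (P f)" using f by (intro proj_eq P_mem PP)
    finally show ?thesis .
  qed
  have N'P: "N' (proj (P f)) = 0" if f: "f \<in> F" for f
  proof -
    have "N' (proj (P f)) = proj (N (P f))"
      unfolding N'_def using f
      by (intro proj_eq P_mem N_mem proj_mem bounded_operator_cong[OF N] proj_ae)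
    also have "\<dots> = proj (\<lambda>_. 0)" using f by (intro proj_eq P_mem N_mem NP zero)
    finally show ?thesis by (simp add: proj_zero)
  qed
  have P'N: "P' (proj (N f)) = 0" if f: "f \<in> F" for f
  proof -
    have "P' (proj (N f)) = proj (P (N f))"
      unfolding P'_def using f
      by (intro proj_eq P_mem N_mem proj_mem bounded_operator_cong[OF P] proj_ae)
    also have "\<dots> = proj (\<lambda>_. 0)" using f by (intro proj_eq P_mem N_mem PN zero)
    finally show ?thesis by (simp add: proj_zero)
  qed
  have PP': "P' (P' f) = P' f" and NP': "N' (P' f) = 0" and PN': "P' (N' f) = 0" if "f \<in> Q" for f
    using P'P N'P P'N Q_sub[OF that] by (simp_all add: P'_def N'_def)
  obtain p where p: "p \<in> Q" "p \<noteq> 0" "P' p = p" "\<And>f. f \<in> Q \<Longrightarrow> \<exists>c. P' f = scl c p"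
  proof -
    obtain q where q: "q \<in> F" "\<not> ae_eq M (P q) (\<lambda>_. 0)"
      "\<And>f. f \<in> F \<Longrightarrow> \<exists>c. ae_eq M (P f) (\<lambda>x. c * P q x)"
      using dim unfolding one_dimensional_image_def by blast
    have "P' (proj (P q)) = proj (P q)" using q by (intro P'P)
    moreover have "proj (P q) \<noteq> 0"
    proof
      assume "proj (P q) = 0"
      hence "ae_eq M 0 (P q)" using proj_ae[OF P_mem[OF q(1)]] by simp
      hence "ae_eq M (P q) (\<lambda>_. 0)" unfolding ae_eq_def by eventually_elim auto
      thus False using q(2) by blast
    qed
    moreover have "\<exists>c. P' f = scl c (proj (P q))" if "f \<in> Q" for f
    proof -
      obtain c where "ae_eq M (P f) (scl c (P q))" using q(3) Q_sub[OF \<open>f \<in> Q\<close>] by blast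
      hence "proj (P f) = proj (scl c (P q))"
        using Q_sub[OF that] q by (intro proj_eq P_mem scale_mem)
      thus ?thesis unfolding P'_def proj_scale by blast
    qed
    moreover have "proj (P q) \<in> Q" using q by (intro proj_Q P_mem)
    ultimately show ?thesis using that by blast
  qed
  have norm_p: "nrm p \<noteq> 0" using p Q_null by blast
  \<comment> \<open>\<open>N'\<close> annihilates \<open>p\<close>, so \<open>p\<close> is an
    eigenvector of \<open>V\<close> for \<open>lam\<close>, and its integral of modulus is
    positive.\<close>
  have lam_le: "cmod lam \<le> 1"
  proof -
    have "V p = scl lam p" using V_Q[OF p(1)] NP'[OF p(1)] p by simp
    hence "(LINT x|M. cmod (scl lam p x)) \<le> (LINT x|M. cmod (p x))"
      using L1_contraction_V[OF Q_sub[OF p(1)]] by simp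
    hence *: "cmod lam * (LINT x|M. cmod (p x)) \<le> 1 * (LINT x|M. cmod (p x))"
      by (simp add: norm_mult)
    have "(LINT x|M. cmod (p x)) \<noteq> 0"
    proof
      assume "(LINT x|M. cmod (p x)) = 0"
      hence "AE x in M. cmod (p x) = 0"
        using F_integrable[OF Q_sub[OF p(1)]] by (subst (asm) integral_nonneg_eq_0_iff_AE) auto
      hence "ae_eq M p (\<lambda>_. 0)" by (simp add: ae_eq_def)
      thus False using norm_p norm_eq_0_iff Q_sub p by blast
    qed
    moreover have "0 \<le> (LINT x|M. cmod (p x))" by simp
    ultimately have "0 < (LINT x|M. cmod (p x))" by linarith
    thus ?thesis using * by (simp only: mult_le_cancel_right)
  qed
  \<comment> \<open>The power bound needs a positive radius. A number separating the spectral radius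
    from the modulus of \<open>lam\<close> may fail to be positive, since the supremum over an empty
    spectrum is minus infinity; then half the modulus of \<open>lam\<close> serves, provided that
    \<open>lam\<close> is nonzero.\<close>
  obtain r where r: "0 < r" "r < cmod lam" "operator_spectral_radius M F nrm N < ereal r"
  proof -
    obtain r0 where r0: "operator_spectral_radius M F nrm N < ereal r0" "ereal r0 < ereal (cmod lam)"
      using ereal_dense2[OF rad] by blast
    obtain q where q: "q \<in> F" "\<not> ae_eq M (P q) (\<lambda>_. 0)"
      using dim unfolding one_dimensional_image_def by blast
    show ?thesis
    proof (cases "0 < r0")
      case True
      thus ?thesis using r0 that by simp
    next
      case False
      hence "r0 \<le> cmod lam / 2" using norm_ge_zero[of lam] by linarith
      with r0(1) have "operator_spectral_radius M F nrm N < ereal (cmod lam / 2)"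
        by (metis ereal_less_eq(3) less_le_trans)
      moreover have "lam \<noteq> 0"
      proof \<comment> \<open>A negative spectral radius means empty spectrum; then \<open>N\<close> would be invertible, against \<open>N P = 0\<close>.\<close>
        assume "lam = 0"
        hence "r0 < 0" using r0 by simp
        hence "ereal r0 < 0" by simp
        with r0(1) have neg: "operator_spectral_radius M F nrm N < 0" by (rule less_trans)
        have "z \<notin> operator_spectrum M F nrm N" for z
        proof
          assume "z \<in> operator_spectrum M F nrm N"
          hence "ereal (cmod z) \<le> operator_spectral_radius M F nrm N"
            unfolding operator_spectral_radius_def by (rule SUP_upper)
          with neg have "ereal (cmod z) < 0" by (rule le_less_trans[rotated])
          thus False using norm_ge_zero[of z] by (simp add: not_less[symmetric] del: norm_ge_zero)
        qed
        hence "0 \<notin> operator_spectrum M F nrm N" by blast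
        then obtain R where "bounded_operator M F nrm R" and R: "\<And>f. f \<in> F \<Longrightarrow> ae_eq M (R (\<lambda>x. 0 * f x - N f x)) f"
          by (auto simp: operator_spectrum_def)
        from R[OF P_mem[OF q(1)]] have 1: "ae_eq M (R (\<lambda>x. - N (P q) x)) (P q)" by simp
        from R[OF zero] have 2: "ae_eq M (R (\<lambda>x. - N (\<lambda>_. 0) x)) (\<lambda>_. 0)" by simp
        have "ae_eq M (N (\<lambda>x. 0 * q x)) (\<lambda>x. 0 * N q x)"
          using N q unfolding bounded_operator_def by blast
        hence 3: "ae_eq M (N (\<lambda>_. 0)) (\<lambda>_. 0)" by simp
        have neg: "(\<lambda>x. - f x) \<in> F" if "f \<in> F" for f
          using scale_mem[OF that, of "-1"] by simp
        have "ae_eq M (R (\<lambda>x. - N (P q) x)) (R (\<lambda>x. - N (\<lambda>_. 0) x))"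
        proof (rule bounded_operator_cong[OF \<open>bounded_operator M F nrm R\<close>])
          show "ae_eq M (\<lambda>x. - N (P q) x) (\<lambda>x. - N (\<lambda>_. 0) x)"
            using 3 NP[OF q(1)] unfolding ae_eq_def by eventually_elim auto
        qed (use q zero in \<open>auto intro!: neg N_mem P_mem\<close>)
        with 1 2 have "ae_eq M (P q) (\<lambda>_. 0)" unfolding ae_eq_def by eventually_elim auto
        thus False using q by blast
      qed
      ultimately show ?thesis using that[of "cmod lam / 2"] by simp
    qed
  qed
  obtain C where C: "\<And>n f. f \<in> Q \<Longrightarrow> nrm ((N' ^^ n) f) \<le> C * r ^ n * nrm f"
    using power_bound_of_spectral_radius[OF N r(1,3)] unfolding N'_def by blast
  \<comment> \<open>Positive exponents only: at exponent 0 the right-hand side would be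
    \<open>P' f + f\<close>.\<close>
  have V_Q_power: "(V ^^ Suc n) f = scl (lam ^ Suc n) (P' f) + (N' ^^ Suc n) f" if f: "f \<in> Q" for f n
  proof (induction n)
    case 0
    show ?case using V_Q[OF f] by simp
  next
    case (Suc n)
    have mem: "scl (lam ^ Suc n) (P' f) \<in> Q" "(N' ^^ Suc n) f \<in> Q"
      using f by (auto intro!: Q.X_scale P'_mem N'_mem Q.endo_power_mem[OF N'])
    have "P' ((N' ^^ Suc n) f) = 0" using PN' Q.endo_power_mem[OF N' f] by simp
    hence 1: "P' (scl (lam ^ Suc n) (P' f) + (N' ^^ Suc n) f) = scl (lam ^ Suc n) (P' f)"
      using mem f by (simp only: Q.endo_add[OF P'] Q.endo_scale[OF P'] P'_mem PP') simp
    have 2: "N' (scl (lam ^ Suc n) (P' f) + (N' ^^ Suc n) f) = N' ((N' ^^ Suc n) f)"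
      using mem f by (simp only: Q.endo_add[OF N'] Q.endo_scale[OF N'] P'_mem NP') (simp add: zero_fun_def plus_fun_def)
    have 3: "V (scl (lam ^ Suc n) (P' f) + (N' ^^ Suc n) f) =
        scl lam (scl (lam ^ Suc n) (P' f)) + N' ((N' ^^ Suc n) f)"
      unfolding V_Q[OF Q.X_add[OF mem]] 1 2 by (rule refl)
    have "(V ^^ Suc (Suc n)) f = V (scl (lam ^ Suc n) (P' f) + (N' ^^ Suc n) f)"
      unfolding funpow.simps(2)[of "Suc n" V] comp_apply Suc by (rule refl)
    moreover have "scl lam (scl (lam ^ Suc n) (P' f)) = scl (lam ^ Suc (Suc n)) (P' f)"
      by (simp only: power_Suc mult.assoc)
    ultimately show ?case
      unfolding 3 funpow.simps(2)[of "Suc n" N'] comp_apply by (rule trans[OF _ arg_cong])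
  qed
  define e where "e = proj (\<lambda>_. 1)"
  have e: "e \<in> Q" unfolding e_def by (intro proj_Q const_mem)
  have e_ae: "ae_eq M e (\<lambda>_. 1)" unfolding e_def by (intro proj_ae const_mem)
  have norm_e: "0 < nrm e"
  proof -
    have "\<not> ae_eq M e (\<lambda>_. 0)"
    proof
      assume "ae_eq M e (\<lambda>_. 0)"
      with e_ae have "AE x in M. False" unfolding ae_eq_def by eventually_elim auto
      thus False by simp
    qed
    thus ?thesis using norm_eq_0_iff[OF Q_sub[OF e]] Q.nrm_nonneg[OF e] by linarith
  qed
  have V_e: "(V ^^ n) e = e" for n
  proof (induction n)
    case (Suc n)
    have "V e = V (\<lambda>_. 1)" using e_ae by (intro V_cong Q_sub[OF e] const_mem)
    also have "V (\<lambda>_. 1) = proj (V (\<lambda>_. 1))" using V_mem_Q[OF const_mem] by (simp add: proj_id)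
    also have "\<dots> = e" unfolding e_def by (intro proj_eq V_mem const_mem V_one)
    finally show ?case using Suc by simp
  qed simp
  define a where "a = P' e"
  have a: "a \<in> Q" unfolding a_def by (intro P'_mem e)
  \<comment> \<open>Since \<open>V\<close> fixes \<open>e\<close>, its leading component times a
    power of \<open>lam\<close> reproduces \<open>e\<close> up to the decaying part.\<close>
  have near: "nrm (e - scl (lam ^ Suc n) a) \<le> C * r ^ Suc n * nrm e" for n
  proof -
    have "e = scl (lam ^ Suc n) a + (N' ^^ Suc n) e"
      using V_Q_power[OF e, of n] V_e[of "Suc n"] by (simp add: a_def)
    hence "e - scl (lam ^ Suc n) a = (N' ^^ Suc n) e"
      by (simp add: diff_eq_eq add.commute)
    thus ?thesis using C[OF e, of "Suc n"] by simp
  qed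
  have vanish: "x = 0" if q: "0 \<le> q" "q < 1" and x: "0 \<le> x" and le: "\<And>n. x \<le> b * q ^ Suc n" for x q b :: real
  proof -
    have "(\<lambda>n. q ^ Suc n) \<longlonglongrightarrow> 0"
      using q LIMSEQ_Suc[OF LIMSEQ_realpow_zero[of q]] by simp
    from tendsto_mult_left[OF this, of b]
    have "x \<le> b * 0" using le by (intro LIMSEQ_le_const) auto
    thus ?thesis using x by simp
  qed
  have lam0: "0 < cmod lam" using r by linarith
  have norm_a: "nrm a \<noteq> 0"
  proof
    assume "nrm a = 0"
    hence "nrm (scl (lam ^ Suc n) a) = 0" for n using Q.nrm_scale[OF a] by simp
    hence "nrm e \<le> (C * nrm e) * r ^ Suc n" for n
      using near[of n] Q.nrm_le_add_diff[OF e Q.X_scale[OF a], of "lam ^ Suc n"] by (simp add: mult_ac)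
    hence "nrm e = 0" using norm_e r lam_le by (intro vanish[of r "nrm e" "C * nrm e"]) auto
    thus False using norm_e by simp
  qed
  \<comment> \<open>Two successive multiples of \<open>a\<close> both approach \<open>e\<close> at
    rate \<open>r ^ n\<close>. Their difference has size \<open>cmod lam ^ n\<close> times the
    quantity considered, and \<open>r < cmod lam\<close> forces the latter to vanish.\<close>
  have "cmod (lam - 1) * nrm a = 0"
  proof (rule vanish[of "r / cmod lam"])
    fix n
    define u where "u = scl (lam ^ Suc n) a"
    define v where "v = scl (lam ^ Suc (Suc n)) a"
    have uv: "u \<in> Q" "v \<in> Q" unfolding u_def v_def by (rule Q.X_scale[OF a])+
    have "lam ^ Suc (Suc n) - lam ^ Suc n = lam ^ Suc n * (lam - 1)" by (simp add: algebra_simps)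
    moreover have "v - u = scl (lam ^ Suc (Suc n) - lam ^ Suc n) a"
      unfolding u_def v_def by (rule F.scale_left_diff_distrib[symmetric])
    ultimately have "nrm (v - u) = cmod (lam ^ Suc n * (lam - 1)) * nrm a"
      using Q.nrm_scale[OF a] by metis
    hence "cmod lam ^ Suc n * (cmod (lam - 1) * nrm a) = nrm (v - u)"
      unfolding norm_mult norm_power by (simp only: mult.assoc)
    also have "v - u = (e - u) - (e - v)" by simp
    also have "nrm \<dots> \<le> nrm (e - u) + nrm (e - v)"
      using uv e by (intro Q.nrm_diff_le Q.X_diff)
    also have "\<dots> \<le> C * r ^ Suc n * nrm e + C * r ^ Suc (Suc n) * nrm e"
      unfolding u_def v_def by (intro add_mono near)
    also have "\<dots> = C * nrm e * (1 + r) * r ^ Suc n" by (simp add: algebra_simps)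
    finally have "cmod (lam - 1) * nrm a \<le> C * nrm e * (1 + r) * r ^ Suc n / cmod lam ^ Suc n"
      using lam0 by (simp add: pos_le_divide_eq mult.commute del: power_Suc)
    thus "cmod (lam - 1) * nrm a \<le> (C * nrm e * (1 + r)) * (r / cmod lam) ^ Suc n"
      by (simp add: power_divide)
  qed (use r lam0 Q.nrm_nonneg[OF a] in auto)
  hence lam1: "lam = 1" using norm_a by simp
  have "nrm (e - a) = 0"
    using near Q.nrm_nonneg[OF Q.X_diff[OF e a]] r lam_le
    by (intro vanish[of r "nrm (e - a)" "C * nrm e"]) (auto simp: lam1 mult_ac)
  hence ea: "a = e" using Q_null[OF Q.X_diff[OF e a]] by simp
  obtain c0 where c0: "e = scl c0 p" using p(4)[OF e] ea by (auto simp: a_def)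
  have "c0 \<noteq> 0" using norm_e Q.nrm_scale[OF p(1), of c0] c0 by auto
  have r1: "r < 1" using r lam_le by linarith
  have P'_eq: "P' f = scl (LINT x|M. f x) e" if f: "f \<in> Q" for f
  proof -
    obtain c where "P' f = scl c p" using p(4)[OF f] by blast
    also have "scl c p = scl (c / c0) e" using \<open>c0 \<noteq> 0\<close> by (simp add: c0)
    finally have c: "P' f = scl (c / c0) e" .
    \<comment> \<open>All powers of \<open>V\<close> preserve the integral, while the integral of
      the \<open>N'\<close> part tends to 0; this identifies the coefficient.\<close>
    have "cmod ((LINT x|M. f x) - c / c0) = 0"
    proof (rule vanish[of r])
      fix n
      have mem: "(N' ^^ Suc n) f \<in> Q" using f by (rule Q.endo_power_mem[OF N'])
      have "(LINT x|M. f x) = (LINT x|M. (V ^^ Suc n) f x)"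
        by (rule integral_V_power[OF Q_sub[OF f], symmetric])
      also have "\<dots> = (LINT x|M. P' f x + (N' ^^ Suc n) f x)"
        unfolding V_Q_power[OF f] lam1 by simp
      also have "\<dots> = (LINT x|M. P' f x) + (LINT x|M. (N' ^^ Suc n) f x)"
        using mem f by (intro Bochner_Integration.integral_add F_integrable Q_sub P'_mem)
      also have "(LINT x|M. P' f x) = c / c0 * (LINT x|M. e x)" unfolding c by simp
      also have "(LINT x|M. e x) = 1"
        using integral_cong_ae_eq[OF Q_sub[OF e] const_mem e_ae] by (simp add: prob_space)
      finally have "cmod ((LINT x|M. f x) - c / c0) = cmod (LINT x|M. (N' ^^ Suc n) f x)" by simp
      also have "\<dots> \<le> nrm ((N' ^^ Suc n) f)" by (rule cmod_integral_le[OF Q_sub[OF mem]])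
      also have "\<dots> \<le> C * r ^ Suc n * nrm f" by (rule C[OF f])
      finally show "cmod ((LINT x|M. f x) - c / c0) \<le> (C * nrm f) * r ^ Suc n" by (simp add: mult_ac)
    qed (use r r1 in auto)
    thus ?thesis using c by simp
  qed
  \<comment> \<open>The summands \<open>1\<close> and the norm of the constant 1 account for
    exponent 0, which the decomposition does not cover.\<close>
  define D where "D = \<bar>C\<bar> + 1 + nrm (\<lambda>_. 1)"
  have "nrm ((V ^^ n) f - (\<lambda>_. LINT x|M. f x)) \<le> D * r ^ n * nrm f" if f: "f \<in> F" for n f
  proof -
    let ?c = "LINT x|M. f x"
    note pf = proj_Q[OF f]
    have n1: "0 \<le> nrm (\<lambda>_. 1)" by (intro F.nrm_nonneg const_mem)
    have nf: "0 \<le> nrm f" by (rule F.nrm_nonneg[OF f])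
    show ?thesis
    proof (cases n)
      case 0
      have "nrm (f - (\<lambda>_. ?c)) \<le> nrm f + nrm (\<lambda>_. ?c)"
        by (intro F.nrm_diff_le f const_mem)
      also have "nrm (\<lambda>_. ?c) = cmod ?c * nrm (\<lambda>_. 1)"
        using norm_scale[OF const_mem[of 1], of ?c] by simp
      also have "\<dots> \<le> nrm f * nrm (\<lambda>_. 1)"
        using n1 by (intro mult_right_mono cmod_integral_le f)
      also have "nrm f + nrm f * nrm (\<lambda>_. 1) \<le> D * nrm f"
        using nf unfolding D_def by (simp add: algebra_simps)
      finally show ?thesis unfolding 0 by (simp only: funpow.simps id_apply power_0 mult_1_right)
    next
      case (Suc m)
      \<comment> \<open>After one application of \<open>V\<close> it no longer matters which
        representative it started from.\<close>
      have "V (proj f) = V f"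
        by (intro V_cong proj_ae proj_mem f)
      hence "(V ^^ n) f = (V ^^ n) (proj f)" by (simp add: Suc funpow_swap1 del: funpow.simps) (simp add: funpow_swap1)
      also have "\<dots> = P' (proj f) + (N' ^^ n) (proj f)"
        unfolding Suc V_Q_power[OF pf] lam1 by simp
      also have "P' (proj f) = scl ?c e"
        using P'_eq[OF pf] integral_cong_ae_eq[OF proj_mem[OF f] f proj_ae[OF f]] by simp
      finally have eq: "(V ^^ n) f = scl ?c e + (N' ^^ n) (proj f)" .
      have mem: "(N' ^^ n) (proj f) \<in> Q" using pf by (rule Q.endo_power_mem[OF N'])
      have "nrm ((V ^^ n) f - (\<lambda>_. ?c)) = nrm ((N' ^^ n) (proj f))"
      proof (rule norm_cong)
        show "ae_eq M ((V ^^ n) f - (\<lambda>_. ?c)) ((N' ^^ n) (proj f))"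
          using e_ae unfolding eq ae_eq_def by eventually_elim auto
      qed (intro F.X_diff V_power_mem const_mem f, rule Q_sub[OF mem])
      also have "\<dots> \<le> C * r ^ n * nrm f" using C[OF pf, of n] norm_proj[OF f] by simp
      also have "\<dots> \<le> D * r ^ n * nrm f"
        using nf r n1 unfolding D_def by (intro mult_right_mono) auto
      finally show ?thesis .
    qed
  qed
  moreover have "0 \<le> D" unfolding D_def using F.nrm_nonneg[OF const_mem[of 1]] by simp
  ultimately show ?thesis using r r1 that by blast
qed

end

section \<open>Concentration of Birkhoff sums\<close>

lemma (in measure_preserving) T_power_measurable [measurable]: "T ^^ n \<in> measurable M M"
  by (induction n) (auto simp: comp_def)

text \<open>Lets a product of affine factors dominate the exponential of a Birkhoff sum, at the
  price of a quadratic correction.\<close>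

lemma exp_le_one_plus:
  fixes y :: real
  assumes "\<bar>y\<bar> \<le> 1 / 2" shows "exp (y - 2 * y\<^sup>2) \<le> 1 + y"
proof -
  have "y - 2 * y\<^sup>2 \<le> ln (1 + y)"
  proof (cases "0 \<le> y")
    case True
    thus ?thesis
      using abs_ln_one_plus_x_minus_x_bound_nonneg[of y] assms by (auto simp: abs_if split: if_splits)
  next
    case False
    thus ?thesis
      using abs_ln_one_plus_x_minus_x_bound_nonpos[of y] assms by (auto simp: abs_if split: if_splits)
  qed
  hence "exp (y - 2 * y\<^sup>2) \<le> exp (ln (1 + y))" by simp
  also have "\<dots> = 1 + y" using assms by (subst exp_ln) auto
  finally show ?thesis .
qed

context spectral_gap_system
begin

definition birkhoff_sum :: "('a \<Rightarrow> real) \<Rightarrow> nat \<Rightarrow> 'a \<Rightarrow> real" where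
  "birkhoff_sum f n x = (\<Sum>i<n. f ((T ^^ i) x))"

lemma birkhoff_sum_measurable:
  "f \<in> borel_measurable M \<Longrightarrow> birkhoff_sum f n \<in> borel_measurable M"
  unfolding birkhoff_sum_def[abs_def]
  by (intro borel_measurable_sum measurable_compose[OF T_power_measurable])

lemma integral_V_mult:
  assumes f: "f \<in> F" and h: "h \<in> Linf M"
  shows "(LINT x|M. V f x * h x) = (LINT x|M. f x * h (T x))"
proof -
  have "(LINT x|M. V f x * h x) = (LINT x|M. transfer_op M T f x * h x)"
    using V_ae[OF f] F_borel[OF V_mem[OF f]] F_borel[OF transfer_mem[OF f]] h
    by (intro integral_cong_AE) (auto simp: ae_eq_def Linf_iff)
  thus ?thesis using transfer_op_spec(2)[OF F_integrable[OF f] h] by simp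
qed

text \<open>\<open>K\<close> is a parameter because the concentration rate may depend on the
  observable only through it. The bounds on the values hold at every point of the space, so that
  products along orbits can be estimated pointwise.\<close>

definition bounded_observable :: "real \<Rightarrow> ('a \<Rightarrow> real) \<Rightarrow> bool" where
  "bounded_observable K f \<longleftrightarrow> (\<lambda>x. of_real (f x)) \<in> F \<and> nrm (\<lambda>x. of_real (f x)) \<le> K \<and>
     f \<in> borel_measurable M \<and> (\<forall>x\<in>space M. 0 \<le> f x \<and> f x \<le> 1)"

context
  fixes f :: "'a \<Rightarrow> real" and K s :: real
  assumes f: "bounded_observable K f" and s: "\<bar>s\<bar> \<le> 1 / 2"
begin

lemma f_F: "(\<lambda>x. of_real (f x)) \<in> F" and f_norm: "nrm (\<lambda>x. of_real (f x)) \<le> K"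
  and f_measurable [measurable]: "f \<in> borel_measurable M"
  and f_bounds: "x \<in> space M \<Longrightarrow> 0 \<le> f x \<and> f x \<le> 1"
  using f by (auto simp: bounded_observable_def)

definition product :: "nat \<Rightarrow> 'a \<Rightarrow> real" where
  "product n x = (\<Prod>i<n. 1 + s * f ((T ^^ i) x))"

text \<open>The twist is affine instead of exponential in the observable, so that the iterates are
  built by the operations of the algebra and their norms are bounded directly.\<close>

fun twisted :: "nat \<Rightarrow> 'a \<Rightarrow> complex" where
  "twisted 0 = (\<lambda>_. 1)"
| "twisted (Suc n) = V (twisted n + scl (of_real s) (\<lambda>x. of_real (f x) * twisted n x))"

lemma twisted_mem: "twisted n \<in> F"
proof (induction n)
  case (Suc n)
  thus ?case unfolding twisted.simps by (intro V_mem add_mem scale_mem mult_mem f_F)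
qed (simp add: const_mem)

lemma product_measurable [measurable]: "product n \<in> borel_measurable M"
  unfolding product_def by measurable

lemma T_power_space: "x \<in> space M \<Longrightarrow> (T ^^ i) x \<in> space M"
  using measurable_space[OF T_power_measurable] .

lemma factor_bounds: "x \<in> space M \<Longrightarrow> 1 - \<bar>s\<bar> \<le> 1 + s * f ((T ^^ i) x) \<and> 1 + s * f ((T ^^ i) x) \<le> 2"
proof -
  assume "x \<in> space M"
  hence b: "0 \<le> f ((T ^^ i) x)" "f ((T ^^ i) x) \<le> 1" using f_bounds T_power_space by auto
  hence "\<bar>s * f ((T ^^ i) x)\<bar> \<le> \<bar>s\<bar> * 1" unfolding abs_mult by (intro mult_left_mono) auto
  thus ?thesis using s by (auto simp: abs_le_iff)
qed

lemma factor_nonneg: "x \<in> space M \<Longrightarrow> 0 \<le> 1 + s * f ((T ^^ i) x)"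
  using factor_bounds[of x i] s by linarith

lemma product_nonneg: "x \<in> space M \<Longrightarrow> 0 \<le> product n x"
  unfolding product_def using factor_nonneg by (intro prod_nonneg) auto

lemma product_integrable: "integrable M (product n)"
proof (rule integrable_const_bound[of _ "2 ^ n"])
  have "product n x \<le> 2 ^ n" if "x \<in> space M" for x
  proof -
    have "product n x \<le> (\<Prod>i<n. 2)"
      unfolding product_def using factor_bounds[OF that] factor_nonneg[OF that] by (intro prod_mono) auto
    thus ?thesis by simp
  qed
  thus "AE x in M. norm (product n x) \<le> 2 ^ n"
    using product_nonneg by auto
qed auto

text \<open>Moving one \<open>V\<close> across the integral replaces the test function by its
  composition with \<open>T\<close> times the affine factor. The induction therefore runs over all
  test functions.\<close>

lemma integral_twisted:
  assumes "h \<in> Linf M"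
  shows "(LINT x|M. twisted n x * h x) = (LINT x|M. of_real (product n x) * h ((T ^^ n) x))"
  using assms
proof (induction n arbitrary: h)
  case 0
  thus ?case by (simp add: product_def)
next
  case (Suc n)
  let ?h = "\<lambda>x. (1 + of_real (s * f x)) * h (T x)"
  have w: "(\<lambda>x. 1 + of_real (s * f x) :: complex) \<in> Linf M"
    unfolding Linf_iff
  proof
    have "cmod (1 + of_real (s * f x)) \<le> 2" if "x \<in> space M" for x
    proof -
      have "1 + complex_of_real (s * f x) = of_real (1 + s * f x)" by simp
      thus ?thesis using factor_bounds[OF that, of 0] s by (simp only: norm_of_real) auto
    qed
    thus "\<exists>C. AE x in M. cmod (1 + of_real (s * f x)) \<le> C" by (auto intro!: exI[of _ 2])
  qed measurable
  have h': "?h \<in> Linf M"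
  proof -
    obtain C where C: "AE x in M. cmod (1 + of_real (s * f x)) \<le> C" using w by (auto simp: Linf_iff)
    obtain D where D: "AE x in M. cmod (h (T x)) \<le> D" using Linf_comp_T[OF Suc.prems] by (auto simp: Linf_iff)
    have "AE x in M. cmod (?h x) \<le> C * D"
      using C D by eventually_elim (simp only: norm_mult, intro mult_mono; force intro: order_trans[OF norm_ge_zero])
    moreover have "?h \<in> borel_measurable M"
      using w Linf_comp_T[OF Suc.prems] by (auto simp: Linf_iff)
    ultimately show ?thesis by (auto simp: Linf_iff)
  qed
  have "(LINT x|M. twisted (Suc n) x * h x) =
      (LINT x|M. (twisted n + scl (of_real s) (\<lambda>x. of_real (f x) * twisted n x)) x * h (T x))"
    unfolding twisted.simps
    by (intro integral_V_mult add_mem scale_mem mult_mem f_F twisted_mem Suc.prems)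
  also have "\<dots> = (LINT x|M. twisted n x * ?h x)"
    by (intro Bochner_Integration.integral_cong refl) (simp add: algebra_simps)
  also have "\<dots> = (LINT x|M. of_real (product n x) * ?h ((T ^^ n) x))"
    by (rule Suc.IH[OF h'])
  also have "\<dots> = (LINT x|M. of_real (product (Suc n) x) * h ((T ^^ Suc n) x))"
    by (intro Bochner_Integration.integral_cong refl) (simp add: product_def mult.assoc)
  finally show ?case .
qed

definition moment :: "nat \<Rightarrow> real" where
  "moment n = (LINT x|M. product n x)"

lemma integral_twisted_eq_moment: "(LINT x|M. twisted n x) = of_real (moment n)"
proof -
  have "(\<lambda>_. 1 :: complex) \<in> Linf M" by (auto simp: Linf_iff)
  from integral_twisted[OF this, of n] show ?thesis by (simp add: moment_def)
qed

lemma moment_0: "moment 0 = 1"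
  by (simp add: moment_def product_def prob_space)

text \<open>Allows an error measured relative to one moment to be measured relative to the
  next.\<close>

lemma moment_Suc_ge: "(1 - \<bar>s\<bar>) * moment n \<le> moment (Suc n)"
proof -
  have "(1 - \<bar>s\<bar>) * moment n = (LINT x|M. (1 - \<bar>s\<bar>) * product n x)" by (simp add: moment_def)
  also have "\<dots> \<le> (LINT x|M. product (Suc n) x)"
  proof (rule integral_mono)
    fix x assume x: "x \<in> space M"
    have "(1 - \<bar>s\<bar>) * product n x \<le> (1 + s * f ((T ^^ n) x)) * product n x"
      using factor_bounds[OF x, of n] product_nonneg[OF x] by (intro mult_right_mono) auto
    thus "(1 - \<bar>s\<bar>) * product n x \<le> product (Suc n) x" by (simp add: product_def mult.commute)
  qed (use product_integrable in auto)
  finally show ?thesis by (simp add: moment_def)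
qed

lemma moment_pos: "0 < moment n"
proof (induction n)
  case (Suc n)
  have "0 < (1 - \<bar>s\<bar>) * moment n" using Suc s by simp
  thus ?case using moment_Suc_ge[of n] by linarith
qed (simp add: moment_0)

definition mean :: real where "mean = (LINT x|M. f x)"

lemma f_integrable: "integrable M f"
  using f_bounds by (intro integrable_const_bound[of _ 1]) auto

lemma mean_nonneg: "0 \<le> mean"
  unfolding mean_def using f_bounds by (intro integral_nonneg_AE) auto

lemma moment_Suc: "of_real (moment (Suc n)) =
    of_real (moment n) + of_real s * (LINT x|M. of_real (f x) * twisted n x)"
proof -
  let ?u = "\<lambda>x. of_real (f x) * twisted n x"
  have u: "?u \<in> F" by (intro mult_mem f_F twisted_mem)
  have "of_real (moment (Suc n)) = (LINT x|M. (twisted n + scl (of_real s) ?u) x)"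
    unfolding integral_twisted_eq_moment[symmetric] twisted.simps
    by (intro integral_V add_mem scale_mem twisted_mem u)
  also have "\<dots> = (LINT x|M. twisted n x) + of_real s * (LINT x|M. ?u x)"
    using F_integrable[OF u] F_integrable[OF twisted_mem[of n]] by simp
  finally show ?thesis by (simp add: integral_twisted_eq_moment)
qed

text \<open>The mean survives as a factor since the observable is nonnegative and \<open>h\<close>
  is bounded almost everywhere by its norm. This is what makes the final exponent proportional to
  \<open>n\<close> times the mean.\<close>

lemma integral_observable_le:
  assumes "h \<in> F" shows "cmod (LINT x|M. of_real (f x) * h x) \<le> mean * nrm h"
proof -
  have "cmod (LINT x|M. of_real (f x) * h x) \<le> (LINT x|M. cmod (of_real (f x) * h x))"
    by (rule integral_norm_bound)
  also have "\<dots> \<le> (LINT x|M. f x * nrm h)"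
  proof (rule integral_mono_AE)
    show "integrable M (\<lambda>x. cmod (of_real (f x) * h x))"
      by (intro integrable_norm F_integrable mult_mem f_F assms)
    have "AE x in M. x \<in> space M" by simp
    with AE_le_norm[OF assms] show "AE x in M. cmod (of_real (f x) * h x) \<le> f x * nrm h"
      by eventually_elim (use f_bounds in \<open>auto simp: norm_mult intro!: mult_left_mono\<close>)
  qed (use f_integrable in auto)
  finally show ?thesis by (simp add: mean_def)
qed

text \<open>The deviation of the twisted iterates from their mean is of order \<open>\<bar>s\<bar>\<close> relative to the mean: it
  is created at rate \<open>\<bar>s\<bar>\<close> and forgotten exponentially fast.\<close>

lemma twisted_deviation:
  assumes C: "0 \<le> C" "0 < r" "r < 1"
    "\<And>n g. g \<in> F \<Longrightarrow> nrm ((V ^^ n) g - (\<lambda>_. LINT x|M. g x)) \<le> C * r ^ n * nrm g"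
    and K: "0 \<le> K"
    and b: "b = nrm (\<lambda>_. 1)"
    and D: "0 \<le> D" "4 * C * K * b \<le> D * (1 - r)"
    and s': "\<bar>s\<bar> \<le> (1 - r) / 2" "D * \<bar>s\<bar> \<le> b"
  shows "nrm ((V ^^ k) (twisted n) - (\<lambda>_. of_real (moment n))) \<le> r ^ k * (D * \<bar>s\<bar> * moment n)"
\<comment> \<open>One more twist costs one more application of \<open>V\<close>: exponent
  \<open>k\<close> at \<open>Suc n\<close> draws on exponent \<open>Suc k\<close> at
  \<open>n\<close>.\<close>
proof (induction n arbitrary: k)
  case 0
  have "nrm ((V ^^ k) (twisted 0) - (\<lambda>_. of_real (moment 0))) = 0"
    using V_power_one[of k] by (simp only: twisted.simps moment_0 of_real_1)
  moreover have "0 \<le> r ^ k * (D * \<bar>s\<bar> * moment 0)"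
    using C(2) D(1) less_imp_le[OF moment_pos[of 0]] by simp
  ultimately show ?case by (simp only:)
next
  case (Suc n)
  let ?u = "\<lambda>x. of_real (f x) * twisted n x"
  define I where "I = (LINT x|M. ?u x)"
  have u: "?u \<in> F" by (intro mult_mem f_F twisted_mem)
  let ?a = "(V ^^ Suc k) (twisted n) - (\<lambda>_. of_real (moment n))"
  let ?b = "(V ^^ Suc k) ?u - (\<lambda>_. I)"
  have ab: "?a \<in> F" "?b \<in> F"
    by (intro F.X_diff V_power_mem twisted_mem const_mem u)+
  have n1: "0 \<le> b" unfolding b by (intro F.nrm_nonneg const_mem)
  note A = moment_pos[of n]
  have "(V ^^ k) (twisted (Suc n)) = (V ^^ Suc k) (twisted n + scl (of_real s) ?u)"
    by (simp only: twisted.simps funpow_Suc_right comp_apply)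
  also have "\<dots> = (V ^^ Suc k) (twisted n) + scl (of_real s) ((V ^^ Suc k) ?u)"
    using twisted_mem u scale_mem[OF u] by (simp only: V_power_add V_power_scale)
  finally have eq: "(V ^^ k) (twisted (Suc n)) - (\<lambda>_. of_real (moment (Suc n))) = ?a + scl (of_real s) ?b"
    by (simp only: moment_Suc I_def[symmetric])
      (rule ext, simp only: plus_fun_apply minus_apply right_diff_distrib, simp)
  \<comment> \<open>The induction hypothesis at exponent 0 together with
    \<open>D * \<bar>s\<bar> \<le> b\<close>.\<close>
  have tn: "nrm (twisted n) \<le> 2 * b * moment n"
  proof -
    have 1: "nrm (\<lambda>_. of_real (moment n)) = moment n * b"
      using norm_scale[OF const_mem[of 1], of "of_real (moment n)"] A by (simp add: b)
    have 2: "nrm (twisted n - (\<lambda>_. of_real (moment n))) \<le> D * \<bar>s\<bar> * moment n"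
      using Suc[of 0] by (simp only: funpow.simps id_apply power_0 mult_1)
    have "nrm (twisted n) \<le> moment n * b + D * \<bar>s\<bar> * moment n"
      by (rule order_trans[OF F.nrm_le_add_diff[OF twisted_mem const_mem] add_mono[OF eq_refl[OF 1] 2]])
    moreover have "D * \<bar>s\<bar> * moment n \<le> b * moment n"
      using s' A by (intro mult_right_mono) auto
    moreover have "moment n * b + b * moment n = 2 * b * moment n" by simp
    ultimately show ?thesis by linarith
  qed
  have nu: "nrm ?u \<le> K * (2 * b * moment n)"
    by (rule order_trans[OF norm_mult_le[OF f_F twisted_mem]
          mult_mono[OF f_norm tn K F.nrm_nonneg[OF twisted_mem]]])
  have "nrm ?b \<le> C * r ^ Suc k * nrm ?u"
    unfolding I_def by (rule C(4)[OF u])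
  also have "\<dots> \<le> C * r ^ Suc k * (K * (2 * b * moment n))"
    using nu by (rule mult_left_mono) (use C(1,2) in simp)
  finally have "\<bar>s\<bar> * nrm ?b \<le> \<bar>s\<bar> * (C * r ^ Suc k * (K * (2 * b * moment n)))"
    by (rule mult_left_mono) simp
  moreover have "nrm (scl (of_real s) ?b) = \<bar>s\<bar> * nrm ?b"
    using norm_scale[OF ab(2), of "of_real s"] by (simp only: norm_of_real)
  ultimately have nb: "nrm (scl (of_real s) ?b) \<le> \<bar>s\<bar> * (C * r ^ Suc k * (K * (2 * b * moment n)))"
    by (simp only:)
  have le: "nrm (?a + scl (of_real s) ?b) \<le>
      r ^ Suc k * (D * \<bar>s\<bar> * moment n) + \<bar>s\<bar> * (C * r ^ Suc k * (K * (2 * b * moment n)))"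
    by (rule order_trans[OF norm_add[OF ab(1) scale_mem[OF ab(2)]] add_mono[OF Suc nb]])
  have "r ^ Suc k * (D * \<bar>s\<bar> * moment n) + \<bar>s\<bar> * (C * r ^ Suc k * (K * (2 * b * moment n))) =
      r ^ k * \<bar>s\<bar> * moment n * (r * (D + 2 * C * K * b))"
    by (simp add: algebra_simps)
  \<comment> \<open>The gained factor \<open>r\<close> pays twice: half of \<open>1 - r\<close> for
    the newly created error, by the choice of \<open>D\<close>, and half for the loss
    \<open>1 - \<bar>s\<bar>\<close> in passing to the next moment.\<close>
  also have "\<dots> \<le> r ^ k * \<bar>s\<bar> * moment n * (D * (1 - \<bar>s\<bar>))"
  proof (rule mult_left_mono)
    have "r * (2 * C * K * b) \<le> 1 * (2 * C * K * b)"
      using C(1-3) K n1 by (intro mult_right_mono) auto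
    hence "r * (D + 2 * C * K * b) \<le> r * D + 2 * C * K * b" by (simp add: distrib_left)
    also have "\<dots> \<le> r * D + D * (1 - r) / 2" using D by simp
    also have "\<dots> = D * (1 - (1 - r) / 2)" by (simp add: field_simps)
    also have "\<dots> \<le> D * (1 - \<bar>s\<bar>)" using D s' by (intro mult_left_mono) auto
    finally show "r * (D + 2 * C * K * b) \<le> D * (1 - \<bar>s\<bar>)" .
  qed (use C(2) A in auto)
  also have "\<dots> = r ^ k * (D * \<bar>s\<bar> * ((1 - \<bar>s\<bar>) * moment n))" by (simp add: algebra_simps)
  also have "\<dots> \<le> r ^ k * (D * \<bar>s\<bar> * moment (Suc n))"
    using C(2) D(1) moment_Suc_ge by (intro mult_left_mono) auto
  finally show ?case unfolding eq by (rule order_trans[OF le])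
qed

text \<open>With the constant part of the iterate the recursion has factor
  \<open>1 + s * mean\<close>. The deviation is itself of order \<open>s\<close>, so it contributes
  an error of order \<open>s\<close> squared, still multiplied by the mean.\<close>

lemma moment_bound:
  assumes dev: "\<And>n. nrm (twisted n - (\<lambda>_. of_real (moment n))) \<le> D * \<bar>s\<bar> * moment n"
  shows "moment n \<le> exp (real n * mean * (s + D * s\<^sup>2))"
proof (induction n)
  case (Suc n)
  let ?d = "twisted n - (\<lambda>_. of_real (moment n))"
  have d: "?d \<in> F" by (intro F.X_diff twisted_mem const_mem)
  have "(LINT x|M. of_real (f x) * twisted n x) =
      (LINT x|M. of_real (f x) * ?d x + of_real (f x) * of_real (moment n))"
    by (intro Bochner_Integration.integral_cong refl) (simp add: algebra_simps)
  also have "\<dots> = (LINT x|M. of_real (f x) * ?d x) + (LINT x|M. of_real (f x) * of_real (moment n))"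
    by (intro Bochner_Integration.integral_add F_integrable mult_mem f_F const_mem d)
  also have "(LINT x|M. of_real (f x) * of_real (moment n)) = complex_of_real (mean * moment n)"
    by (simp add: mean_def)
  finally have "complex_of_real (moment (Suc n)) =
      of_real (moment n) + of_real s * ((LINT x|M. of_real (f x) * ?d x) + of_real (mean * moment n))"
    by (simp only: moment_Suc)
  hence "complex_of_real (moment (Suc n) - moment n - s * (mean * moment n)) = of_real s * (LINT x|M. of_real (f x) * ?d x)"
    by (simp add: algebra_simps)
  hence "cmod (complex_of_real (moment (Suc n) - moment n - s * (mean * moment n))) =
      cmod (of_real s * (LINT x|M. of_real (f x) * ?d x))" by (rule arg_cong)
  hence "\<bar>moment (Suc n) - moment n - s * (mean * moment n)\<bar> = \<bar>s\<bar> * cmod (LINT x|M. of_real (f x) * ?d x)"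
    by (simp only: norm_mult norm_of_real)
  also have "\<dots> \<le> \<bar>s\<bar> * (mean * (D * \<bar>s\<bar> * moment n))"
    by (rule mult_left_mono[OF order_trans[OF integral_observable_le[OF d]
          mult_left_mono[OF dev mean_nonneg]] abs_ge_zero])
  also have "\<dots> = D * \<bar>s\<bar>\<^sup>2 * (mean * moment n)"
    by (simp only: power2_eq_square mult_ac)
  also have "\<dots> = D * s\<^sup>2 * (mean * moment n)"
    by (simp only: power2_abs)
  finally have "moment (Suc n) \<le> (1 + mean * (s + D * s\<^sup>2)) * moment n"
    by (simp add: algebra_simps)
  also have "\<dots> \<le> exp (mean * (s + D * s\<^sup>2)) * moment n"
    using moment_pos[of n] by (intro mult_right_mono exp_ge_add_one_self) auto
  also have "\<dots> \<le> exp (mean * (s + D * s\<^sup>2)) * exp (real n * mean * (s + D * s\<^sup>2))"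
    using Suc by (intro mult_left_mono) auto
  also have "\<dots> = exp (real (Suc n) * mean * (s + D * s\<^sup>2))"
    by (simp add: exp_add[symmetric] algebra_simps)
  finally show ?case .
qed (simp add: moment_0)

text \<open>The observable takes values in [0, 1] and thus dominates its square, so the quadratic
  correction can be charged to the coefficient of the sum.\<close>

lemma exp_birkhoff_le_product:
  assumes x: "x \<in> space M"
  shows "exp ((s - 2 * s\<^sup>2) * birkhoff_sum f n x) \<le> product n x"
proof -
  have "exp ((s - 2 * s\<^sup>2) * birkhoff_sum f n x) = (\<Prod>i<n. exp ((s - 2 * s\<^sup>2) * f ((T ^^ i) x)))"
    by (simp add: birkhoff_sum_def sum_distrib_left exp_sum)
  also have "\<dots> \<le> product n x"
    unfolding product_def
  proof (rule prod_mono)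
    fix i
    let ?y = "f ((T ^^ i) x)"
    have y: "0 \<le> ?y" "?y \<le> 1" using f_bounds T_power_space x by auto
    have sy: "\<bar>s * ?y\<bar> \<le> 1 / 2"
      using y s mult_mono[of "\<bar>s\<bar>" "1/2" ?y 1] by (simp add: abs_mult)
    have "s\<^sup>2 * (?y * ?y) \<le> s\<^sup>2 * (1 * ?y)" using y by (intro mult_left_mono mult_right_mono) auto
    hence "(s - 2 * s\<^sup>2) * ?y \<le> s * ?y - 2 * (s * ?y)\<^sup>2"
      by (simp add: power2_eq_square algebra_simps)
    hence "exp ((s - 2 * s\<^sup>2) * ?y) \<le> exp (s * ?y - 2 * (s * ?y)\<^sup>2)" by simp
    also have "\<dots> \<le> 1 + s * ?y" by (rule exp_le_one_plus[OF sy])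
    finally show "0 \<le> exp ((s - 2 * s\<^sup>2) * ?y) \<and> exp ((s - 2 * s\<^sup>2) * ?y) \<le> 1 + s * ?y" by simp
  qed
  finally show ?thesis .
qed

text \<open>Markov's inequality for the product. The coefficient of the sum is negative for negative
  \<open>s\<close>, so upper and lower deviations are both instances.\<close>

lemma chernoff:
  assumes dev: "\<And>n. nrm (twisted n - (\<lambda>_. of_real (moment n))) \<le> D * \<bar>s\<bar> * moment n"
  shows "prob {x \<in> space M. t \<le> (s - 2 * s\<^sup>2) * birkhoff_sum f n x} \<le> exp (real n * mean * (s + D * s\<^sup>2) - t)"
proof -
  have [measurable]: "birkhoff_sum f n \<in> borel_measurable M" by (rule birkhoff_sum_measurable[OF f_measurable])
  have "{x \<in> space M. t \<le> (s - 2 * s\<^sup>2) * birkhoff_sum f n x} \<subseteq> {x \<in> space M. exp t \<le> product n x}"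
  proof
    fix x assume "x \<in> {x \<in> space M. t \<le> (s - 2 * s\<^sup>2) * birkhoff_sum f n x}"
    hence x: "x \<in> space M" and le: "exp t \<le> exp ((s - 2 * s\<^sup>2) * birkhoff_sum f n x)" by auto
    show "x \<in> {x \<in> space M. exp t \<le> product n x}"
      by (rule CollectI, rule conjI[OF x], rule order_trans[OF le exp_birkhoff_le_product[OF x]])
  qed
  hence "prob {x \<in> space M. t \<le> (s - 2 * s\<^sup>2) * birkhoff_sum f n x} \<le> prob {x \<in> space M. exp t \<le> product n x}"
    by (rule finite_measure_mono) measurable
  also have "\<dots> \<le> (LINT x:space M|M. product n x) / exp t"
  proof (rule integral_Markov_inequality'_measure)
    have "integrable M (\<lambda>x. indicator (space M) x *\<^sub>R product n x) \<longleftrightarrow> integrable M (product n)"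
      by (intro Bochner_Integration.integrable_cong) auto
    thus "set_integrable M (space M) (product n)"
      unfolding set_integrable_def using product_integrable by blast
  qed (auto simp: product_nonneg)
  also have "(LINT x:space M|M. product n x) = moment n"
    unfolding moment_def by (rule set_integral_space[OF product_integrable])
  also have "moment n / exp t \<le> exp (real n * mean * (s + D * s\<^sup>2)) / exp t"
    using moment_bound[OF dev] by (intro divide_right_mono) auto
  finally show ?thesis by (simp add: exp_diff)
qed

end

theorem concentration:
  assumes K: "0 \<le> K" and e: "0 < e" "e \<le> 1"
  obtains c where "0 < c"
    "\<And>f n. bounded_observable K f \<Longrightarrow>
      prob {x \<in> space M. \<bar>birkhoff_sum f n x - real n * (LINT x|M. f x)\<bar> > e * (real n * (LINT x|M. f x))} \<le>
        2 * exp (- c * (real n * (LINT x|M. f x)))"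
proof -
  obtain C r where C: "0 \<le> C" "0 < r" "r < 1"
    "\<And>n f. f \<in> F \<Longrightarrow> nrm ((V ^^ n) f - (\<lambda>_. LINT x|M. f x)) \<le> C * r ^ n * nrm f"
    using exponential_decay by blast
  \<comment> \<open>Solves the requirement of the deviation lemma on \<open>D\<close>; the summand 1
    keeps \<open>D\<close> positive even when the fraction vanishes.\<close>
  define D where "D = 4 * C * K * nrm (\<lambda>_. 1) / (1 - r) + 1"
  have n1: "1 \<le> nrm (\<lambda>_. 1)" using cmod_integral_le[OF const_mem[of 1]] by (simp add: prob_space)
  have D: "1 \<le> D" "4 * C * K * nrm (\<lambda>_. 1) \<le> D * (1 - r)"
  proof -
    show "1 \<le> D" using C K n1 by (simp add: D_def)
    have "D * (1 - r) = 4 * C * K * nrm (\<lambda>_. 1) + (1 - r)"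
      unfolding D_def distrib_right using C by simp
    thus "4 * C * K * nrm (\<lambda>_. 1) \<le> D * (1 - r)" using C by linarith
  qed
  \<comment> \<open>1/4 keeps \<open>s - 2 * s\<^sup>2\<close> positive, \<open>(1 - r) / 2\<close>
    meets the deviation lemma, and the last bound limits the quadratic terms, whose coefficient is
    at most \<open>D + 4\<close>, to half of the gain \<open>e * s\<close>. It also gives
    \<open>D * s \<le> 1\<close>, and the constant 1 has norm at least 1.\<close>
  define s where "s = min (min (1 / 4) ((1 - r) / 2)) (e / (2 * (D + 4)))"
  have s: "0 < s" "s \<le> 1 / 4" "s \<le> (1 - r) / 2" "s \<le> e / (2 * (D + 4))"
  proof -
    show "0 < s" unfolding s_def using C(2,3) D(1) e by auto
  qed (simp_all only: s_def min_le_iff_disj order_refl simp_thms)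
  have sD: "s * (D + 4) \<le> e / 2" using s(4) D by (simp add: field_simps)
  hence sD': "s * D \<le> 1" using s(1) e by (simp add: algebra_simps)
  show ?thesis
  proof (rule that[of "e * s / 2"])
    fix f n assume f: "bounded_observable K f"
    define p where "p = (LINT x|M. f x)"
    have mean_p: "mean f = p" using mean_def[OF f, of s] s by (simp add: p_def)
    have p: "0 \<le> p" using mean_nonneg[OF f, of s] s by (simp add: mean_p)
    have dev: "nrm (twisted f t n - (\<lambda>_. of_real (moment f t n))) \<le> D * \<bar>t\<bar> * moment f t n"
      if "\<bar>t\<bar> = s" for t n
      using twisted_deviation[OF f _ C K refl _ D(2), of t 0 n] that s(1-3) sD' D(1) n1 by (simp add: mult.commute)
    have "prob {x \<in> space M. (s - 2 * s\<^sup>2) * ((1 + e) * (real n * p)) \<le> (s - 2 * s\<^sup>2) * birkhoff_sum f n x}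
        \<le> exp (real n * mean f * (s + D * s\<^sup>2) - (s - 2 * s\<^sup>2) * ((1 + e) * (real n * p)))"
      using s by (intro chernoff[OF f] dev) auto
    also have "\<dots> \<le> exp (- (e * s / 2) * (real n * p))"
    proof -
      have "real n * mean f * (s + D * s\<^sup>2) - (s - 2 * s\<^sup>2) * ((1 + e) * (real n * p)) =
          real n * p * s * (s * (D + 2 * (1 + e)) - e)"
        by (simp add: mean_p power2_eq_square algebra_simps)
      also have "\<dots> \<le> real n * p * s * (- (e / 2))"
      proof (rule mult_left_mono)
        have "s * (D + 2 * (1 + e)) \<le> s * (D + 4)" using s e by (intro mult_left_mono) auto
        thus "s * (D + 2 * (1 + e)) - e \<le> - (e / 2)" using sD by linarith
      qed (use p s in auto)
      finally show ?thesis by (simp add: algebra_simps)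
    qed
    finally have upper: "prob {x \<in> space M. (s - 2 * s\<^sup>2) * ((1 + e) * (real n * p)) \<le> (s - 2 * s\<^sup>2) * birkhoff_sum f n x}
        \<le> exp (- (e * s / 2) * (real n * p))" .
    have "prob {x \<in> space M. (- s - 2 * (- s)\<^sup>2) * ((1 - e) * (real n * p)) \<le> (- s - 2 * (- s)\<^sup>2) * birkhoff_sum f n x}
        \<le> exp (real n * mean f * (- s + D * (- s)\<^sup>2) - (- s - 2 * (- s)\<^sup>2) * ((1 - e) * (real n * p)))"
      using s by (intro chernoff[OF f] dev) auto
    also have "\<dots> \<le> exp (- (e * s / 2) * (real n * p))"
    proof -
      have "real n * mean f * (- s + D * (- s)\<^sup>2) - (- s - 2 * (- s)\<^sup>2) * ((1 - e) * (real n * p)) =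
          real n * p * s * (s * (D + 2 * (1 - e)) - e)"
        by (simp add: mean_p power2_eq_square algebra_simps)
      also have "\<dots> \<le> real n * p * s * (- (e / 2))"
      proof (rule mult_left_mono)
        have "s * (D + 2 * (1 - e)) \<le> s * (D + 4)" using s e by (intro mult_left_mono) auto
        thus "s * (D + 2 * (1 - e)) - e \<le> - (e / 2)" using sD by linarith
      qed (use p s in auto)
      finally show ?thesis by (simp add: algebra_simps)
    qed
    finally have lower: "prob {x \<in> space M. (- s - 2 * (- s)\<^sup>2) * ((1 - e) * (real n * p)) \<le> (- s - 2 * (- s)\<^sup>2) * birkhoff_sum f n x}
        \<le> exp (- (e * s / 2) * (real n * p))" .
    let ?U = "{x \<in> space M. (s - 2 * s\<^sup>2) * ((1 + e) * (real n * p)) \<le> (s - 2 * s\<^sup>2) * birkhoff_sum f n x}"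
    let ?L = "{x \<in> space M. (- s - 2 * (- s)\<^sup>2) * ((1 - e) * (real n * p)) \<le> (- s - 2 * (- s)\<^sup>2) * birkhoff_sum f n x}"
    have "f \<in> borel_measurable M" using f unfolding bounded_observable_def by blast
    hence [measurable]: "birkhoff_sum f n \<in> borel_measurable M" by (rule birkhoff_sum_measurable)
    have s2: "0 < s - 2 * s\<^sup>2" "- s - 2 * (- s)\<^sup>2 < 0"
    proof -
      have "2 * s\<^sup>2 \<le> s / 2"
        using s(1,2) mult_right_mono[of s "1/4" s] by (simp add: power2_eq_square)
      thus "0 < s - 2 * s\<^sup>2" using s(1) by linarith
      have "0 \<le> s\<^sup>2" by simp
      thus "- s - 2 * (- s)\<^sup>2 < 0" using s(1) unfolding power2_minus by linarith
    qed
    have "{x \<in> space M. \<bar>birkhoff_sum f n x - real n * p\<bar> > e * (real n * p)} \<subseteq> ?U \<union> ?L"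
    proof
      fix x assume "x \<in> {x \<in> space M. \<bar>birkhoff_sum f n x - real n * p\<bar> > e * (real n * p)}"
      hence x: "x \<in> space M" "\<bar>birkhoff_sum f n x - real n * p\<bar> > e * (real n * p)" by auto
      hence "(1 + e) * (real n * p) \<le> birkhoff_sum f n x \<or> birkhoff_sum f n x \<le> (1 - e) * (real n * p)"
        unfolding distrib_right left_diff_distrib mult_1 by linarith
      thus "x \<in> ?U \<union> ?L"
        using x(1) s2 by (simp only: Un_iff mem_Collect_eq mult_le_cancel_left_pos mult_le_cancel_left_neg simp_thms)
    qed
    hence "prob {x \<in> space M. \<bar>birkhoff_sum f n x - real n * p\<bar> > e * (real n * p)} \<le> prob (?U \<union> ?L)"
      by (rule finite_measure_mono) measurable
    also have "\<dots> \<le> prob ?U + prob ?L" by (rule measure_Un_le) measurable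
    finally show "prob {x \<in> space M. \<bar>birkhoff_sum f n x - real n * (LINT x|M. f x)\<bar> > e * (real n * (LINT x|M. f x))} \<le>
        2 * exp (- (e * s / 2) * (real n * (LINT x|M. f x)))"
      using upper lower unfolding p_def by linarith
  qed (use s e in auto)
qed

end

section \<open>Trimmed sums and truncated sums\<close>

text \<open>The trimmed sum rests on a choice of arrangement. Sorting the indices by negated value
  provides one.\<close>

lemma exists_decreasing_arrangement: "\<exists>\<sigma>. decreasing_arrangement T chi n x \<sigma>"
proof -
  define a where "a i = chi ((T ^^ i) x)" for i
  define xs where "xs = sort_key (\<lambda>i. - a i) [0..<n]"
  have "mset xs = mset [0..<n]" by (simp add: xs_def)
  then obtain \<sigma> where \<sigma>: "\<sigma> permutes {..<length [0..<n]}" "permute_list \<sigma> [0..<n] = xs"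
    by (rule mset_eq_permutation)
  have len: "length xs = n" by (simp add: xs_def)
  have nth: "xs ! i = \<sigma> i" if "i < n" for i
  proof -
    have "\<sigma> i < n" using permutes_in_image[OF \<sigma>(1), of i] that by simp
    thus ?thesis using \<sigma>(2)[symmetric] that permute_list_nth[OF \<sigma>(1), of i] by simp
  qed
  have "sorted (map (\<lambda>i. - a i) xs)" unfolding xs_def by (rule sorted_sort_key)
  hence "a (\<sigma> j) \<le> a (\<sigma> i)" if "i \<le> j" "j < n" for i j
    using sorted_nth_mono[of "map (\<lambda>i. - a i) xs" i j] that len by (simp add: nth)
  thus ?thesis
    using \<sigma>(1) unfolding decreasing_arrangement_def a_def by (intro exI[of _ \<sigma>]) auto
qed

definition large_terms :: "('a \<Rightarrow> 'a) \<Rightarrow> ('a \<Rightarrow> real) \<Rightarrow> nat \<Rightarrow> real \<Rightarrow> 'a \<Rightarrow> nat" where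
  "large_terms T chi n t x = card {i. i < n \<and> t < chi ((T ^^ i) x)}"

lemma trimmed_sum_arrangement:
  obtains \<sigma> where "decreasing_arrangement T chi n x \<sigma>"
    "trimmed_sum T chi n b x = (\<Sum>k=b..<n. chi ((T ^^ \<sigma> k) x))"
proof (rule that)
  show "decreasing_arrangement T chi n x (SOME \<sigma>. decreasing_arrangement T chi n x \<sigma>)"
    by (rule someI_ex[OF exists_decreasing_arrangement])
qed (simp add: trimmed_sum_def Let_def)

lemma sum_truncation_arrangement:
  assumes "decreasing_arrangement T chi n x \<sigma>"
  shows "(\<Sum>k<n. truncation t chi ((T ^^ \<sigma> k) x)) = (\<Sum>i<n. truncation t chi ((T ^^ i) x))"
  using assms sum.permute[of \<sigma> "{..<n}" "\<lambda>i. truncation t chi ((T ^^ i) x)"]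
  by (simp add: decreasing_arrangement_def comp_def)

text \<open>If a retained term at position \<open>k \<ge> b\<close> exceeded \<open>t\<close>, so
  would all \<open>k + 1\<close> terms up to it, more than \<open>b\<close> of them. Retained terms
  are thus unaffected by truncation.\<close>

lemma trimmed_sum_le:
  assumes nonneg: "\<And>i. 0 \<le> chi ((T ^^ i) x)" and few: "large_terms T chi n t x \<le> b"
  shows "trimmed_sum T chi n b x \<le> (\<Sum>i<n. truncation t chi ((T ^^ i) x))"
proof -
  obtain \<sigma> where \<sigma>: "decreasing_arrangement T chi n x \<sigma>"
    "trimmed_sum T chi n b x = (\<Sum>k=b..<n. chi ((T ^^ \<sigma> k) x))"
    by (rule trimmed_sum_arrangement)
  have perm: "\<sigma> permutes {..<n}" and dec: "\<And>i j. i \<le> j \<Longrightarrow> j < n \<Longrightarrow> chi ((T ^^ \<sigma> j) x) \<le> chi ((T ^^ \<sigma> i) x)"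
    using \<sigma>(1) by (auto simp: decreasing_arrangement_def)
  have small: "chi ((T ^^ \<sigma> k) x) \<le> t" if k: "b \<le> k" "k < n" for k
  proof (rule ccontr)
    assume "\<not> chi ((T ^^ \<sigma> k) x) \<le> t"
    hence "\<sigma> ` {..k} \<subseteq> {i. i < n \<and> t < chi ((T ^^ i) x)}"
      using dec[of _ k] k permutes_in_image[OF perm] by force
    hence "card (\<sigma> ` {..k}) \<le> large_terms T chi n t x"
      unfolding large_terms_def by (intro card_mono) auto
    moreover have "card (\<sigma> ` {..k}) = Suc k"
      using permutes_inj_on[OF perm] by (simp add: card_image)
    ultimately show False using few k by simp
  qed
  have "trimmed_sum T chi n b x = (\<Sum>k=b..<n. truncation t chi ((T ^^ \<sigma> k) x))"
    unfolding \<sigma>(2) using small by (intro sum.cong) (auto simp: truncation_def)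
  also have "\<dots> \<le> (\<Sum>k<n. truncation t chi ((T ^^ \<sigma> k) x))"
    using nonneg by (intro sum_mono2) (auto simp: truncation_def)
  finally show ?thesis by (simp add: sum_truncation_arrangement[OF \<sigma>(1)])
qed

text \<open>The discarded terms all exceed \<open>t\<close> and are truncated to 0, so trimming
  removes nothing from the truncated sum.\<close>

lemma trimmed_sum_ge:
  assumes nonneg: "\<And>i. 0 \<le> chi ((T ^^ i) x)" and many: "b \<le> large_terms T chi n t x"
  shows "(\<Sum>i<n. truncation t chi ((T ^^ i) x)) \<le> trimmed_sum T chi n b x"
proof -
  obtain \<sigma> where \<sigma>: "decreasing_arrangement T chi n x \<sigma>"
    "trimmed_sum T chi n b x = (\<Sum>k=b..<n. chi ((T ^^ \<sigma> k) x))"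
    by (rule trimmed_sum_arrangement)
  have perm: "\<sigma> permutes {..<n}" and dec: "\<And>i j. i \<le> j \<Longrightarrow> j < n \<Longrightarrow> chi ((T ^^ \<sigma> j) x) \<le> chi ((T ^^ \<sigma> i) x)"
    using \<sigma>(1) by (auto simp: decreasing_arrangement_def)
  have large: "t < chi ((T ^^ \<sigma> k) x)" if k: "k < b" "k < n" for k
  proof (rule ccontr)
    assume k': "\<not> t < chi ((T ^^ \<sigma> k) x)"
    have "{i. i < n \<and> t < chi ((T ^^ i) x)} \<subseteq> \<sigma> ` {..<k}"
    proof
      fix i assume i: "i \<in> {i. i < n \<and> t < chi ((T ^^ i) x)}"
      then obtain j where j: "i = \<sigma> j" "j < n"
        using permutes_image[OF perm] by (metis (no_types, lifting) imageE lessThan_iff mem_Collect_eq)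
      have "j < k"
      proof (rule ccontr)
        assume "\<not> j < k"
        thus False using dec[of k j] j i k' by auto
      qed
      thus "i \<in> \<sigma> ` {..<k}" using j by auto
    qed
    hence "large_terms T chi n t x \<le> card (\<sigma> ` {..<k})"
      unfolding large_terms_def by (intro card_mono) auto
    also have "\<dots> \<le> k" using card_image_le[of "{..<k}" \<sigma>] by simp
    finally show False using many k by simp
  qed
  have "(\<Sum>k<n. truncation t chi ((T ^^ \<sigma> k) x)) = (\<Sum>k=b..<n. truncation t chi ((T ^^ \<sigma> k) x))"
  proof (rule sum.mono_neutral_right)
    show "\<forall>k\<in>{..<n} - {b..<n}. truncation t chi ((T ^^ \<sigma> k) x) = 0"
    proof
      fix k assume "k \<in> {..<n} - {b..<n}"
      hence "t < chi ((T ^^ \<sigma> k) x)" using large[of k] by auto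
      thus "truncation t chi ((T ^^ \<sigma> k) x) = 0" by (simp add: truncation_def)
    qed
  qed auto
  also have "\<dots> \<le> trimmed_sum T chi n b x"
    unfolding \<sigma>(2) using nonneg by (intro sum_mono) (auto simp: truncation_def indicator_def)
  finally show ?thesis by (simp add: sum_truncation_arrangement[OF \<sigma>(1)])
qed

locale heavy_tail_system = spectral_gap_system M T F nrm
  for M :: "'a measure" and T F nrm +
  fixes chi :: "'a \<Rightarrow> real" and L :: "real \<Rightarrow> real" and \<alpha> :: real
  assumes property_D: "property_D M T F nrm chi"
    and alpha: "0 < \<alpha>" "\<alpha> < 1"
    and slow: "slowly_varying L"
    and tail_L: "\<And>x. x > 0 \<Longrightarrow> measure M {w \<in> space M. chi w > x} = L x / x powr \<alpha>"
begin

lemma chi_measurable [measurable]: "chi \<in> borel_measurable M"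
  and chi_nonneg: "x \<in> space M \<Longrightarrow> 0 \<le> chi x"
  using property_D by (auto simp: property_D_def)

definition tail :: "real \<Rightarrow> real" where
  "tail t = prob {x \<in> space M. t < chi x}"

sublocale regular_tail tail \<alpha>
proof
  have anti: "tail y \<le> tail x" if "x \<le> y" for x y
    unfolding tail_def using that by (intro finite_measure_mono) auto
  have Lpos: "\<forall>\<^sub>F x in at_top. 0 < L x" using slow by (simp add: slowly_varying_def)
  have tail_eq: "tail x = L x / x powr \<alpha>" if "0 < x" for x
    using tail_L[OF that] by (simp add: tail_def)
  have "\<forall>\<^sub>F y in at_top. 0 < tail y"
    using Lpos eventually_gt_at_top[of 0] by eventually_elim (simp add: tail_eq)
  then obtain y where y: "\<And>z. y \<le> z \<Longrightarrow> 0 < tail z" by (auto simp: eventually_at_top_linorder)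
  show "tail y \<le> tail x" if "x \<le> y" for x y using anti[OF that] .
  \<comment> \<open>Far out the tail is positive because \<open>L\<close> is eventually positive;
    monotonicity carries this back to every \<open>x\<close>.\<close>
  show "0 < tail x" for x using anti[of x "max x y"] y[of "max x y"] by auto
  show "((\<lambda>t. tail (c * t) / tail t) \<longlongrightarrow> c powr - \<alpha>) at_top" if c: "0 < c" for c
  proof -
    have "(\<lambda>x. L (c * x)) \<sim>[at_top] L" using slow c by (simp add: slowly_varying_def)
    hence "((\<lambda>x. L (c * x) / L x) \<longlongrightarrow> 1) at_top"
      by (rule asymp_equivD_strong) (use Lpos in eventually_elim, auto)
    hence "((\<lambda>x. L (c * x) / L x * c powr - \<alpha>) \<longlongrightarrow> 1 * c powr - \<alpha>) at_top"
      by (intro tendsto_intros)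
    hence "((\<lambda>x. L (c * x) / L x * c powr - \<alpha>) \<longlongrightarrow> c powr - \<alpha>) at_top" by simp
    thus ?thesis
    proof (rule Lim_transform_eventually)
      show "\<forall>\<^sub>F x in at_top. L (c * x) / L x * c powr - \<alpha> = tail (c * x) / tail x"
        using eventually_gt_at_top[of 0]
        by eventually_elim (use c in \<open>simp add: tail_eq powr_mult powr_minus_divide\<close>)
    qed
  qed
qed (use alpha in auto)

lemma tail_eq: "0 < x \<Longrightarrow> tail x = L x / x powr \<alpha>"
  using tail_L by (simp add: tail_def)

definition truncated_mean :: "real \<Rightarrow> real" where
  "truncated_mean t = (LINT x|M. truncation t chi x)"

lemma truncation_bounds: "x \<in> space M \<Longrightarrow> 0 < t \<Longrightarrow> 0 \<le> truncation t chi x \<and> truncation t chi x \<le> t"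
  using chi_nonneg[of x] by (auto simp: truncation_def indicator_def)

lemma truncation_measurable [measurable]: "truncation t chi \<in> borel_measurable M"
  unfolding truncation_def[abs_def] indicator_def by measurable

lemma truncation_integrable: "0 < t \<Longrightarrow> integrable M (truncation t chi)"
  using truncation_bounds by (intro integrable_const_bound[of _ t]) auto

text \<open>Raising the level from \<open>s\<close> to \<open>t\<close> adds the values of
  \<open>chi\<close> in between, on a set of measure \<open>tail s - tail t\<close>; these are the
  increment bounds of Karamata's theorem.\<close>

lemma truncated_mean_asymptotic:
  "((\<lambda>t. truncated_mean t / (t * tail t)) \<longlongrightarrow> \<alpha> / (1 - \<alpha>)) at_top"
proof -
  \<comment> \<open>Extension by 0 to nonpositive levels: nonnegativity is asked of all arguments,
    the limit concerns large ones.\<close>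
  define W where "W t = (if 0 < t then truncated_mean t else 0)" for t
  have diff: "s * (tail s - tail t) \<le> W t - W s \<and> W t - W s \<le> t * (tail s - tail t)"
    if st: "0 < s" "s \<le> t" for s t
  proof -
    let ?A = "{x \<in> space M. s < chi x \<and> chi x \<le> t}"
    have "prob ?A = tail s - tail t"
    proof -
      have "?A = {x \<in> space M. s < chi x} - {x \<in> space M. t < chi x}" by auto
      moreover have "prob ({x \<in> space M. s < chi x} - {x \<in> space M. t < chi x}) = tail s - tail t"
        unfolding tail_def by (rule finite_measure_Diff) (use st in auto)
      ultimately show ?thesis by (simp only:)
    qed
    moreover have "W t - W s = (LINT x|M. truncation t chi x - truncation s chi x)"
      using st truncation_integrable by (simp add: W_def truncated_mean_def)
    moreover have int1: "integrable M (\<lambda>x. c * indicator ?A x)" for c :: real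
      by (intro integrable_mult_right integrable_real_indicator) (auto simp: less_top[symmetric])
    moreover have int2: "integrable M (\<lambda>x. truncation t chi x - truncation s chi x)"
      using st by (intro Bochner_Integration.integrable_diff truncation_integrable) auto
    moreover have "(LINT x|M. s * indicator ?A x) \<le> (LINT x|M. truncation t chi x - truncation s chi x)"
      using st by (intro integral_mono[OF int1 int2]) (auto simp: truncation_def indicator_def)
    moreover have "(LINT x|M. truncation t chi x - truncation s chi x) \<le> (LINT x|M. t * indicator ?A x)"
      using st by (intro integral_mono[OF int2 int1]) (auto simp: truncation_def indicator_def)
    ultimately show ?thesis by simp
  qed
  have "0 \<le> W t" for t
    using truncation_bounds unfolding W_def truncated_mean_def by (auto intro!: integral_nonneg_AE)
  hence "((\<lambda>t. W t / (t * tail t)) \<longlongrightarrow> \<alpha> / (1 - \<alpha>)) at_top"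
    using diff by (intro truncated_moment alpha) auto
  thus ?thesis
    by (rule Lim_transform_eventually)
      (use eventually_gt_at_top[of 0] in eventually_elim, simp add: W_def)
qed

lemma observables:
  obtains K where "0 \<le> K" "\<And>t. 0 < t \<Longrightarrow> bounded_observable K (indicator {x. t < chi x})"
    "\<And>t. 0 < t \<Longrightarrow> bounded_observable K (\<lambda>x. truncation t chi x / t)"
proof -
  obtain K1 K2 where K: "0 < K1" "0 < K2"
    "\<And>l. 0 < l \<Longrightarrow> (\<lambda>x. complex_of_real (truncation l chi x)) \<in> F"
    "\<And>l. 0 < l \<Longrightarrow> nrm (\<lambda>x. complex_of_real (truncation l chi x)) \<le> K1 * l"
    "\<And>l. 0 < l \<Longrightarrow> (\<lambda>x. indicator {y. l < chi y} x) \<in> F"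
    "\<And>l. 0 < l \<Longrightarrow> nrm (\<lambda>x. indicator {y. l < chi y} x) \<le> K2"
    using property_D unfolding property_D_def by blast
  show ?thesis
  proof (rule that[of "K1 + K2"])
    fix t :: real assume t: "0 < t"
    have ind: "(\<lambda>x. complex_of_real (indicator {x. t < chi x} x)) = (\<lambda>x. indicator {y. t < chi y} x)"
      by (rule ext) (simp add: indicator_def)
    have [measurable]: "(indicator {x. t < chi x} :: _ \<Rightarrow> real) \<in> borel_measurable M"
      unfolding indicator_def by measurable
    have "nrm (\<lambda>x. indicator {y. t < chi y} x) \<le> K1 + K2" using K(6)[OF t] K(1) by linarith
    thus "bounded_observable (K1 + K2) (indicator {x. t < chi x})"
      unfolding bounded_observable_def ind
    proof (intro conjI ballI)
      show "(\<lambda>x. indicator {y. t < chi y} x) \<in> F" by (rule K(5)[OF t])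
    qed (simp_all only:, simp_all add: indicator_def)
    let ?g = "\<lambda>x. complex_of_real (truncation t chi x)"
    have g: "(\<lambda>x. complex_of_real (truncation t chi x / t)) = scl (of_real (1 / t)) ?g"
      by (rule ext) simp
    have "nrm (scl (of_real (1 / t)) ?g) = 1 / t * nrm ?g"
      using norm_scale[OF K(3)[OF t], of "of_real (1 / t)"] t by (simp only: norm_of_real) simp
    also have "\<dots> \<le> 1 / t * (K1 * t)" using K(4)[OF t] t by (intro mult_left_mono) auto
    also have "\<dots> \<le> K1 + K2" using t K(2) by simp
    finally have le: "nrm (scl (of_real (1 / t)) ?g) \<le> K1 + K2" .
    show "bounded_observable (K1 + K2) (\<lambda>x. truncation t chi x / t)"
      unfolding bounded_observable_def g
    proof (intro conjI ballI scale_mem K(3) t le)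
      fix x assume "x \<in> space M"
      thus "0 \<le> truncation t chi x / t" "truncation t chi x / t \<le> 1"
        using truncation_bounds[of x t] t by auto
    qed measurable
  qed (use K in simp)
qed

lemma birkhoff_sum_indicator: "birkhoff_sum (indicator {x. t < chi x}) n x = real (large_terms T chi n t x)"
proof -
  have "birkhoff_sum (indicator {x. t < chi x}) n x = (\<Sum>i<n. if t < chi ((T ^^ i) x) then 1 else 0)"
    unfolding birkhoff_sum_def by (intro sum.cong) (auto simp: indicator_def)
  also have "\<dots> = real (card ({..<n} \<inter> {i. t < chi ((T ^^ i) x)}))"
    by (simp add: sum.If_cases)
  also have "{..<n} \<inter> {i. t < chi ((T ^^ i) x)} = {i. i < n \<and> t < chi ((T ^^ i) x)}" by auto
  finally show ?thesis by (simp add: large_terms_def)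
qed

lemma birkhoff_sum_truncation:
  "birkhoff_sum (\<lambda>x. truncation t chi x / t) n x = (\<Sum>i<n. truncation t chi ((T ^^ i) x)) / t"
  by (simp add: birkhoff_sum_def sum_divide_distrib)

lemma integral_indicator_tail: "(LINT x|M. indicator {x. t < chi x} x) = tail t"
proof -
  have "(LINT x|M. indicator {x. t < chi x} x) = (LINT x|M. indicator {x \<in> space M. t < chi x} x :: real)"
    by (intro Bochner_Integration.integral_cong) (auto simp: indicator_def)
  thus ?thesis by (simp add: tail_def)
qed

end

section \<open>The strong law for trimmed sums\<close>

text \<open>A geometric series started at the least element of \<open>I\<close>, which already
  satisfies the threshold.\<close>

lemma sum_exp_tail_le:
  fixes z \<delta> :: real
  assumes "finite I" "0 < \<delta>" "\<And>m. m \<in> I \<Longrightarrow> z \<le> \<delta> * real m"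
  shows "(\<Sum>m\<in>I. exp (- \<delta> * real m)) \<le> exp (- z) / (1 - exp (- \<delta>))"
proof (cases "I = {}")
  case False
  define m0 where "m0 = Min I"
  define r where "r = exp (- \<delta>)"
  have r: "0 < r" "r < 1" using assms by (auto simp: r_def)
  have m0: "m0 \<in> I" "\<And>m. m \<in> I \<Longrightarrow> m0 \<le> m" using assms False by (auto simp: m0_def)
  have pow: "exp (- \<delta> * real m) = r ^ m" for m
    by (simp add: r_def exp_of_nat_mult[symmetric] mult.commute)
  have "(\<Sum>m\<in>I. exp (- \<delta> * real m)) = (\<Sum>m\<in>I. r ^ m0 * r ^ (m - m0))"
    unfolding pow using m0 by (intro sum.cong refl) (simp flip: power_add)
  also have "\<dots> = r ^ m0 * (\<Sum>j\<in>(\<lambda>m. m - m0) ` I. r ^ j)"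
    unfolding sum_distrib_left[symmetric]
    using m0 by (subst sum.reindex) (auto intro!: inj_onI simp: comp_def dest: eq_diff_iff)
  also have "\<dots> \<le> r ^ m0 * (\<Sum>j. r ^ j)"
    using r assms by (intro mult_left_mono sum_le_suminf summable_geometric) auto
  also have "(\<Sum>j. r ^ j) = 1 / (1 - r)" using r by (intro suminf_geometric) auto
  also have "r ^ m0 * (1 / (1 - r)) \<le> exp (- z) * (1 / (1 - r))"
    using assms(3)[OF m0(1)] r unfolding pow[symmetric] by (intro mult_right_mono) auto
  finally show ?thesis by (simp add: r_def)
qed (use assms in auto)

text \<open>Each value of \<open>g\<close> is repeated exactly \<open>J\<close> times, so the
  partial sums are at most \<open>J\<close> times the total.\<close>

lemma summable_comp_div:
  fixes g :: "nat \<Rightarrow> real"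
  assumes "summable g" "\<And>k. 0 \<le> g k" "0 < J"
  shows "summable (\<lambda>i. g (i div J))"
proof (rule bounded_imp_summable)
  fix n
  have "n < Suc n * J" using assms(3) by (cases J) auto
  hence "(\<Sum>i\<le>n. g (i div J)) \<le> (\<Sum>i<Suc n * J. g (i div J))"
    using assms(2) by (intro sum_mono2) auto
  also have "\<dots> = (\<Sum>k<Suc n. \<Sum>i=k * J..<k * J + J. g (i div J))"
    by (rule sum.nat_group[symmetric])
  also have "\<dots> = (\<Sum>k<Suc n. real J * g k)"
  proof (intro sum.cong refl)
    fix k
    have "(\<Sum>i=k * J..<k * J + J. g (i div J)) = (\<Sum>i=k * J..<k * J + J. g k)"
    proof (intro sum.cong refl)
      fix i assume "i \<in> {k * J..<k * J + J}"
      hence "i div J = k" by (intro div_nat_eqI) (auto simp: mult.commute)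
      thus "g (i div J) = g k" by simp
    qed
    thus "(\<Sum>i=k * J..<k * J + J. g (i div J)) = real J * g k" by simp
  qed
  also have "\<dots> \<le> real J * suminf g"
    unfolding sum_distrib_left[symmetric] using assms by (intro mult_left_mono sum_le_suminf) auto
  finally show "(\<Sum>i\<le>n. g (i div J)) \<le> real J * suminf g" .
qed (use assms in auto)

text \<open>Recovers the argument of \<psi>, the floor of the logarithm of \<open>n\<close>, from
  the index of the finer geometric scale.\<close>

lemma nat_floor_mult_div:
  fixes x :: real
  assumes "0 \<le> x" "0 < J" shows "nat \<lfloor>real J * x\<rfloor> div J = nat \<lfloor>x\<rfloor>"
proof (rule div_nat_eqI)
  have x: "real (nat \<lfloor>x\<rfloor>) \<le> x" "x < real (nat \<lfloor>x\<rfloor>) + 1" using assms by linarith+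
  have Jx: "0 \<le> real J * x" using assms by simp
  have "real J * real (nat \<lfloor>x\<rfloor>) \<le> real J * x" using x by (intro mult_left_mono) auto
  hence "real (J * nat \<lfloor>x\<rfloor>) \<le> real J * x" by simp
  thus "J * nat \<lfloor>x\<rfloor> \<le> nat \<lfloor>real J * x\<rfloor>" using Jx by (simp add: le_nat_floor)
  have "real J * x < real J * (real (nat \<lfloor>x\<rfloor>) + 1)" using x assms by (intro mult_strict_left_mono) auto
  also have "\<dots> = real (J * Suc (nat \<lfloor>x\<rfloor>))" by (simp add: algebra_simps)
  finally have "real (nat \<lfloor>real J * x\<rfloor>) < real (J * Suc (nat \<lfloor>x\<rfloor>))" using Jx by linarith
  thus "nat \<lfloor>real J * x\<rfloor> < J * Suc (nat \<lfloor>x\<rfloor>)" by (simp only: of_nat_less_iff)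
qed

lemma large_terms_mono: "n \<le> n' \<Longrightarrow> large_terms T chi n t x \<le> large_terms T chi n' t x"
  unfolding large_terms_def by (intro card_mono) auto

context heavy_tail_system
begin

definition kappa :: real where "kappa = \<alpha> / (1 - \<alpha>)"

lemma kappa_pos: "0 < kappa"
  using alpha by (simp add: kappa_def)

text \<open>The quantile and Karamata asymptotics at one \<open>p\<close>, each to within a factor
  \<open>q\<close>. This turns the block estimates into bookkeeping of powers of
  \<open>q\<close>.\<close>

definition good_threshold :: "real \<Rightarrow> real \<Rightarrow> bool" where
  "good_threshold q p \<longleftrightarrow> 0 < tail_quantile p \<and>
     p / q \<le> tail (tail_quantile p) \<and> tail (tail_quantile p) \<le> q * p \<and>
     kappa / q * (tail_quantile p * tail (tail_quantile p)) \<le> truncated_mean (tail_quantile p) \<and>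
     truncated_mean (tail_quantile p) \<le> q * kappa * (tail_quantile p * tail (tail_quantile p))"

lemma eventually_good_threshold:
  assumes q: "1 < q" shows "\<forall>\<^sub>F p in at_right 0. good_threshold q p"
proof -
  have "1 / q < 1" using q by simp
  note 1 = order_tendstoD(1)[OF tail_of_quantile this] order_tendstoD(2)[OF tail_of_quantile q]
  have "((\<lambda>p. truncated_mean (tail_quantile p) / (tail_quantile p * tail (tail_quantile p))) \<longlongrightarrow> kappa) (at_right 0)"
    unfolding kappa_def by (rule filterlim_compose[OF truncated_mean_asymptotic filterlim_tail_quantile])
  note 2 = order_tendstoD[OF this]
  have "kappa / q < kappa" "kappa < q * kappa" using q kappa_pos by (auto simp: divide_simps)
  note 2 = 2(1)[OF this(1)] 2(2)[OF this(2)]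
  have "\<forall>\<^sub>F p in at_right 0. 0 < tail_quantile p"
    using filterlim_tail_quantile by (simp add: filterlim_at_top_dense)
  with 1 2 eventually_at_right_less[of 0] show ?thesis
  proof eventually_elim
    case (elim p)
    have "0 < tail_quantile p * tail (tail_quantile p)" using elim pos by simp
    thus ?case
      using elim q unfolding good_threshold_def
      by (simp add: less_divide_eq divide_less_eq) (simp add: field_simps)
  qed
qed

definition deviation_event :: "real \<Rightarrow> nat \<Rightarrow> real \<Rightarrow> 'a set" where
  "deviation_event e n t =
     {x \<in> space M. \<bar>birkhoff_sum (indicator {x. t < chi x}) n x - real n * tail t\<bar> > e * (real n * tail t)} \<union>
     {x \<in> space M. \<bar>birkhoff_sum (\<lambda>x. truncation t chi x / t) n x - real n * (truncated_mean t / t)\<bar> >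
        e * (real n * (truncated_mean t / t))}"

lemma birkhoff_measurable [measurable]:
  "birkhoff_sum (indicator {x. t < chi x}) n \<in> borel_measurable M"
  "birkhoff_sum (\<lambda>x. truncation t chi x / t) n \<in> borel_measurable M"
proof -
  have "(indicator {x. t < chi x} :: _ \<Rightarrow> real) \<in> borel_measurable M"
    unfolding indicator_def by measurable
  thus "birkhoff_sum (indicator {x. t < chi x}) n \<in> borel_measurable M" by (rule birkhoff_sum_measurable)
  have "(\<lambda>x. truncation t chi x / t) \<in> borel_measurable M" by measurable
  thus "birkhoff_sum (\<lambda>x. truncation t chi x / t) n \<in> borel_measurable M" by (rule birkhoff_sum_measurable)
qed

lemma deviation_event_sets [measurable]: "deviation_event e n t \<in> sets M"
  unfolding deviation_event_def by measurable

lemma deviation_event_prob: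
  assumes e: "0 < e" "e \<le> 1"
  obtains c where "0 < c" "\<And>t n d. 0 < t \<Longrightarrow> d \<le> real n * tail t \<Longrightarrow> d \<le> real n * (truncated_mean t / t) \<Longrightarrow>
    prob (deviation_event e n t) \<le> 4 * exp (- c * d)"
proof -
  obtain K where K: "0 \<le> K" "\<And>t. 0 < t \<Longrightarrow> bounded_observable K (indicator {x. t < chi x})"
    "\<And>t. 0 < t \<Longrightarrow> bounded_observable K (\<lambda>x. truncation t chi x / t)"
    by (rule observables) blast
  obtain c where c: "0 < c" "\<And>f n. bounded_observable K f \<Longrightarrow>
      prob {x \<in> space M. \<bar>birkhoff_sum f n x - real n * (LINT x|M. f x)\<bar> > e * (real n * (LINT x|M. f x))} \<le>
        2 * exp (- c * (real n * (LINT x|M. f x)))"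
    by (rule concentration[OF K(1) e]) blast
  show ?thesis
  proof (rule that[OF c(1)])
    fix t d :: real and n assume t: "0 < t" and d: "d \<le> real n * tail t" "d \<le> real n * (truncated_mean t / t)"
    let ?A = "{x \<in> space M. \<bar>birkhoff_sum (indicator {x. t < chi x}) n x - real n * tail t\<bar> > e * (real n * tail t)}"
    let ?B = "{x \<in> space M. \<bar>birkhoff_sum (\<lambda>x. truncation t chi x / t) n x - real n * (truncated_mean t / t)\<bar> >
        e * (real n * (truncated_mean t / t))}"
    have "prob ?A \<le> 2 * exp (- c * (real n * tail t))"
      using c(2)[OF K(2)[OF t], of n] unfolding integral_indicator_tail .
    also have "\<dots> \<le> 2 * exp (- c * d)" using mult_left_mono[OF d(1), of c] c(1) by simp
    finally have A: "prob ?A \<le> 2 * exp (- c * d)" .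
    have int: "(LINT x|M. truncation t chi x / t) = truncated_mean t / t" by (simp add: truncated_mean_def)
    have "prob ?B \<le> 2 * exp (- c * (real n * (truncated_mean t / t)))"
      using c(2)[OF K(3)[OF t], of n] unfolding int .
    also have "\<dots> \<le> 2 * exp (- c * d)" using mult_left_mono[OF d(2), of c] c(1) by simp
    finally have B: "prob ?B \<le> 2 * exp (- c * d)" .
    have "prob (?A \<union> ?B) \<le> prob ?A + prob ?B" by (rule measure_Un_le) measurable
    thus "prob (deviation_event e n t) \<le> 4 * exp (- c * d)"
      unfolding deviation_event_def using A B by linarith
  qed
qed

lemma outside_deviation_event:
  assumes x: "x \<in> space M" "x \<notin> deviation_event e n t" and t: "0 < t"
  shows "real (large_terms T chi n t x) \<le> (1 + e) * (real n * tail t)"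
    and "(1 - e) * (real n * tail t) \<le> real (large_terms T chi n t x)"
    and "(\<Sum>i<n. truncation t chi ((T ^^ i) x)) \<le> (1 + e) * (real n * truncated_mean t)"
    and "(1 - e) * (real n * truncated_mean t) \<le> (\<Sum>i<n. truncation t chi ((T ^^ i) x))"
proof -
  define c where "c = real (large_terms T chi n t x)"
  define s where "s = (\<Sum>i<n. truncation t chi ((T ^^ i) x))"
  have "\<bar>c - real n * tail t\<bar> \<le> e * (real n * tail t)"
    using x by (auto simp: deviation_event_def birkhoff_sum_indicator c_def)
  thus "c \<le> (1 + e) * (real n * tail t)" "(1 - e) * (real n * tail t) \<le> c"
    unfolding distrib_right left_diff_distrib mult_1 by linarith+
  have "\<bar>s / t - real n * (truncated_mean t / t)\<bar> \<le> e * (real n * (truncated_mean t / t))"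
    using x by (auto simp: deviation_event_def birkhoff_sum_truncation s_def)
  hence "t * \<bar>s / t - real n * (truncated_mean t / t)\<bar> \<le> t * (e * (real n * (truncated_mean t / t)))"
    using t by (intro mult_left_mono) auto
  moreover have "t * \<bar>s / t - real n * (truncated_mean t / t)\<bar> = \<bar>s - real n * truncated_mean t\<bar>"
    using t abs_mult_pos'[of t "s / t - real n * (truncated_mean t / t)"] by (simp add: right_diff_distrib)
  ultimately have "\<bar>s - real n * truncated_mean t\<bar> \<le> e * (real n * truncated_mean t)"
    using t by simp
  thus "s \<le> (1 + e) * (real n * truncated_mean t)" "(1 - e) * (real n * truncated_mean t) \<le> s"
    unfolding distrib_right left_diff_distrib mult_1 by linarith+
qed

lemma orbit_nonneg: "x \<in> space M \<Longrightarrow> 0 \<le> chi ((T ^^ i) x)"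
  using chi_nonneg measurable_space[OF T_power_measurable] by blast

lemma truncation_orbit_nonneg: "x \<in> space M \<Longrightarrow> 0 \<le> truncation t chi ((T ^^ i) x)"
  using orbit_nonneg by (simp add: truncation_def)

text \<open>Count and truncated sum increase with the number of terms, so the event at the end
  \<open>N\<close> of the block serves every \<open>n \<le> N\<close>. The \<open>q ^ 3\<close> in
  \<open>p\<close> pays for the length of the block, the error of the quantile and the deviation,
  which keeps the count at most \<open>m\<close>; the Karamata error remains in the
  conclusion.\<close>

lemma block_upper:
  fixes m :: nat
  assumes q: "1 < q" and X: "0 < X" "real N \<le> q * X" and n: "n \<le> N" and p: "p = real m / (X * q ^ 3)"
    and good: "good_threshold q p" and x: "x \<in> space M" "x \<notin> deviation_event (1 - 1 / q) N (tail_quantile p)"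
  shows "trimmed_sum T chi n m x \<le> q * kappa * real m * tail_quantile p"
proof -
  define t where "t = tail_quantile p"
  have t: "0 < t" "tail t \<le> q * p" "truncated_mean t \<le> q * kappa * (t * tail t)"
    using good by (auto simp: good_threshold_def t_def)
  have p0: "0 \<le> p" using p X q by simp
  have e: "1 + (1 - 1 / q) \<le> q"
  proof -
    have "0 \<le> (q - 1)\<^sup>2 / q" using q by simp
    also have "\<dots> = q - (1 + (1 - 1 / q))" using q by (simp add: power2_eq_square field_simps)
    finally show ?thesis by simp
  qed
  have pm: "q * (q * X * (q * p)) = real m" using p X q by (simp add: power3_eq_cube field_simps)
  have tail_nonneg: "0 \<le> tail t" using pos[of t] by simp
  have "real (large_terms T chi n t x) \<le> real (large_terms T chi N t x)"
    using large_terms_mono[OF n] by simp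
  also have "\<dots> \<le> (1 + (1 - 1 / q)) * (real N * tail t)"
    using outside_deviation_event(1)[OF x(1) x(2)[folded t_def] t(1)] .
  also have "\<dots> \<le> q * (q * X * (q * p))"
    using e X t q p0 tail_nonneg by (intro mult_mono) auto
  finally have few: "large_terms T chi n t x \<le> m" using pm by simp
  have "trimmed_sum T chi n m x \<le> (\<Sum>i<n. truncation t chi ((T ^^ i) x))"
    using orbit_nonneg[OF x(1)] few by (intro trimmed_sum_le) auto
  also have "\<dots> \<le> (\<Sum>i<N. truncation t chi ((T ^^ i) x))"
    using n truncation_orbit_nonneg[OF x(1)] by (intro sum_mono2) auto
  also have "\<dots> \<le> (1 + (1 - 1 / q)) * (real N * truncated_mean t)"
    using outside_deviation_event(3)[OF x(1) x(2)[folded t_def] t(1)] .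
  also have "\<dots> \<le> q * (q * X * (q * kappa * (t * (q * p))))"
  proof (intro mult_mono e X)
    have "q * kappa * (t * tail t) \<le> q * kappa * (t * (q * p))"
      using q kappa_pos t by (intro mult_left_mono) auto
    thus "truncated_mean t \<le> q * kappa * (t * (q * p))" using t by linarith
    show "0 \<le> truncated_mean t"
      using truncation_bounds t(1) unfolding truncated_mean_def by (intro integral_nonneg_AE) auto
  qed (use q X p0 t kappa_pos truncation_bounds in \<open>auto simp: truncated_mean_def intro!: mult_nonneg_nonneg integral_nonneg_AE\<close>)
  also have "\<dots> = q * kappa * (q * (q * X * (q * p))) * t" by (simp add: mult_ac)
  finally show ?thesis unfolding pm t_def .
qed

text \<open>Here the start \<open>N\<close> of the block serves every later \<open>n\<close>. Two of
  the three factors \<open>q\<close> in \<open>p\<close> pay for the quantile and the deviation; the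
  third is spare for the count and absorbs the Karamata error for the sum.\<close>

lemma block_lower:
  fixes m :: nat
  assumes q: "1 < q" and X: "0 < X" "X \<le> real N" and n: "N \<le> n" and p: "p = q ^ 3 * real m / X"
    and good: "good_threshold q p" and x: "x \<in> space M" "x \<notin> deviation_event (1 - 1 / q) N (tail_quantile p)"
  shows "kappa * real m * tail_quantile p \<le> trimmed_sum T chi n m x"
proof -
  define t where "t = tail_quantile p"
  have t: "0 < t" "p / q \<le> tail t" "kappa / q * (t * tail t) \<le> truncated_mean t"
    using good by (auto simp: good_threshold_def t_def)
  have p0: "0 \<le> p" using p X q by simp
  have e: "1 - (1 - 1 / q) = 1 / q" by simp
  have pm: "1 / q * (X * (p / q)) = q * real m" using p X q by (simp add: power3_eq_cube field_simps)
  have "real m \<le> q * real m" using q mult_right_mono[of 1 q "real m"] by simp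
  also have "\<dots> = 1 / q * (X * (p / q))" using pm by simp
  also have "\<dots> \<le> 1 / q * (real N * tail t)"
    using X t q p0 by (intro mult_left_mono mult_mono) auto
  also have "\<dots> \<le> real (large_terms T chi N t x)"
    using outside_deviation_event(2)[OF x(1) x(2)[folded t_def] t(1)] unfolding e .
  also have "\<dots> \<le> real (large_terms T chi n t x)"
    using large_terms_mono[OF n] by simp
  finally have many: "m \<le> large_terms T chi n t x" by simp
  have "kappa * real m * t = 1 / q * (X * (p / q)) * kappa * t / q"
    unfolding pm using q by simp
  also have "\<dots> = 1 / q * (X * (kappa / q * (t * (p / q))))" by (simp add: mult_ac)
  also have "\<dots> \<le> 1 / q * (real N * truncated_mean t)"
  proof (intro mult_left_mono mult_mono X)
    have "kappa / q * (t * (p / q)) \<le> kappa / q * (t * tail t)"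
      using t q kappa_pos by (intro mult_left_mono) auto
    thus "kappa / q * (t * (p / q)) \<le> truncated_mean t" using t by linarith
  qed (use q p0 t kappa_pos in auto)
  also have "\<dots> \<le> (\<Sum>i<N. truncation t chi ((T ^^ i) x))"
    using outside_deviation_event(4)[OF x(1) x(2)[folded t_def] t(1)] unfolding e .
  also have "\<dots> \<le> (\<Sum>i<n. truncation t chi ((T ^^ i) x))"
    using n truncation_orbit_nonneg[OF x(1)] by (intro sum_mono2) auto
  also have "\<dots> \<le> trimmed_sum T chi n m x"
    using orbit_nonneg[OF x(1)] many by (intro trimmed_sum_ge) auto
  finally show ?thesis unfolding t_def .
qed

text \<open>Both expectations in the exponent of the deviation bound are at least a fixed multiple
  of \<open>m\<close>. Only a lower bound on \<open>p\<close> is assumed, which makes the lemma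
  apply to the thresholds of the upper and of the lower estimate.\<close>

lemma block_mean_lower:
  fixes m :: nat
  assumes q: "1 < q" and X: "0 < X" "X \<le> real N" and p: "real m / (X * q ^ 3) \<le> p"
    and good: "good_threshold q p"
  shows "min 1 kappa / q ^ 5 * real m \<le> real N * tail (tail_quantile p)"
    and "min 1 kappa / q ^ 5 * real m \<le> real N * (truncated_mean (tail_quantile p) / tail_quantile p)"
proof -
  define t where "t = tail_quantile p"
  have t: "0 < t" "p / q \<le> tail t" "kappa / q * (t * tail t) \<le> truncated_mean t"
    using good by (auto simp: good_threshold_def t_def)
  have "0 \<le> real m / (X * q ^ 3)" using X q by simp
  hence p0: "0 \<le> p" using p by linarith
  have Xp: "real m / q ^ 4 \<le> X * (p / q)"
  proof -
    have "X * (real m / (X * q ^ 3) / q) \<le> X * (p / q)"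
      using p q X by (intro mult_left_mono divide_right_mono) auto
    moreover have "X * (real m / (X * q ^ 3) / q) = real m / q ^ 4"
      using X by (simp add: power_numeral_reduce)
    ultimately show ?thesis by simp
  qed
  also have "\<dots> \<le> real N * tail t" using t X p0 q by (intro mult_mono) auto
  finally have Nt: "real m / q ^ 4 \<le> real N * tail t" .
  have "min 1 kappa / q ^ 5 * real m \<le> 1 / q ^ 4 * real m"
    using q kappa_pos by (intro mult_right_mono frac_le power_increasing) auto
  thus "min 1 kappa / q ^ 5 * real m \<le> real N * tail (tail_quantile p)" using Nt by (simp add: t_def)
  have "min 1 kappa / q ^ 5 * real m \<le> kappa / q ^ 5 * real m"
    using q by (intro mult_right_mono divide_right_mono) auto
  also have "\<dots> = kappa / q * (real m / q ^ 4)" by (simp add: power_numeral_reduce)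
  also have "\<dots> \<le> kappa / q * (real N * tail t)" using Nt kappa_pos q by (intro mult_left_mono) auto
  also have "\<dots> = real N * (kappa / q * (t * tail t) / t)" using t by simp
  also have "\<dots> \<le> real N * (truncated_mean t / t)"
    using t by (intro mult_left_mono divide_right_mono) auto
  finally show "min 1 kappa / q ^ 5 * real m \<le> real N * (truncated_mean (tail_quantile p) / tail_quantile p)"
    by (simp add: t_def)
qed

text \<open>Replacing the block scale by \<open>n\<close> turns the upper threshold into
  \<open>p / q ^ 3\<close> and the lower one into \<open>q ^ 4 * p\<close>, the extra
  \<open>q\<close> being the length of a block. The exact limits have exponents 3/\<alpha> and
  -4/\<alpha>; 4 and 5 give strict room.\<close>

lemma eventually_quantile_ratio:
  assumes q: "1 < q"
  shows "\<forall>\<^sub>F p in at_right 0. tail_quantile (p / q ^ 3) \<le> q powr (4 / \<alpha>) * tail_quantile p \<and>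
    q powr - (5 / \<alpha>) * tail_quantile p \<le> tail_quantile (q ^ 4 * p)"
proof -
  have "(1 / q ^ 3) powr - (1 / \<alpha>) = q powr (3 / \<alpha>)"
  proof -
    have "1 / q ^ 3 = q powr (- 3)" using q by (simp add: powr_minus_divide)
    thus ?thesis by (simp only: powr_powr) simp
  qed
  moreover have "q powr (3 / \<alpha>) < q powr (4 / \<alpha>)"
    using q alpha by (intro powr_less_mono divide_strict_right_mono) auto
  ultimately have 1: "\<forall>\<^sub>F p in at_right 0. tail_quantile (1 / q ^ 3 * p) / tail_quantile p < q powr (4 / \<alpha>)"
    using q by (intro order_tendstoD(2)[OF tail_quantile_ratio]) auto
  have "(q ^ 4) powr - (1 / \<alpha>) = q powr - (4 / \<alpha>)"
  proof -
    have "q ^ 4 = q powr 4" using q by simp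
    thus ?thesis by (simp only: powr_powr) simp
  qed
  moreover have "q powr - (5 / \<alpha>) < q powr - (4 / \<alpha>)"
    using q alpha by (intro powr_less_mono) (auto intro: divide_strict_right_mono)
  ultimately have 2: "\<forall>\<^sub>F p in at_right 0. q powr - (5 / \<alpha>) < tail_quantile (q ^ 4 * p) / tail_quantile p"
    using q by (intro order_tendstoD(1)[OF tail_quantile_ratio]) auto
  have "\<forall>\<^sub>F p in at_right 0. 0 < tail_quantile p"
    using filterlim_tail_quantile by (simp add: filterlim_at_top_dense)
  with 1 2 show ?thesis
    by eventually_elim (simp add: divide_less_eq less_divide_eq less_imp_le)
qed

end

lemma filterlim_powr_at_top:
  fixes p :: real
  assumes "0 < p" shows "filterlim (\<lambda>x. x powr p) at_top at_top"
  unfolding filterlim_at_top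
proof
  fix Z :: real
  show "\<forall>\<^sub>F x in at_top. Z \<le> x powr p"
    using eventually_ge_at_top[of "max 1 Z powr (1 / p)"]
  proof eventually_elim
    case (elim x)
    hence "(max 1 Z powr (1 / p)) powr p \<le> x powr p"
      using assms by (intro powr_mono2) auto
    thus ?case using assms by (simp add: powr_powr)
  qed
qed

context heavy_tail_system
begin

text \<open>Thresholds are taken from the geometric scale \<open>q ^ i\<close> of times, so that within the range
  \<open>[e ^ k, e ^ (k + 1))\<close> only \<open>J\<close> scales and the possible values \<open>m\<close> of the trimming number have to be
  controlled. The union over \<open>m \<ge> ln (\<psi> k) / \<delta>\<close> costs a constant times \<open>1 / \<psi> k\<close>.\<close>

lemma AE_block_bounds:
  fixes b :: "nat \<Rightarrow> nat" and J :: nat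
  assumes b: "filterlim b at_top sequentially"
    and small: "((\<lambda>n. real (b n) / real n) \<longlongrightarrow> 0) sequentially"
    and psi: "\<psi> \<in> Psi"
    and lim: "filterlim (\<lambda>n. real (b n) / ln (\<psi> (nat \<lfloor>ln (real n)\<rfloor>))) at_top sequentially"
    and J: "0 < J" and q_def: "q = exp (1 / real J)"
  shows "AE x in M. \<forall>\<^sub>F n in sequentially.
    q powr - (5 / \<alpha>) * (kappa * real (b n) * tail_quantile (real (b n) / real n)) \<le> trimmed_sum T chi n (b n) x \<and>
    trimmed_sum T chi n (b n) x \<le> q * q powr (4 / \<alpha>) * (kappa * real (b n) * tail_quantile (real (b n) / real n))"
proof -
  have q: "1 < q" using J by (simp add: q_def)
  define e where "e = 1 - 1 / q"
  have e: "0 < e" "e \<le> 1" using q by (auto simp: e_def)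
  obtain c where c: "0 < c" "\<And>t n d. 0 < t \<Longrightarrow> d \<le> real n * tail t \<Longrightarrow> d \<le> real n * (truncated_mean t / t) \<Longrightarrow>
    prob (deviation_event e n t) \<le> 4 * exp (- c * d)"
    by (rule deviation_event_prob[OF e]) blast
  \<comment> \<open>The constant from the lower bound on the block means; times \<open>c\<close> it
    becomes the rate \<delta> of decay in \<open>m\<close>.\<close>
  define \<theta> where "\<theta> = min 1 kappa / q ^ 5"
  define \<delta> where "\<delta> = c * \<theta>"
  have \<theta>: "0 < \<theta>" using q kappa_pos by (simp add: \<theta>_def)
  have \<delta>: "0 < \<delta>" using c \<theta> by (simp add: \<delta>_def)
  obtain \<eta> where \<eta>: "0 < \<eta>" "\<And>p. 0 < p \<Longrightarrow> p < \<eta> \<Longrightarrow> good_threshold q p"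
    using eventually_good_threshold[OF q] unfolding eventually_at_right_field by auto
  define X where "X i = exp (real i / real J)" for i :: nat
  \<comment> \<open>\<open>hi i\<close> is an integer horizon at the end of the block from
    \<open>X i\<close> to \<open>q * X i\<close>, and \<open>lo i\<close> one at its start. Rounding
    keeps every \<open>n\<close> of the block between them.\<close>
  define hi where "hi i = nat \<lfloor>q * X i\<rfloor>" for i
  define lo where "lo i = nat \<lceil>X i\<rceil>" for i
  \<comment> \<open>The second condition makes the sum over \<open>m\<close> of order
    \<open>1 / \<psi> (i div J)\<close>; the third puts both thresholds below \<eta> and makes the
    set finite.\<close>
  define I where "I i = {m::nat. 0 < m \<and> ln (\<psi> (i div J)) \<le> \<delta> * real m \<and> q ^ 3 * real m < \<eta> * X i}" for i
  define A where "A i m = deviation_event e (hi i) (tail_quantile (real m / (X i * q ^ 3))) \<union>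
      deviation_event e (lo i) (tail_quantile (q ^ 3 * real m / X i))" for i m
  \<comment> \<open>From \<open>J\<close> on, \<open>i div J\<close> is positive and \<psi> is
    positive there. The other bound makes \<open>X i\<close> at least \<open>1 / (q - 1)\<close>, so
    that rounding down in \<open>hi i\<close> stays above \<open>X i\<close>.\<close>
  define i0 where "i0 = max J (nat \<lceil>real J * ln (1 / (q - 1))\<rceil>)"
  define E where "E i = (if i < i0 then {} else (\<Union>m\<in>I i. A i m))" for i
  have X: "0 < X i" for i by (simp add: X_def)
  have q3: "1 \<le> q ^ 3" using q by simp
  have finI: "finite (I i)" for i
  proof (rule finite_subset)
    show "I i \<subseteq> {..nat \<lfloor>\<eta> * X i\<rfloor>}"
    proof
      fix m assume "m \<in> I i"
      hence "q ^ 3 * real m < \<eta> * X i" by (simp add: I_def)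
      moreover have "1 * real m \<le> q ^ 3 * real m" using q3 by (intro mult_right_mono) auto
      ultimately have "real m \<le> \<eta> * X i" by linarith
      thus "m \<in> {..nat \<lfloor>\<eta> * X i\<rfloor>}" by (simp add: le_nat_floor)
    qed
  qed simp
  have thresholds: "good_threshold q (real m / (X i * q ^ 3))" "good_threshold q (q ^ 3 * real m / X i)"
    "real m / (X i * q ^ 3) \<le> q ^ 3 * real m / X i"
    if m: "m \<in> I i" for i m
  proof -
    have m': "0 < real m" "q ^ 3 * real m / X i < \<eta>"
      using m X[of i] by (auto simp: I_def divide_less_eq)
    have "real m / (X i * q ^ 3) \<le> real m / X i"
      using q3 X[of i] m' by (intro frac_le) (auto simp: mult_le_cancel_left1)
    also have "\<dots> \<le> q ^ 3 * real m / X i"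
      using q3 X[of i] m' by (intro divide_right_mono) (auto simp: mult_le_cancel_right1)
    finally show le: "real m / (X i * q ^ 3) \<le> q ^ 3 * real m / X i" .
    have "0 < real m / (X i * q ^ 3)" using m' X[of i] q by simp
    thus "good_threshold q (real m / (X i * q ^ 3))" "good_threshold q (q ^ 3 * real m / X i)"
      using le m' by (auto intro!: \<eta>(2))
  qed
  have hi: "X i \<le> real (hi i)" "real (hi i) \<le> q * X i" and lo: "X i \<le> real (lo i)" if i: "i0 \<le> i" for i
  proof -
    have "real J * ln (1 / (q - 1)) \<le> real i" using i unfolding i0_def by linarith
    hence "ln (1 / (q - 1)) \<le> real i / real J" using J by (simp add: field_simps)
    hence "exp (ln (1 / (q - 1))) \<le> X i" unfolding X_def by (simp only: exp_le_cancel_iff)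
    moreover have "exp (ln (1 / (q - 1))) = 1 / (q - 1)" using q by (intro exp_ln) auto
    ultimately have "1 / (q - 1) \<le> X i" by linarith
    hence "X i + 1 \<le> q * X i" using q by (simp add: field_simps)
    thus "X i \<le> real (hi i)" unfolding hi_def by linarith
    have "0 \<le> q * X i" using q X[of i] by simp
    thus "real (hi i) \<le> q * X i" unfolding hi_def by linarith
    show "X i \<le> real (lo i)" unfolding lo_def using X[of i] by linarith
  qed
  have A_prob: "prob (A i m) \<le> 8 * exp (- \<delta> * real m)" if i: "i0 \<le> i" and m: "m \<in> I i" for i m
  proof -
    have good: "0 < tail_quantile p" if "good_threshold q p" for p
      using that by (simp add: good_threshold_def)
    have "prob (deviation_event e (hi i) (tail_quantile (real m / (X i * q ^ 3)))) \<le> 4 * exp (- c * (\<theta> * real m))"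
      unfolding \<theta>_def
      by (intro c(2) good thresholds(1)[OF m] block_mean_lower[OF q X hi(1)[OF i] order_refl])
    moreover have "prob (deviation_event e (lo i) (tail_quantile (q ^ 3 * real m / X i))) \<le> 4 * exp (- c * (\<theta> * real m))"
      unfolding \<theta>_def
      by (intro c(2) good thresholds(2)[OF m] block_mean_lower[OF q X lo[OF i] thresholds(3)[OF m]])
    moreover have "prob (A i m) \<le> prob (deviation_event e (hi i) (tail_quantile (real m / (X i * q ^ 3)))) +
        prob (deviation_event e (lo i) (tail_quantile (q ^ 3 * real m / X i)))"
      unfolding A_def by (rule measure_Un_le) measurable
    ultimately show ?thesis by (simp add: \<delta>_def mult.assoc)
  qed
  have A_sets: "A i m \<in> sets M" for i m unfolding A_def by measurable
  have E_sets: "E i \<in> sets M" for i unfolding E_def using finI A_sets by auto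
  \<comment> \<open>The value of \<psi> at 0 is unrestricted and is masked.\<close>
  define g where "g k = (if k = 0 then 0 else 1 / \<psi> k)" for k
  have psi_pos: "0 < \<psi> k" if "0 < k" for k using psi that by (simp add: Psi_def)
  have "summable (\<lambda>k. g (Suc k))" using psi by (simp add: Psi_def g_def)
  hence "summable g" by (simp add: summable_Suc_iff)
  moreover have "0 \<le> g k" for k using psi_pos[of k] by (simp add: g_def less_imp_le)
  ultimately have sum_g: "summable (\<lambda>i. 8 / (1 - exp (- \<delta>)) * g (i div J))"
    using J by (intro summable_mult summable_comp_div)
  have E_prob: "prob (E i) \<le> 8 / (1 - exp (- \<delta>)) * g (i div J)" if i: "i0 \<le> i" for i
  proof -
    have "J \<le> i" using i by (simp add: i0_def)
    hence k: "0 < i div J" using J by (simp add: div_greater_zero_iff)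
    have "prob (E i) \<le> (\<Sum>m\<in>I i. prob (A i m))"
      using i A_sets finI by (auto simp: E_def intro: finite_measure_subadditive_finite)
    also have "\<dots> \<le> (\<Sum>m\<in>I i. 8 * exp (- \<delta> * real m))"
      by (intro sum_mono A_prob i)
    also have "\<dots> = 8 * (\<Sum>m\<in>I i. exp (- \<delta> * real m))" by (simp add: sum_distrib_left)
    also have "\<dots> \<le> 8 * (exp (- ln (\<psi> (i div J))) / (1 - exp (- \<delta>)))"
      using finI \<delta> by (intro mult_left_mono sum_exp_tail_le) (auto simp: I_def)
    also have "exp (- ln (\<psi> (i div J))) = g (i div J)"
      using psi_pos[OF k] k by (simp add: exp_minus g_def inverse_eq_divide)
    finally show ?thesis by simp
  qed
  have "summable (\<lambda>i. prob (E i))"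
    by (rule summable_comparison_test'[OF sum_g, of i0]) (use E_prob in auto)
  hence "AE x in M. \<forall>\<^sub>F i in sequentially. x \<in> space M - E i"
    using E_sets by (intro borel_cantelli_AE1) (auto simp: less_top[symmetric])
  \<comment> \<open>The index of the block that contains \<open>n\<close>.\<close>
  define ix where "ix n = nat \<lfloor>real J * ln (real n)\<rfloor>" for n :: nat
  have ix_lim: "filterlim ix at_top sequentially"
  proof -
    have "filterlim (\<lambda>n. real J * ln (real n)) at_top sequentially"
      using J by (intro filterlim_tendsto_pos_mult_at_top[OF tendsto_const]
          filterlim_compose[OF ln_at_top filterlim_real_sequentially]) auto
    thus ?thesis
      unfolding ix_def
      by (intro filterlim_compose[OF filterlim_nat_sequentially] filterlim_compose[OF filterlim_floor_sequentially])
  qed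
  have X_ix: "X (ix n) \<le> real n" "real n < q * X (ix n)" if n: "0 < n" for n
  proof -
    have "0 \<le> real J * ln (real n)" using n by simp
    hence *: "real (ix n) \<le> real J * ln (real n)" "real J * ln (real n) < real (ix n) + 1"
      unfolding ix_def by linarith+
    have "real (ix n) / real J \<le> ln (real n)" "ln (real n) < (real (ix n) + 1) / real J"
      using * J by (auto simp: divide_le_eq less_divide_eq mult.commute)
    hence "exp (real (ix n) / real J) \<le> exp (ln (real n))" "exp (ln (real n)) < exp ((real (ix n) + 1) / real J)"
      by simp_all
    thus "X (ix n) \<le> real n" "real n < q * X (ix n)"
      using n by (simp_all add: X_def q_def add_divide_distrib exp_add mult.commute)
  qed
  have "\<forall>\<^sub>F n in sequentially. 1 \<le> b n"
    using b unfolding filterlim_at_top by blast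
  hence b_pos: "\<forall>\<^sub>F n in sequentially. 0 < b n" by eventually_elim auto
  have p_lim: "filterlim (\<lambda>n. real (b n) / real n) (at_right 0) sequentially"
    unfolding filterlim_at
  proof
    show "\<forall>\<^sub>F n in sequentially. real (b n) / real n \<in> {0<..} \<and> real (b n) / real n \<noteq> 0"
      using b_pos eventually_gt_at_top[of 0] by eventually_elim auto
  qed (rule small)
  \<comment> \<open>Here the growth condition on \<open>b\<close> enters: eventually the quotient
    exceeds 1/\<delta>. A nonpositive logarithm is harmless, as the required inequality is then
    trivial.\<close>
  have in_I: "\<forall>\<^sub>F n in sequentially. b n \<in> I (ix n)"
  proof -
    have "\<forall>\<^sub>F n in sequentially. real (b n) / real n < \<eta> / q ^ 4"
      using order_tendstoD(2)[OF small, of "\<eta> / q ^ 4"] \<eta> q by simp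
    moreover have "\<forall>\<^sub>F n in sequentially. 1 / \<delta> < real (b n) / ln (\<psi> (nat \<lfloor>ln (real n)\<rfloor>))"
      using lim by (simp add: filterlim_at_top_dense)
    ultimately show ?thesis
      using b_pos eventually_gt_at_top[of 0]
    proof eventually_elim
      case (elim n)
      have "ix n div J = nat \<lfloor>ln (real n)\<rfloor>"
        unfolding ix_def using elim J by (intro nat_floor_mult_div) auto
      moreover have "ln (\<psi> (nat \<lfloor>ln (real n)\<rfloor>)) \<le> \<delta> * real (b n)"
      proof (cases "0 < ln (\<psi> (nat \<lfloor>ln (real n)\<rfloor>))")
        case True
        have "1 / \<delta> * ln (\<psi> (nat \<lfloor>ln (real n)\<rfloor>)) < real (b n)"
          using elim(2) True by (simp add: less_divide_eq)
        thus ?thesis using \<delta> by (simp add: field_simps)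
      next
        case False
        thus ?thesis using \<delta> mult_nonneg_nonneg[of \<delta> "real (b n)"] by linarith
      qed
      moreover have "q ^ 3 * real (b n) < \<eta> * X (ix n)"
      proof -
        have "real (b n) * q ^ 4 < \<eta> * real n"
          using elim q by (simp add: field_simps)
        also have "\<dots> < \<eta> * (q * X (ix n))" using X_ix[OF elim(4)] \<eta> by simp
        finally have "q * (q ^ 3 * real (b n)) < q * (\<eta> * X (ix n))"
          by (simp add: power_numeral_reduce mult_ac)
        thus ?thesis using q by simp
      qed
      ultimately show ?case using elim by (simp add: I_def)
    qed
  qed
  have ratio: "\<forall>\<^sub>F n in sequentially.
      tail_quantile (real (b n) / real n / q ^ 3) \<le> q powr (4 / \<alpha>) * tail_quantile (real (b n) / real n) \<and>
      q powr - (5 / \<alpha>) * tail_quantile (real (b n) / real n) \<le> tail_quantile (q ^ 4 * (real (b n) / real n))"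
    by (rule eventually_compose_filterlim[OF eventually_quantile_ratio[OF q] p_lim])
  from \<open>AE x in M. \<forall>\<^sub>F i in sequentially. x \<in> space M - E i\<close> show ?thesis
  proof eventually_elim
    case (elim x)
    have "\<forall>\<^sub>F n in sequentially. x \<in> space M - E (ix n)"
      by (rule eventually_compose_filterlim[OF elim ix_lim])
    moreover have "\<forall>\<^sub>F n in sequentially. i0 \<le> ix n"
      using ix_lim by (simp add: filterlim_at_top)
    ultimately show ?case
      using in_I ratio eventually_gt_at_top[of 0] b_pos
    proof eventually_elim
      case (elim n)
      define i where "i = ix n"
      define m where "m = b n"
      have x: "x \<in> space M" "x \<notin> A i m"
        using elim(1,2,3) by (auto simp: E_def i_def m_def)
      have m: "m \<in> I i" using elim(3) by (simp add: i_def m_def)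
      have i: "i0 \<le> i" using elim by (simp add: i_def)
      have Xn: "X i \<le> real n" "real n < q * X i" using X_ix elim(5) by (auto simp: i_def)
      have mpos: "0 < real m" using elim by (simp add: m_def)
      have n: "0 < real n" using elim by simp
      have "n \<le> hi i" unfolding hi_def using Xn(2) by (intro le_nat_floor) simp
      have up: "trimmed_sum T chi n m x \<le> q * kappa * real m * tail_quantile (real m / (X i * q ^ 3))"
        using x by (intro block_upper[OF q X hi(2)[OF i] \<open>n \<le> hi i\<close> refl thresholds(1)[OF m]])
          (auto simp: A_def e_def)
      have "lo i \<le> n" unfolding lo_def using Xn(1) by (simp add: ceiling_le_iff)
      have low: "kappa * real m * tail_quantile (q ^ 3 * real m / X i) \<le> trimmed_sum T chi n m x"
        using x by (intro block_lower[OF q X lo[OF i] \<open>lo i \<le> n\<close> refl thresholds(2)[OF m]])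
          (auto simp: A_def e_def)
      have "tail_quantile (real m / (X i * q ^ 3)) \<le> tail_quantile (real m / real n / q ^ 3)"
      proof (rule tail_quantile_antimono)
        show "real m / real n / q ^ 3 \<le> real m / (X i * q ^ 3)"
          unfolding divide_divide_eq_left using Xn X[of i] q mpos
          by (intro divide_left_mono mult_right_mono mult_pos_pos) auto
      qed (use mpos n q in auto)
      also have "\<dots> \<le> q powr (4 / \<alpha>) * tail_quantile (real m / real n)"
        using elim(4) by (simp add: m_def)
      finally have "q * kappa * real m * tail_quantile (real m / (X i * q ^ 3)) \<le>
          q * kappa * real m * (q powr (4 / \<alpha>) * tail_quantile (real m / real n))"
        using q kappa_pos by (intro mult_left_mono) auto
      with up have 1: "trimmed_sum T chi n m x \<le> q * q powr (4 / \<alpha>) * (kappa * real m * tail_quantile (real m / real n))"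
        by (simp add: mult_ac)
      have "q powr - (5 / \<alpha>) * tail_quantile (real m / real n) \<le> tail_quantile (q ^ 4 * (real m / real n))"
        using elim(4) by (simp add: m_def)
      also have "\<dots> \<le> tail_quantile (q ^ 3 * real m / X i)"
      proof (rule tail_quantile_antimono)
        have "q ^ 3 * real m * real n \<le> q ^ 3 * real m * (q * X i)"
          using Xn q mpos by (intro mult_left_mono) auto
        thus "q ^ 3 * real m / X i \<le> q ^ 4 * (real m / real n)"
          using n X[of i] by (simp add: divide_le_eq le_divide_eq power_numeral_reduce mult_ac)
      qed (use mpos X[of i] q in auto)
      finally have "kappa * real m * (q powr - (5 / \<alpha>) * tail_quantile (real m / real n)) \<le>
          kappa * real m * tail_quantile (q ^ 3 * real m / X i)"
        using kappa_pos by (intro mult_left_mono) auto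
      with low have 2: "q powr - (5 / \<alpha>) * (kappa * real m * tail_quantile (real m / real n)) \<le> trimmed_sum T chi n m x"
        by (simp add: mult_ac)
      show ?case using 1 2 unfolding m_def by blast
    qed
  qed
qed

text \<open>Each \<open>q\<close> leaves a multiplicative error depending on \<open>q\<close> only.
  Along a sequence decreasing to 1 the exceptional null sets can be united and the errors
  vanish.\<close>

theorem AE_trimmed_sum_asymptotic:
  fixes b :: "nat \<Rightarrow> nat"
  assumes b: "filterlim b at_top sequentially"
    and small: "((\<lambda>n. real (b n) / real n) \<longlongrightarrow> 0) sequentially"
    and psi: "\<psi> \<in> Psi"
    and lim: "filterlim (\<lambda>n. real (b n) / ln (\<psi> (nat \<lfloor>ln (real n)\<rfloor>))) at_top sequentially"
    and d: "\<forall>\<^sub>F n in sequentially. d n = kappa * real (b n) * tail_quantile (real (b n) / real n) \<and> 0 < d n"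
  shows "AE x in M. (\<lambda>n. trimmed_sum T chi n (b n) x / d n) \<longlonglongrightarrow> 1"
proof -
  define q where "q J = exp (1 / real (Suc J))" for J
  have "AE x in M. \<forall>J. \<forall>\<^sub>F n in sequentially.
    q J powr - (5 / \<alpha>) * (kappa * real (b n) * tail_quantile (real (b n) / real n)) \<le> trimmed_sum T chi n (b n) x \<and>
    trimmed_sum T chi n (b n) x \<le> q J * q J powr (4 / \<alpha>) * (kappa * real (b n) * tail_quantile (real (b n) / real n))"
    unfolding AE_all_countable by (intro allI AE_block_bounds[OF b small psi lim, of "Suc _"]) (auto simp: q_def)
  thus ?thesis
  proof eventually_elim
    case (elim x)
    have bounds: "\<forall>\<^sub>F n in sequentially. q J powr - (5 / \<alpha>) \<le> trimmed_sum T chi n (b n) x / d n \<and>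
        trimmed_sum T chi n (b n) x / d n \<le> q J * q J powr (4 / \<alpha>)" for J
      using elim[rule_format, of J] d
      by eventually_elim (simp add: le_divide_eq divide_le_eq)
    have "(\<lambda>J. 1 / real (Suc J)) \<longlonglongrightarrow> 0"
      using LIMSEQ_inverse_real_of_nat by (simp add: inverse_eq_divide)
    hence "q \<longlonglongrightarrow> exp 0" unfolding q_def by (intro tendsto_intros)
    hence q_lim: "q \<longlonglongrightarrow> 1" by simp
    have "(\<lambda>J. q J powr - (5 / \<alpha>)) \<longlonglongrightarrow> 1 powr - (5 / \<alpha>)" by (intro tendsto_intros q_lim) simp
    hence lower: "(\<lambda>J. q J powr - (5 / \<alpha>)) \<longlonglongrightarrow> 1" by simp
    have "(\<lambda>J. q J * q J powr (4 / \<alpha>)) \<longlonglongrightarrow> 1 * 1 powr (4 / \<alpha>)" by (intro tendsto_intros q_lim) simp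
    hence upper: "(\<lambda>J. q J * q J powr (4 / \<alpha>)) \<longlonglongrightarrow> 1" by simp
    show ?case
    proof (rule order_tendstoI)
      fix a :: real assume "a < 1"
      hence "\<forall>\<^sub>F J in sequentially. a < q J powr - (5 / \<alpha>)" by (rule order_tendstoD(1)[OF lower])
      then obtain J where "a < q J powr - (5 / \<alpha>)" by (auto simp: eventually_sequentially)
      thus "\<forall>\<^sub>F n in sequentially. a < trimmed_sum T chi n (b n) x / d n"
        using bounds[of J] by (auto elim!: eventually_mono)
    next
      fix a :: real assume "1 < a"
      hence "\<forall>\<^sub>F J in sequentially. q J * q J powr (4 / \<alpha>) < a" by (rule order_tendstoD(2)[OF upper])
      then obtain J where "q J * q J powr (4 / \<alpha>) < a" by (auto simp: eventually_sequentially)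
      thus "\<forall>\<^sub>F n in sequentially. trimmed_sum T chi n (b n) x / d n < a"
        using bounds[of J] by (auto elim!: eventually_mono)
    qed
  qed
qed

text \<open>With \<open>y\<close> the power 1/\<alpha> of \<open>n / b n\<close>, the argument y
  powr - \<alpha> of the quantile is \<open>b n / n\<close>, and the two explicit powers combine to
  \<open>b n * y\<close>; the rest is the asymptotics of the conjugate.\<close>

lemma norming_asymptotic:
  fixes b :: "nat \<Rightarrow> nat"
  assumes p_lim: "filterlim (\<lambda>n. real (b n) / real n) (at_right 0) sequentially"
    and d: "\<forall>\<^sub>F n in sequentially. d n = kappa * real (b n) * tail_quantile (real (b n) / real n) \<and> 0 < d n"
  shows "d \<sim>[sequentially] (\<lambda>n. \<alpha> / (1 - \<alpha>) * real n powr (1 / \<alpha>) * real (b n) powr (1 - 1 / \<alpha>) *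
      de_bruijn_conjugate (\<lambda>x. L x powr (- 1 / \<alpha>)) ((real n / real (b n)) powr (1 / \<alpha>)))"
proof -
  let ?C = "de_bruijn_conjugate (\<lambda>x. L x powr (- 1 / \<alpha>))"
  let ?y = "\<lambda>n. (real n / real (b n)) powr (1 / \<alpha>)"
  have p_pos: "\<forall>\<^sub>F n in sequentially. 0 < real (b n) / real n"
    using p_lim unfolding filterlim_at by (auto elim: eventually_mono)
  have "filterlim (\<lambda>n. inverse (real (b n) / real n)) at_top sequentially"
    by (rule filterlim_compose[OF filterlim_inverse_at_top_right p_lim])
  hence "filterlim (\<lambda>n. real n / real (b n)) at_top sequentially" by simp
  hence y_lim: "filterlim ?y at_top sequentially"
    using alpha by (intro filterlim_compose[OF filterlim_powr_at_top]) auto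
  have "((\<lambda>n. ?y n * ?C (?y n) / tail_quantile (?y n powr - \<alpha>)) \<longlongrightarrow> 1) sequentially"
    by (rule filterlim_compose[OF conjugate_quantile[OF tail_eq] y_lim])
  from tendsto_inverse[OF this]
  have "((\<lambda>n. inverse (?y n * ?C (?y n) / tail_quantile (?y n powr - \<alpha>))) \<longlongrightarrow> 1) sequentially" by simp
  thus ?thesis
  proof (intro asymp_equivI', rule Lim_transform_eventually)
    show "\<forall>\<^sub>F n in sequentially. inverse (?y n * ?C (?y n) / tail_quantile (?y n powr - \<alpha>)) =
        d n / (\<alpha> / (1 - \<alpha>) * real n powr (1 / \<alpha>) * real (b n) powr (1 - 1 / \<alpha>) * ?C (?y n))"
      using p_pos d
    proof eventually_elim
      case (elim n)
      have bn: "0 < real (b n)" "0 < real n" using elim(1) by (auto simp: zero_less_divide_iff)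
      have "?y n powr - \<alpha> = (real n / real (b n)) powr - 1" using alpha by (simp add: powr_powr)
      also have "\<dots> = real (b n) / real n" using bn by (simp add: powr_minus_divide)
      finally have y: "?y n powr - \<alpha> = real (b n) / real n" .
      have "real n powr (1 / \<alpha>) * real (b n) powr (1 - 1 / \<alpha>) = real (b n) * ?y n"
        using bn by (simp add: powr_divide powr_diff)
      hence "\<alpha> / (1 - \<alpha>) * real n powr (1 / \<alpha>) * real (b n) powr (1 - 1 / \<alpha>) * ?C (?y n) =
          kappa * real (b n) * (?y n * ?C (?y n))"
        by (simp add: kappa_def mult.assoc)
      thus ?case using elim(2) kappa_pos bn unfolding y by simp
    qed
  qed
qed

end

theorem theorem1p7:
  fixes M :: "'a measure" and T :: "'a \<Rightarrow> 'a"
    and F :: "('a \<Rightarrow> complex) set" and nrm :: "('a \<Rightarrow> complex) \<Rightarrow> real"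
    and chi :: "'a \<Rightarrow> real" and L :: "real \<Rightarrow> real" and \<alpha> :: real and b :: "nat \<Rightarrow> nat"
  assumes "property_D M T F nrm chi"
    and "0 < \<alpha>" and "\<alpha> < 1"
    and "slowly_varying L"
    and "\<And>x. x > 0 \<Longrightarrow> measure M {w \<in> space M. chi w > x} = L x / x powr \<alpha>"
    and "filterlim b at_top sequentially"
    and "(\<lambda>n. real (b n)) \<in> o(\<lambda>n. real n)"
    and "\<exists>\<psi>\<in>Psi. filterlim (\<lambda>n. real (b n) / ln (\<psi> (nat \<lfloor>ln (real n)\<rfloor>))) at_top sequentially"
  shows "\<exists>d :: nat \<Rightarrow> real.
           (\<forall>n. d n > 0) \<and>
           (AE x in M. (\<lambda>n. trimmed_sum T chi n (b n) x / d n) \<longlonglongrightarrow> 1) \<and>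
           d \<sim>[sequentially]
             (\<lambda>n. \<alpha> / (1 - \<alpha>) * real n powr (1 / \<alpha>) * real (b n) powr (1 - 1 / \<alpha>) *
                  de_bruijn_conjugate (\<lambda>x. L x powr (- 1 / \<alpha>))
                    ((real n / real (b n)) powr (1 / \<alpha>)))"
proof -
  interpret heavy_tail_system M T F nrm chi L \<alpha>
  proof
    show "property_C M T F nrm" using assms(1) by (simp add: property_D_def)
  qed (use assms in auto)
  have small: "((\<lambda>n. real (b n) / real n) \<longlongrightarrow> 0) sequentially"
    by (rule smalloD_tendsto[OF assms(7)])
  have "\<forall>\<^sub>F n in sequentially. 1 \<le> b n"
    using assms(6) unfolding filterlim_at_top by blast
  hence b_pos: "\<forall>\<^sub>F n in sequentially. 0 < b n" by eventually_elim auto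
  hence "\<forall>\<^sub>F n in sequentially. real (b n) / real n \<in> {0<..} \<and> real (b n) / real n \<noteq> 0"
    using eventually_gt_at_top[of 0] by eventually_elim auto
  with small have p_lim: "filterlim (\<lambda>n. real (b n) / real n) (at_right 0) sequentially"
    by (simp add: filterlim_at)
  define d0 where "d0 n = kappa * real (b n) * tail_quantile (real (b n) / real n)" for n
  \<comment> \<open>The sequence must be positive at every index, \<open>d0\<close> is so only
    eventually; 1 is a filler for the remaining indices.\<close>
  define d where "d n = (if 0 < d0 n then d0 n else 1)" for n
  have "\<forall>\<^sub>F n in sequentially. 0 < tail_quantile (real (b n) / real n)"
    using filterlim_compose[OF filterlim_tail_quantile p_lim] by (simp add: filterlim_at_top_dense)
  with b_pos have d: "\<forall>\<^sub>F n in sequentially. d n = kappa * real (b n) * tail_quantile (real (b n) / real n) \<and> 0 < d n"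
    by eventually_elim (use kappa_pos in \<open>simp add: d_def d0_def\<close>)
  obtain \<psi> where psi: "\<psi> \<in> Psi"
    "filterlim (\<lambda>n. real (b n) / ln (\<psi> (nat \<lfloor>ln (real n)\<rfloor>))) at_top sequentially"
    using assms(8) by blast
  show ?thesis
  proof (intro exI[of _ d] conjI)
    show "\<forall>n. 0 < d n" by (simp add: d_def)
    show "AE x in M. (\<lambda>n. trimmed_sum T chi n (b n) x / d n) \<longlonglongrightarrow> 1"
      by (rule AE_trimmed_sum_asymptotic[OF assms(6) small psi d])
  qed (rule norming_asymptotic[OF p_lim d])
qed

end
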